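(* Fix $\alpha>0$ and $\rho>0$. Then there exist constants $L_0,\rho^*,C_1>0$ such that for all $L\ge L_0$ and all initial conditions $x(0)\in\mathcal{B}_{L,\rho}$ the following holds, with $T:=\alpha L^{2k-3}$: (i) $x(t)\in\mathcal{B}_{L,\rho^*}$ for all $0\le t\le T$; (ii) $H(x(T))-H(x(0))\le -C_1\,\dfrac{T}{L^{4k-6}}$.
   Context: Fix integers $n\ge 2$ and $k$ with $2\le k\le n$. The phase space is $\Omega=\mathbb{R}^n\times\mathbb{T}^n$, with $\mathbb{T}=\mathbb{R}/2\pi\mathbb{Z}$, with points $x=(\mathbf{I},\boldsymbol{\phi})$, $\mathbf{I}=(I_1,\dots,I_n)$, $\boldsymbol{\phi}=(\phi_1,\dots,\phi_n)$. For $i=1,\dots,n-1$, $U_i:\mathbb{T}\to\mathbb{R}$ is a real smooth function whose Fourier series contains only finitely many modes, has no constant mode, and which is non-degenerate: there is no $\phi\in\mathbb{T}$ with $U_i'(\phi)=U_i''(\phi)=0$. The Hamiltonian is $H(\mathbf{I},\boldsymbol{\phi})=\frac12\sum_{i=1}^n I_i^2+\sum_{i=1}^{n-1}U_i(\phi_{i+1}-\phi_i)$. Fix $\gamma>0$; $x(t)$ denotes the solution of $\dot I_i=-\partial_{\phi_i}H-\delta_{i,1}\gamma I_1$, $\dot\phi_i=\partial_{I_i}H$ ($i=1,\dots,n$). For $L,\rho>0$, $\mathcal{B}_{L,\rho}=\{(\mathbf{I},\boldsymbol{\phi})\in\Omega:\ |I_i-L\delta_{i,k}|<\rho,\ i=1,\dots,n\}$.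 *)

theory Defs
  imports "HOL-Analysis.Analysis"
begin

text \<open>Angles on the torus are represented by real lifts; all data are 2pi-periodic in
the angles, so solutions of the lifted system project to solutions on the torus.\<close>

text \<open>A real trigonometric polynomial with finitely many modes and no constant mode
(this makes U smooth and 2pi-periodic, i.e. a function on the circle).\<close>
definition finite_fourier_no_const :: "(real \<Rightarrow> real) \<Rightarrow> bool" where
  "finite_fourier_no_const f \<longleftrightarrow>
     (\<exists>N::nat. \<exists>a b :: nat \<Rightarrow> real.
        \<forall>x. f x = (\<Sum>m=1..N. a m * cos (real m * x) + b m * sin (real m * x)))"

definition nondegenerate :: "(real \<Rightarrow> real) \<Rightarrow> bool" where
  "nondegenerate f \<longleftrightarrow> \<not> (\<exists>x. deriv f x = 0 \<and> deriv (deriv f) x = 0)"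

definition Ham :: "nat \<Rightarrow> (nat \<Rightarrow> real \<Rightarrow> real) \<Rightarrow> (nat \<Rightarrow> real) \<Rightarrow> (nat \<Rightarrow> real) \<Rightarrow> real" where
  "Ham n U I phi = (1/2) * (\<Sum>i=1..n. (I i)\<^sup>2) + (\<Sum>i=1..n-1. U i (phi (Suc i) - phi i))"

definition is_solution ::
  "nat \<Rightarrow> (nat \<Rightarrow> real \<Rightarrow> real) \<Rightarrow> real \<Rightarrow> real \<Rightarrow> (real \<Rightarrow> nat \<Rightarrow> real) \<Rightarrow> (real \<Rightarrow> nat \<Rightarrow> real) \<Rightarrow> bool" where
  "is_solution n U \<gamma> T I phi \<longleftrightarrow>
     (\<forall>t\<in>{0..T}. \<forall>i\<in>{1..n}.
        ((\<lambda>s. I s i) has_real_derivative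
           (- deriv (\<lambda>y. Ham n U (I t) ((phi t)(i := y))) (phi t i)
            - (if i = 1 then \<gamma> * I t 1 else 0))) (at t within {0..T})
      \<and> ((\<lambda>s. phi s i) has_real_derivative I t i) (at t within {0..T}))"

definition in_B :: "nat \<Rightarrow> nat \<Rightarrow> real \<Rightarrow> real \<Rightarrow> (nat \<Rightarrow> real) \<Rightarrow> bool" where
  "in_B n k L \<rho> I \<longleftrightarrow> (\<forall>i\<in>{1..n}. \<bar>I i - (if i = k then L else 0)\<bar> < \<rho>)"

end

theory Submission
  imports Defs
begin

text \<open>Put \<open>\<epsilon> = 2 * pi / L\<close> and \<open>s = t / \<epsilon>\<close>. Then the fast phase is \<open>2 * pi * s\<close> plus a slow function, all
  other variables are slow, and the equations have period 1 in \<open>s\<close>.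

  Confinement. Interpolate the trajectory at the times \<open>s, s + 1, \<dots>, s + N\<close> by polynomials; as the
  \<open>j\<close>-th differences are \<open>O(\<epsilon> ^ j)\<close>, the slope \<open>D\<close> of the interpolant is a derivation up to
  \<open>O(\<epsilon> ^ (N + 1))\<close>, blind to the fast oscillation. Noether's argument for the approximate symmetry
  \<open>D\<close> shows that \<open>Y = (\<Sum>i. y i * D (p i)) / \<epsilon> - D \<Lambda>\<close>, with \<open>\<Lambda>\<close> a primitive of the Lagrangian,
  satisfies \<open>Y' = - \<gamma> * y 1 * D (p 1) + O(\<epsilon> ^ (N + 1))\<close>. Since \<open>p 1\<close> differs from its slow part
  only by \<open>O(\<epsilon> ^ k)\<close>, the right-hand side is at most \<open>O(\<epsilon> ^ (2 * k - 1))\<close>, and \<open>Y\<close> is close to the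
  energy in the frame of the fast rotator, which controls all momenta.

  Dissipation. If the first momentum were much smaller than \<open>\<epsilon> ^ (2 * k - 3)\<close> on a window of length
  1 in \<open>s\<close>, then so would be its derivatives, by interpolation; non-degeneracy of the potentials
  allows solving the equations of motion for the next rotator, at the cost of a factor
  \<open>\<epsilon> ^ 2\<close>, until the rotator \<open>k\<close> itself is found to be nearly at rest.\<close>

text \<open>The Hamiltonian itself cannot confine the momenta: up to a constant it is
  \<open>E p y s + 2 * pi / \<epsilon> * y k s\<close>, in which the deviation of the fast momentum
  enters with a factor of order \<open>L\<close>. The energy \<open>E\<close> does control them, but
  it is not conserved: per unit of \<open>s\<close> the force on the fast rotator may change it by
  O(1), and the horizon is of order \<open>1 / \<epsilon> ^ N\<close>. Normal form theory would
  remove this by successive changes of variables. Here finite differences of unit step take their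
  place: they act on one given trajectory, and a dependence of period 1 in \<open>s\<close> drops
  out of them exactly, leaving no averaging remainder. The confinement is a bootstrap: the estimates
  assume momenta of size at most \<open>R\<close>, and their constants depend on \<open>R\<close>
  only in front of positive powers of \<open>\<epsilon>\<close>; the one term that stays of order
  one is independent of \<open>R\<close>, so \<open>R\<close> can be chosen after it. For the
  dissipation, the first momentum may change sign, so it is bounded below only on some part of each
  unit window.\<close>

section \<open>Functions with weighted bounds on their derivatives\<close>

text \<open>The weight \<open>w j\<close> bounds the \<open>j\<close>-th derivative; powers of
  \<open>\<epsilon>\<close> in it record how slow a function is. The derivatives are quantified
  existentially and taken within \<open>X\<close>, so that inductions on the order need no formula
  for higher derivatives and the windows may be closed intervals.\<close>

fun derivs_le :: "nat \<Rightarrow> real set \<Rightarrow> (nat \<Rightarrow> real) \<Rightarrow> (real \<Rightarrow> real) \<Rightarrow> bool" where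
  "derivs_le 0 X w f = (\<forall>x\<in>X. \<bar>f x\<bar> \<le> w 0)"
| "derivs_le (Suc m) X w f = ((\<forall>x\<in>X. \<bar>f x\<bar> \<le> w 0) \<and>
     (\<exists>f'. (\<forall>x\<in>X. (f has_real_derivative f' x) (at x within X)) \<and> derivs_le m X (\<lambda>j. w (Suc j)) f'))"

lemma derivs_le_0D: "derivs_le m X w f \<Longrightarrow> x \<in> X \<Longrightarrow> \<bar>f x\<bar> \<le> w 0"
  by (cases m) auto

lemma derivs_le_SucI:
  assumes "\<And>x. x \<in> X \<Longrightarrow> \<bar>f x\<bar> \<le> w 0"
    and "\<And>x. x \<in> X \<Longrightarrow> (f has_real_derivative f' x) (at x within X)"
    and "derivs_le m X (\<lambda>j. w (Suc j)) f'"
  shows "derivs_le (Suc m) X w f"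
  using assms by auto

lemma derivs_le_mono:
  assumes "derivs_le m X w f" "m' \<le> m" "\<And>j. j \<le> m' \<Longrightarrow> w j \<le> w' j"
  shows "derivs_le m' X w' f"
  using assms
proof (induction m arbitrary: m' w w' f)
  case 0
  then show ?case by force
next
  case (Suc m)
  show ?case
  proof (cases m')
    case 0
    then show ?thesis using Suc.prems by force
  next
    case (Suc l)
    obtain f' where f': "\<forall>x\<in>X. (f has_real_derivative f' x) (at x within X)"
      "derivs_le m X (\<lambda>j. w (Suc j)) f'" using Suc.prems(1) by auto
    have "derivs_le l X (\<lambda>j. w' (Suc j)) f'"
      using Suc.IH[OF f'(2), of l "\<lambda>j. w' (Suc j)"] Suc.prems Suc by auto
    moreover have "\<forall>x\<in>X. \<bar>f x\<bar> \<le> w' 0"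
      using Suc.prems(1) Suc.prems(3)[of 0] by force
    ultimately show ?thesis using f' Suc by auto
  qed
qed

lemma derivs_le_cong:
  assumes "derivs_le m X w f" "\<And>x. x \<in> X \<Longrightarrow> f x = g x"
  shows "derivs_le m X w g"
proof (cases m)
  case 0
  then show ?thesis using assms by auto
next
  case (Suc l)
  then obtain f' where f': "\<forall>x\<in>X. (f has_real_derivative f' x) (at x within X)"
    "derivs_le l X (\<lambda>j. w (Suc j)) f'" "\<forall>x\<in>X. \<bar>f x\<bar> \<le> w 0" using assms(1) by auto
  have "(g has_real_derivative f' x) (at x within X)" if "x \<in> X" for x
    using f'(1) that assms(2)
    by (intro has_field_derivative_transform_within[of f _ x X 1 g]) auto
  then show ?thesis using f' Suc assms(2) by auto
qed

lemma derivs_le_const: "\<bar>c\<bar> \<le> w 0 \<Longrightarrow> (\<And>j. 0 \<le> w j) \<Longrightarrow> derivs_le m X w (\<lambda>x. c)"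
proof (induction m arbitrary: w c)
  case (Suc m)
  have "derivs_le m X (\<lambda>j. w (Suc j)) (\<lambda>x. 0)" using Suc by auto
  then show ?case using Suc.prems by (auto intro!: exI[of _ "\<lambda>x. 0"])
qed auto

lemma derivs_le_add:
  "derivs_le m X v f \<Longrightarrow> derivs_le m X w g \<Longrightarrow> derivs_le m X (\<lambda>j. v j + w j) (\<lambda>x. f x + g x)"
proof (induction m arbitrary: v w f g)
  case 0
  have "\<bar>f x + g x\<bar> \<le> v 0 + w 0" if "x \<in> X" for x
    using 0 that abs_triangle_ineq[of "f x" "g x"] by force
  then show ?case by simp
next
  case (Suc m)
  obtain f' where f': "\<forall>x\<in>X. (f has_real_derivative f' x) (at x within X)"
      "derivs_le m X (\<lambda>j. v (Suc j)) f'" "\<forall>x\<in>X. \<bar>f x\<bar> \<le> v 0" using Suc.prems(1) by auto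
  obtain g' where g': "\<forall>x\<in>X. (g has_real_derivative g' x) (at x within X)"
      "derivs_le m X (\<lambda>j. w (Suc j)) g'" "\<forall>x\<in>X. \<bar>g x\<bar> \<le> w 0" using Suc.prems(2) by auto
  show ?case
  proof (rule derivs_le_SucI)
    show "derivs_le m X (\<lambda>j. v (Suc j) + w (Suc j)) (\<lambda>x. f' x + g' x)"
      using Suc.IH f' g' by blast
    show "\<And>x. x \<in> X \<Longrightarrow> ((\<lambda>x. f x + g x) has_real_derivative f' x + g' x) (at x within X)"
      using f' g' by (auto intro: DERIV_add)
    show "\<bar>f x + g x\<bar> \<le> v 0 + w 0" if "x \<in> X" for x
      using f'(3) g'(3) that abs_triangle_ineq[of "f x" "g x"] by force
  qed
qed

text \<open>Leibniz rule: each differentiation doubles the number of terms, whence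
  \<open>2 ^ m\<close>, and all terms of order \<open>j\<close> are covered by one weight as soon as
  \<open>w\<close> dominates the products \<open>u i * v j\<close> with \<open>i + j\<close>
  fixed.\<close>

lemma derivs_le_mult:
  assumes "derivs_le m X u f" "derivs_le m X v g"
    and "\<And>i j. u i * v j \<le> w (i + j)" "\<And>j. 0 \<le> u j" "\<And>j. 0 \<le> v j"
  shows "derivs_le m X (\<lambda>j. 2 ^ m * w j) (\<lambda>x. f x * g x)"
  using assms
proof (induction m arbitrary: u v w f g)
  case 0
  have "\<bar>f x * g x\<bar> \<le> u 0 * v 0" if "x \<in> X" for x
    using 0(1,2) 0(4)[of 0] that by (auto simp: abs_mult intro: mult_mono)
  then show ?case using 0(3)[of 0 0] by force
next
  case (Suc m)
  obtain f' where f': "\<forall>x\<in>X. (f has_real_derivative f' x) (at x within X)"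
      "derivs_le m X (\<lambda>j. u (Suc j)) f'" "\<forall>x\<in>X. \<bar>f x\<bar> \<le> u 0" using Suc.prems(1) by auto
  obtain g' where g': "\<forall>x\<in>X. (g has_real_derivative g' x) (at x within X)"
      "derivs_le m X (\<lambda>j. v (Suc j)) g'" "\<forall>x\<in>X. \<bar>g x\<bar> \<le> v 0" using Suc.prems(2) by auto
  have w: "0 \<le> w j" for j
    using Suc.prems(3)[of j 0] mult_nonneg_nonneg[OF Suc.prems(4)[of j] Suc.prems(5)[of 0]] by simp
  have fm: "derivs_le m X u f" "derivs_le m X v g"
    using Suc.prems(1,2) derivs_le_mono[of "Suc m" X _ _ m] by auto
  show ?case
  proof (rule derivs_le_SucI)
    have 1: "derivs_le m X (\<lambda>j. 2 ^ m * w (Suc j)) (\<lambda>x. f' x * g x)"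
      using Suc.prems by (intro Suc.IH[OF f'(2) fm(2)]) (auto simp flip: add_Suc)
    have 2: "derivs_le m X (\<lambda>j. 2 ^ m * w (Suc j)) (\<lambda>x. f x * g' x)"
      using Suc.prems by (intro Suc.IH[OF fm(1) g'(2)]) (auto simp flip: add_Suc_right)
    show "derivs_le m X (\<lambda>j. 2 ^ Suc m * w (Suc j)) (\<lambda>x. f' x * g x + f x * g' x)"
      by (rule derivs_le_mono[OF derivs_le_add[OF 1 2]]) auto
    show "\<And>x. x \<in> X \<Longrightarrow> ((\<lambda>x. f x * g x) has_real_derivative f' x * g x + f x * g' x) (at x within X)"
      using f' g' by (auto intro!: derivative_eq_intros)
    show "\<bar>f x * g x\<bar> \<le> 2 ^ Suc m * w 0" if "x \<in> X" for x
    proof -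
      have "\<bar>f x * g x\<bar> \<le> u 0 * v 0"
        using f'(3) g'(3) that Suc.prems(4)[of 0] by (auto simp: abs_mult intro: mult_mono)
      also have "\<dots> \<le> 1 * w 0" using Suc.prems(3)[of 0 0] by simp
      also have "\<dots> \<le> 2 ^ Suc m * w 0" by (intro mult_right_mono w one_le_power) auto
      finally show ?thesis .
    qed
  qed
qed

lemma derivs_le_cmult:
  assumes "derivs_le m X w f" shows "derivs_le m X (\<lambda>j. \<bar>c\<bar> * w j) (\<lambda>x. c * f x)"
  using assms
proof (induction m arbitrary: w f)
  case 0
  then show ?case by (auto simp: abs_mult intro: mult_left_mono)
next
  case (Suc m)
  obtain f' where f': "\<forall>x\<in>X. (f has_real_derivative f' x) (at x within X)"
      "derivs_le m X (\<lambda>j. w (Suc j)) f'" "\<forall>x\<in>X. \<bar>f x\<bar> \<le> w 0" using Suc.prems(1) by auto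
  show ?case
  proof (rule derivs_le_SucI)
    show "derivs_le m X (\<lambda>j. \<bar>c\<bar> * w (Suc j)) (\<lambda>x. c * f' x)" using Suc.IH f'(2) by blast
    show "\<And>x. x \<in> X \<Longrightarrow> ((\<lambda>x. c * f x) has_real_derivative c * f' x) (at x within X)"
      using f' by (auto intro!: derivative_eq_intros)
  qed (use f' in \<open>auto simp: abs_mult intro: mult_left_mono\<close>)
qed

lemma derivs_le_diff:
  assumes "derivs_le m X v f" "derivs_le m X w g" shows "derivs_le m X (\<lambda>j. v j + w j) (\<lambda>x. f x - g x)"
  using derivs_le_add[OF assms(1) derivs_le_cmult[OF assms(2), of "-1"]] by simp

text \<open>Weights for which bounds of the form \<open>C * w j\<close> survive products and
  compositions with a new \<open>C\<close>. The instances in use are \<open>1\<close>,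
  \<open>\<epsilon> ^ j\<close> for slow functions, and \<open>\<epsilon> ^ min j r\<close> for
  functions whose gain stops at the order \<open>r\<close>.\<close>

definition submult :: "(nat \<Rightarrow> real) \<Rightarrow> bool" where
  "submult w \<longleftrightarrow> w 0 = 1 \<and> (\<forall>j. 0 \<le> w j) \<and> (\<forall>i j. w i * w j \<le> w (i + j))"

lemma submult_powers: "0 \<le> \<epsilon> \<Longrightarrow> submult (\<lambda>j. \<epsilon> ^ j)"
  by (auto simp: submult_def power_add)

lemma submult_powers_min:
  assumes "0 < \<epsilon>" "\<epsilon> \<le> 1" shows "submult (\<lambda>j. \<epsilon> ^ min j r)"
  using assms by (auto simp: submult_def simp flip: power_add intro!: power_decreasing)

text \<open>The derivative of \<open>G 0 (f x)\<close> is \<open>G 1 (f x) * f' x\<close>, so the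
  induction passes to the shifted tower \<open>\<lambda>j. G (Suc j)\<close>. Only \<open>f'\<close>
  is bounded: the functions inserted below are phases, which may grow. \<open>C\<close> is chosen
  before \<open>w\<close>, \<open>f\<close> and \<open>X\<close>, hence is uniform in
  \<open>\<epsilon>\<close>.\<close>

lemma derivs_le_comp:
  assumes "0 \<le> K" "\<And>j. 0 \<le> B j"
  shows "\<exists>C\<ge>0. \<forall>X w G f f'. submult w \<longrightarrow>
      (\<forall>j z. (G j has_real_derivative G (Suc j) z) (at z)) \<longrightarrow> (\<forall>j z. \<bar>G j z\<bar> \<le> B j) \<longrightarrow>
      (\<forall>x\<in>X. (f has_real_derivative f' x) (at x within X)) \<longrightarrow>
      derivs_le m X (\<lambda>j. K * w (Suc j)) f' \<longrightarrow> derivs_le m X (\<lambda>j. C * w j) (\<lambda>x. G 0 (f x))"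
  using assms
proof (induction m arbitrary: B)
  case 0
  then show ?case by (intro exI[of _ "B 0"]) (auto simp: submult_def)
next
  case (Suc m)
  obtain C where C: "C \<ge> 0" "\<And>X w G f f'. submult w \<Longrightarrow>
      (\<forall>j z. (G j has_real_derivative G (Suc j) z) (at z)) \<Longrightarrow> (\<forall>j z. \<bar>G j z\<bar> \<le> B (Suc j)) \<Longrightarrow>
      (\<forall>x\<in>X. (f has_real_derivative f' x) (at x within X)) \<Longrightarrow>
      derivs_le m X (\<lambda>j. K * w (Suc j)) f' \<Longrightarrow> derivs_le m X (\<lambda>j. C * w j) (\<lambda>x. G 0 (f x))"
    using Suc.IH[of "\<lambda>j. B (Suc j)"] Suc.prems by metis
  show ?case
  proof (intro exI[of _ "max (B 0) (2 ^ m * (C * K))"] conjI allI impI)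
    show "0 \<le> max (B 0) (2 ^ m * (C * K))" using Suc.prems(2)[of 0] by auto
    fix X w f f' and G :: "nat \<Rightarrow> real \<Rightarrow> real"
    assume w: "submult w" and G: "\<forall>j z. (G j has_real_derivative G (Suc j) z) (at z)"
      "\<forall>j z. \<bar>G j z\<bar> \<le> B j" and f: "\<forall>x\<in>X. (f has_real_derivative f' x) (at x within X)"
      and f': "derivs_le (Suc m) X (\<lambda>j. K * w (Suc j)) f'"
    have f'm: "derivs_le m X (\<lambda>j. K * w (Suc j)) f'" using f' derivs_le_mono[of "Suc m"] by force
    have 1: "derivs_le m X (\<lambda>j. C * w j) (\<lambda>x. G 1 (f x))"
      using C(2)[of w "\<lambda>j. G (Suc j)" X f f'] w G f f'm by simp
    have 2: "derivs_le m X (\<lambda>j. 2 ^ m * (C * K * w (Suc j))) (\<lambda>x. G 1 (f x) * f' x)"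
    proof (rule derivs_le_mult[OF 1 f'm])
      fix i j
      have "w i * w (Suc j) \<le> w (Suc (i + j))" using w by (metis submult_def add_Suc_right)
      then show "C * w i * (K * w (Suc j)) \<le> C * K * w (Suc (i + j))"
        using mult_left_mono[of "w i * w (Suc j)" "w (Suc (i + j))" "C * K"] C(1) Suc.prems(1)
        by (simp add: mult.assoc mult.left_commute)
    qed (use w C Suc.prems in \<open>auto simp: submult_def\<close>)
    show "derivs_le (Suc m) X (\<lambda>j. max (B 0) (2 ^ m * (C * K)) * w j) (\<lambda>x. G 0 (f x))"
    proof (rule derivs_le_SucI)
      show "derivs_le m X (\<lambda>j. max (B 0) (2 ^ m * (C * K)) * w (Suc j)) (\<lambda>x. G 1 (f x) * f' x)"
      proof (rule derivs_le_mono[OF 2 order_refl])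
        fix j
        have "2 ^ m * (C * K) * w (Suc j) \<le> max (B 0) (2 ^ m * (C * K)) * w (Suc j)"
          using w by (intro mult_right_mono) (auto simp: submult_def)
        then show "2 ^ m * (C * K * w (Suc j)) \<le> max (B 0) (2 ^ m * (C * K)) * w (Suc j)"
          by (simp add: mult.assoc)
      qed
      show "((\<lambda>x. G 0 (f x)) has_real_derivative G 1 (f x) * f' x) (at x within X)" if "x \<in> X" for x
        using DERIV_chain2[of "G 0" "G 1 (f x)" f x "f' x" X] G(1) f that by auto
      show "\<bar>G 0 (f x)\<bar> \<le> max (B 0) (2 ^ m * (C * K)) * w 0" for x
        using G(2) w by (force simp: submult_def le_max_iff_disj)
    qed
  qed
qed

text \<open>Induction through \<open>(1 / f)' = - (1 / f)\<^sup>2 * f'\<close>.\<close>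

lemma derivs_le_inverse:
  assumes "0 < c" "0 \<le> K"
  shows "\<exists>C\<ge>0. \<forall>X f. derivs_le m X (\<lambda>j. K) f \<longrightarrow> (\<forall>x\<in>X. c \<le> \<bar>f x\<bar>) \<longrightarrow>
      derivs_le m X (\<lambda>j. C) (\<lambda>x. 1 / f x)"
proof (induction m)
  case 0
  have "\<bar>1 / z\<bar> \<le> 1 / c" if "c \<le> \<bar>z\<bar>" for z
    using that assms(1) by (simp add: frac_le)
  then show ?case using assms by (intro exI[of _ "1/c"]) auto
next
  case (Suc m)
  obtain C where C: "C \<ge> 0" "\<And>X f. derivs_le m X (\<lambda>j. K) f \<Longrightarrow> (\<forall>x\<in>X. c \<le> \<bar>f x\<bar>) \<Longrightarrow>
      derivs_le m X (\<lambda>j. C) (\<lambda>x. 1 / f x)" using Suc.IH by blast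
  define D where "D = \<bar>-1\<bar> * (2 ^ m * (2 ^ m * (C * C) * K))"
  show ?case
  proof (intro exI[of _ "max (1/c) D"] conjI allI impI)
    show "0 \<le> max (1/c) D" using assms by (auto simp: le_max_iff_disj)
    fix X f assume f: "derivs_le (Suc m) X (\<lambda>j. K) f" and c: "\<forall>x\<in>X. c \<le> \<bar>f x\<bar>"
    obtain f' where f': "\<forall>x\<in>X. (f has_real_derivative f' x) (at x within X)"
      "derivs_le m X (\<lambda>j. K) f'" using f by auto
    have 1: "derivs_le m X (\<lambda>j. C) (\<lambda>x. 1 / f x)"
      using C(2)[OF _ c] f derivs_le_mono[of "Suc m"] by force
    have 2: "derivs_le m X (\<lambda>j. 2 ^ m * (C * C)) (\<lambda>x. 1 / f x * (1 / f x))"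
      by (rule derivs_le_mult[OF 1 1]) (use C in auto)
    have "derivs_le m X (\<lambda>j. 2 ^ m * (2 ^ m * (C * C) * K)) (\<lambda>x. 1 / f x * (1 / f x) * f' x)"
      by (rule derivs_le_mult[OF 2 f'(2)]) (use C assms in auto)
    from derivs_le_cmult[OF this, of "-1"]
    have 3: "derivs_le m X (\<lambda>j. D) (\<lambda>x. - 1 * (1 / f x * (1 / f x) * f' x))"
      unfolding D_def .
    show "derivs_le (Suc m) X (\<lambda>j. max (1/c) D) (\<lambda>x. 1 / f x)"
    proof (rule derivs_le_SucI)
      show "derivs_le m X (\<lambda>j. max (1/c) D) (\<lambda>x. - 1 * (1 / f x * (1 / f x) * f' x))"
        using 3 by (rule derivs_le_mono) auto
      fix x assume x: "x \<in> X"
      then have "f x \<noteq> 0" using c assms(1) by force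
      then show "((\<lambda>x. 1 / f x) has_real_derivative - 1 * (1 / f x * (1 / f x) * f' x)) (at x within X)"
        using f'(1) x by (auto intro!: derivative_eq_intros simp: field_simps)
      have "\<bar>1 / f x\<bar> \<le> 1 / c" using c x assms(1) by (simp add: frac_le)
      then show "\<bar>1 / f x\<bar> \<le> max (1/c) D" by simp
    qed
  qed
qed

lemma has_real_derivative_unique_within_Icc:
  fixes a b :: real
  assumes "a < b" "x \<in> {a..b}"
    and "(f has_real_derivative d) (at x within {a..b})"
    and "(f has_real_derivative e) (at x within {a..b})"
  shows "d = e"
  using assms vector_derivative_unique_within_closed_interval[of a b x f d e]
  by (auto simp: has_real_derivative_iff_has_vector_derivative)

text \<open>On a nondegenerate interval the derivative is unique, so the existential one inside
  \<open>derivs_le\<close> is the known \<open>f'\<close>. This hands a bound on a function on to an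
  explicit formula for its derivative.\<close>

lemma derivs_le_derivative:
  fixes a b :: real
  assumes "a < b" "derivs_le (Suc m) {a..b} w f"
    and "\<And>x. x \<in> {a..b} \<Longrightarrow> (f has_real_derivative f' x) (at x within {a..b})"
  shows "derivs_le m {a..b} (\<lambda>j. w (Suc j)) f'"
proof -
  obtain g where g: "\<forall>x\<in>{a..b}. (f has_real_derivative g x) (at x within {a..b})"
      "derivs_le m {a..b} (\<lambda>j. w (Suc j)) g" using assms(2) by auto
  show ?thesis
    using g(1) assms(1,3) has_real_derivative_unique_within_Icc by (intro derivs_le_cong[OF g(2)]) blast
qed

lemma derivs_le_sequence:
  assumes "derivs_le m X w f"
  shows "\<exists>g. g 0 = f \<and> (\<forall>j<m. \<forall>x\<in>X. (g j has_real_derivative g (Suc j) x) (at x within X)) \<and>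
     (\<forall>j\<le>m. \<forall>x\<in>X. \<bar>g j x\<bar> \<le> w j)"
  using assms
proof (induction m arbitrary: w f)
  case 0
  then show ?case by (intro exI[of _ "\<lambda>_. f"]) auto
next
  case (Suc m)
  obtain f' where f': "\<forall>x\<in>X. (f has_real_derivative f' x) (at x within X)"
      "derivs_le m X (\<lambda>j. w (Suc j)) f'" "\<forall>x\<in>X. \<bar>f x\<bar> \<le> w 0" using Suc.prems(1) by auto
  from Suc.IH[OF f'(2)] obtain g where g: "g 0 = f'"
    "\<forall>j<m. \<forall>x\<in>X. (g j has_real_derivative g (Suc j) x) (at x within X)"
    "\<forall>j\<le>m. \<forall>x\<in>X. \<bar>g j x\<bar> \<le> w (Suc j)" by blast
  show ?case
    using f' g by (intro exI[of _ "case_nat f g"]) (auto split: nat.splits simp: less_Suc_eq_0_disj)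
qed

lemma derivs_le_of_sequence:
  assumes "\<forall>j<m. \<forall>x\<in>X. (g j has_real_derivative g (Suc j) x) (at x within X)"
    "\<forall>j\<le>m. \<forall>x\<in>X. \<bar>g j x\<bar> \<le> w j"
  shows "derivs_le m X w (g 0)"
  using assms
proof (induction m arbitrary: w g)
  case (Suc m)
  have "derivs_le m X (\<lambda>j. w (Suc j)) (g (Suc 0))"
    using Suc.prems by (intro Suc.IH[of "\<lambda>j. g (Suc j)" "\<lambda>j. w (Suc j)"]) auto
  then show ?case using Suc.prems by (intro derivs_le_SucI[of X "g 0" w "g 1"]) auto
qed auto

section \<open>Finite differences and numerical differentiation\<close>

primrec fdiff :: "nat \<Rightarrow> (real \<Rightarrow> real) \<Rightarrow> real \<Rightarrow> real" where
  "fdiff 0 f x = f x"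
| "fdiff (Suc j) f x = fdiff j f (x + 1) - fdiff j f x"

lemma fdiff_cong:
  assumes "\<And>m. m \<le> j \<Longrightarrow> f (x + real m) = g (y + real m)"
  shows "fdiff j f x = fdiff j g y"
  using assms
proof (induction j arbitrary: x y)
  case 0
  show ?case using 0[of 0] by simp
next
  case (Suc j)
  have "fdiff j f (x + 1) = fdiff j g (y + 1)"
  proof (rule Suc.IH)
    show "f (x + 1 + real m) = g (y + 1 + real m)" if "m \<le> j" for m
      using Suc.prems[of "Suc m"] that by (simp add: ac_simps)
  qed
  moreover have "fdiff j f x = fdiff j g y" using Suc.prems by (intro Suc.IH) auto
  ultimately show ?case by simp
qed

lemma fdiff_add: "fdiff j (\<lambda>x. f x + g x) x = fdiff j f x + fdiff j g x"
  by (induction j arbitrary: x) auto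

lemma fdiff_diff: "fdiff j (\<lambda>x. f x - g x) x = fdiff j f x - fdiff j g x"
  by (induction j arbitrary: x) auto

lemma fdiff_cmult: "fdiff j (\<lambda>x. c * f x) x = c * fdiff j f x"
  by (induction j arbitrary: x) (auto simp: algebra_simps)

lemma fdiff_sum: "finite A \<Longrightarrow> fdiff j (\<lambda>x. \<Sum>i\<in>A. f i x) x = (\<Sum>i\<in>A. fdiff j (f i) x)"
  by (induction j arbitrary: x) (auto simp: sum_subtractf)

lemma fdiff_0 [simp]: "fdiff 0 f = f"
  by auto

lemma fdiff_const: "0 < j \<Longrightarrow> fdiff j (\<lambda>x. c) x = 0"
proof (induction j arbitrary: x)
  case (Suc j)
  have "fdiff j (\<lambda>x. c) (x + 1) = fdiff j (\<lambda>x. c) x" by (rule fdiff_cong) simp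
  then show ?case by simp
qed auto

lemma fdiff_abs_le:
  assumes "\<And>m. m \<le> j \<Longrightarrow> \<bar>f (x + real m)\<bar> \<le> M"
  shows "\<bar>fdiff j f x\<bar> \<le> 2 ^ j * M"
  using assms
proof (induction j arbitrary: x)
  case 0
  show ?case using 0[of 0] by simp
next
  case (Suc j)
  have "\<bar>fdiff j f (x + 1)\<bar> \<le> 2 ^ j * M"
  proof (rule Suc.IH)
    show "\<bar>f (x + 1 + real m)\<bar> \<le> M" if "m \<le> j" for m
      using Suc.prems[of "Suc m"] that by (simp add: ac_simps)
  qed
  moreover have "\<bar>fdiff j f x\<bar> \<le> 2 ^ j * M" using Suc.prems by (intro Suc.IH) auto
  ultimately show ?case by simp
qed

lemma fdiff_has_real_derivative:
  assumes "\<And>x. x \<in> {a..b} \<Longrightarrow> (f has_real_derivative f' x) (at x within {a..b})"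
    and "x \<in> {a..b - real j}"
  shows "(fdiff j f has_real_derivative fdiff j f' x) (at x within {a..b - real j})"
  using assms
proof (induction j arbitrary: x)
  case (Suc j)
  have 1: "(fdiff j f has_real_derivative fdiff j f' x) (at x within {a..b - real (Suc j)})"
    using Suc.prems by (intro has_field_derivative_subset[OF Suc.IH]) auto
  have "(fdiff j f has_real_derivative fdiff j f' (x + 1)) (at (x + 1) within {a..b - real j})"
    using Suc.prems by (intro Suc.IH) auto
  then have "(fdiff j f has_real_derivative fdiff j f' (x + 1)) (at (x + 1) within (\<lambda>x. x + 1) ` {a..b - real (Suc j)})"
    by (rule has_field_derivative_subset) auto
  then have "((fdiff j f \<circ> (\<lambda>x. x + 1)) has_real_derivative fdiff j f' (x + 1) * 1) (at x within {a..b - real (Suc j)})"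
    by (intro DERIV_image_chain) (auto intro!: derivative_eq_intros)
  then have "((\<lambda>x. fdiff j f (x + 1) - fdiff j f x) has_real_derivative fdiff j f' (x + 1) - fdiff j f' x)
      (at x within {a..b - real (Suc j)})"
    using 1 by (auto intro!: derivative_eq_intros simp: o_def)
  moreover have "(\<lambda>x. fdiff j f (x + 1) - fdiff j f x) = fdiff (Suc j) f" by auto
  ultimately show ?case by simp
qed auto

lemma mvt_within:
  fixes f :: "real \<Rightarrow> real"
  assumes "a < b" "\<And>x. x \<in> {a..b} \<Longrightarrow> (f has_real_derivative f' x) (at x within {a..b})"
  shows "\<exists>\<xi>\<in>{a<..<b}. f b - f a = (b - a) * f' \<xi>"
proof -
  have "\<exists>z\<in>{a<..<b}. f b - f a = (\<lambda>h. f' z * h) (b - a)"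
  proof (rule mvt_simple[OF assms(1)])
    show "(f has_derivative (\<lambda>h. f' x * h)) (at x within {a..b})" if "a \<le> x" "x \<le> b" for x
      using assms(2)[of x] that by (auto simp: has_field_derivative_def)
  qed
  then show ?thesis by (simp add: mult.commute)
qed

text \<open>Differences commute with differentiation, so the mean value theorem for
  \<open>fdiff j f\<close> trades one difference for one derivative.\<close>

lemma fdiff_Suc_mean_value:
  assumes "\<And>x. x \<in> {a..b} \<Longrightarrow> (f has_real_derivative f' x) (at x within {a..b})"
    and "a \<le> x" "x + real (Suc j) \<le> b"
  shows "\<exists>\<xi>. x \<le> \<xi> \<and> \<xi> \<le> x + 1 \<and> fdiff (Suc j) f x = fdiff j f' \<xi>"
proof -
  have "\<exists>\<xi>\<in>{x<..<x+1}. fdiff j f (x + 1) - fdiff j f x = (x + 1 - x) * fdiff j f' \<xi>"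
  proof (rule mvt_within)
    show "(fdiff j f has_real_derivative fdiff j f' z) (at z within {x..x+1})" if "z \<in> {x..x+1}" for z
    proof (rule has_field_derivative_subset)
      show "(fdiff j f has_real_derivative fdiff j f' z) (at z within {a..b - real j})"
        using assms that by (intro fdiff_has_real_derivative) auto
    qed (use assms in auto)
  qed simp
  then obtain \<xi> where "\<xi> \<in> {x<..<x+1}" "fdiff j f (x + 1) - fdiff j f x = fdiff j f' \<xi>" by auto
  then show ?thesis by (intro exI[of _ \<xi>]) auto
qed

lemma fdiff_le_of_derivs_le:
  assumes "derivs_le j {a..b} w f" "a \<le> x" "x + real j \<le> b"
  shows "\<bar>fdiff j f x\<bar> \<le> w j"
  using assms
proof (induction j arbitrary: w f x)
  case (Suc j)
  obtain f' where f': "\<forall>x\<in>{a..b}. (f has_real_derivative f' x) (at x within {a..b})"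
      "derivs_le j {a..b} (\<lambda>j. w (Suc j)) f'" using Suc.prems(1) by auto
  obtain \<xi> where \<xi>: "x \<le> \<xi>" "\<xi> \<le> x + 1" "fdiff (Suc j) f x = fdiff j f' \<xi>"
    using fdiff_Suc_mean_value[of a b f f' x j] f'(1) Suc.prems(2,3) by auto
  show ?case using Suc.IH[OF f'(2), of \<xi>] \<xi> Suc.prems(2,3) by simp
qed auto

section \<open>Newton interpolation at equidistant nodes\<close>

definition binomial_poly :: "nat \<Rightarrow> real poly" where
  "binomial_poly j = smult (1 / fact j) (\<Prod>i<j. [:- real i, 1:])"

lemma poly_binomial_poly: "poly (binomial_poly j) x = x gchoose j"
  by (simp add: binomial_poly_def gbinomial_prod_rev poly_prod atLeast0LessThan)

lemma degree_binomial_poly: "degree (binomial_poly j) \<le> j"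
proof -
  have "degree (\<Prod>i<j. [:- real i, 1:]) \<le> sum (degree \<circ> (\<lambda>i. [:- real i, 1:])) {..<j}"
    by (rule degree_prod_sum_le) auto
  also have "\<dots> = j" by simp
  finally show ?thesis by (simp add: binomial_poly_def)
qed

text \<open>The polynomial interpolating \<open>f\<close> at
  \<open>x, x + 1, \<dots>, x + N\<close>, in the variable measured from \<open>x\<close>. In
  Newton's form its coefficients are the differences of \<open>f\<close>, so slowness of
  \<open>f\<close> can be read off from them.\<close>

definition newton :: "nat \<Rightarrow> (real \<Rightarrow> real) \<Rightarrow> real \<Rightarrow> real poly" where
  "newton N f x = (\<Sum>j\<le>N. smult (fdiff j f x) (binomial_poly j))"

lemma newton_forward: "f (x + real m) = (\<Sum>j\<le>m. real (m choose j) * fdiff j f x)"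
proof (induction m arbitrary: x)
  case (Suc m)
  have "f (x + real (Suc m)) = f (x + 1 + real m)" by (simp add: ac_simps)
  also have "\<dots> = (\<Sum>j\<le>m. real (m choose j) * (fdiff j f x + fdiff (Suc j) f x))"
    by (subst Suc.IH) simp
  also have "\<dots> = (\<Sum>j\<le>m. real (m choose j) * fdiff j f x) + (\<Sum>j\<le>m. real (m choose j) * fdiff (Suc j) f x)"
    by (simp only: distrib_left sum.distrib)
  also have "(\<Sum>j\<le>m. real (m choose j) * fdiff j f x) = (\<Sum>j\<le>Suc m. real (m choose j) * fdiff j f x)"
    by simp
  also have "\<dots> = fdiff 0 f x + (\<Sum>j\<le>m. real (m choose Suc j) * fdiff (Suc j) f x)"
    by (subst sum.atMost_Suc_shift) simp
  also have "\<dots> + (\<Sum>j\<le>m. real (m choose j) * fdiff (Suc j) f x)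
      = fdiff 0 f x + (\<Sum>j\<le>m. real (Suc m choose Suc j) * fdiff (Suc j) f x)"
    by (simp add: algebra_simps flip: sum.distrib)
  also have "\<dots> = (\<Sum>j\<le>Suc m. real (Suc m choose j) * fdiff j f x)"
    by (subst sum.atMost_Suc_shift) simp
  finally show ?case .
qed simp

lemma poly_newton:
  assumes "m \<le> N" shows "poly (newton N f x) (real m) = f (x + real m)"
proof -
  have "poly (newton N f x) (real m) = (\<Sum>j\<le>N. real (m choose j) * fdiff j f x)"
    by (simp add: newton_def poly_sum poly_binomial_poly binomial_gbinomial mult.commute)
  also have "\<dots> = (\<Sum>j\<le>m. real (m choose j) * fdiff j f x)"
    using assms by (intro sum.mono_neutral_right) (auto simp: binomial_eq_0)
  finally show ?thesis by (simp add: newton_forward)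
qed

lemma degree_newton: "degree (newton N f x) \<le> N"
  unfolding newton_def
  by (rule degree_sum_le) (auto intro: order_trans[OF degree_smult_le] order_trans[OF degree_binomial_poly])

lemma newton_of_poly:
  assumes "degree P \<le> N" shows "newton N (poly P) 0 = P"
proof (rule poly_eqI_degree[of "real ` {..N}"])
  have "card (real ` {..N}) = Suc N" by (subst card_image) auto
  then show "degree (newton N (poly P) 0) < card (real ` {..N})" "degree P < card (real ` {..N})"
    using assms degree_newton[of N "poly P" 0] by auto
qed (auto simp: poly_newton)

text \<open>Numerical differentiation: the slope at \<open>x\<close> of the polynomial interpolating \<open>f\<close> at
  \<open>x, x + 1, \<dots>, x + N\<close>. Oscillations of period 1 are invisible to it.\<close>

definition ndiff :: "nat \<Rightarrow> (real \<Rightarrow> real) \<Rightarrow> real \<Rightarrow> real" where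
  "ndiff N f x = (\<Sum>j\<le>N. poly (pderiv (binomial_poly j)) 0 * fdiff j f x)"

lemma ndiff_newton: "ndiff N f x = poly (pderiv (newton N f x)) 0"
  proof -
  have "pderiv (\<Sum>j\<in>A. q j) = (\<Sum>j\<in>A. pderiv (q j))" for A and q :: "nat \<Rightarrow> real poly"
    by (induction A rule: infinite_finite_induct) (auto simp: pderiv_add)
  then show ?thesis
    by (simp add: ndiff_def newton_def pderiv_smult poly_sum mult.commute)
qed

lemma ndiff_cong:
  assumes "\<And>m. m \<le> N \<Longrightarrow> f (x + real m) = g (y + real m)"
  shows "ndiff N f x = ndiff N g y"
  unfolding ndiff_def using assms by (intro sum.cong refl arg_cong2[of _ _ _ _ "(*)"] fdiff_cong) auto

lemma ndiff_add: "ndiff N (\<lambda>x. f x + g x) x = ndiff N f x + ndiff N g x"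
  by (simp add: ndiff_def fdiff_add sum.distrib distrib_left)

lemma ndiff_diff: "ndiff N (\<lambda>x. f x - g x) x = ndiff N f x - ndiff N g x"
  by (simp add: ndiff_def fdiff_diff sum_subtractf right_diff_distrib)

lemma ndiff_cmult: "ndiff N (\<lambda>x. c * f x) x = c * ndiff N f x"
  by (simp add: ndiff_def fdiff_cmult sum_distrib_left mult.left_commute)

lemma ndiff_sum: "finite A \<Longrightarrow> ndiff N (\<lambda>x. \<Sum>i\<in>A. f i x) x = (\<Sum>i\<in>A. ndiff N (f i) x)"
  unfolding ndiff_def by (simp add: fdiff_sum sum_distrib_left sum.swap[of _ A])

lemma ndiff_const: "ndiff N (\<lambda>x. c) x = 0"
proof -
  have "poly (pderiv (binomial_poly j)) 0 * fdiff j (\<lambda>x. c) x = 0" for j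
    by (cases j) (simp_all add: binomial_poly_def fdiff_const del: fdiff.simps(2))
  then show ?thesis unfolding ndiff_def by (simp only: sum.neutral_const)
qed

lemma ndiff_poly: "degree P \<le> N \<Longrightarrow> ndiff N (poly P) 0 = poly (pderiv P) 0"
  by (simp add: ndiff_newton newton_of_poly)

lemma ndiff_has_real_derivative:
  assumes "\<And>x. x \<in> {a..b} \<Longrightarrow> (f has_real_derivative f' x) (at x within {a..b})"
    and "x \<in> {a..b - real N}"
  shows "(ndiff N f has_real_derivative ndiff N f' x) (at x within {a..b - real N})"
proof -
  have "(fdiff j f has_real_derivative fdiff j f' x) (at x within {a..b - real N})" if "j \<le> N" for j
    using that assms by (intro has_field_derivative_subset[OF fdiff_has_real_derivative[of a b]]) auto
  then have "((\<lambda>x. \<Sum>j\<le>N. poly (pderiv (binomial_poly j)) 0 * fdiff j f x) has_real_derivative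
      (\<Sum>j\<le>N. poly (pderiv (binomial_poly j)) 0 * fdiff j f' x)) (at x within {a..b - real N})"
    by (intro DERIV_sum DERIV_cmult) auto
  moreover have "(\<lambda>x. \<Sum>j\<le>N. poly (pderiv (binomial_poly j)) 0 * fdiff j f x) = ndiff N f"
    by (auto simp: ndiff_def)
  ultimately show ?thesis by (simp add: ndiff_def)
qed

text \<open>Bounds the operator norm of \<open>ndiff N\<close> with respect to the maximum over the
  \<open>N + 1\<close> nodes.\<close>

definition ndiff_norm :: "nat \<Rightarrow> real" where
  "ndiff_norm N = (\<Sum>j\<le>N. \<bar>poly (pderiv (binomial_poly j)) 0\<bar> * 2 ^ j)"

lemma ndiff_norm_nonneg: "0 \<le> ndiff_norm N"
  unfolding ndiff_norm_def by (intro sum_nonneg) auto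

lemma ndiff_abs_le:
  assumes "\<And>m. m \<le> N \<Longrightarrow> \<bar>f (x + real m)\<bar> \<le> M"
  shows "\<bar>ndiff N f x\<bar> \<le> ndiff_norm N * M"
proof -
  have "\<bar>ndiff N f x\<bar> \<le> (\<Sum>j\<le>N. \<bar>poly (pderiv (binomial_poly j)) 0 * fdiff j f x\<bar>)"
    unfolding ndiff_def by (rule sum_abs)
  also have "\<dots> \<le> (\<Sum>j\<le>N. \<bar>poly (pderiv (binomial_poly j)) 0\<bar> * (2 ^ j * M))"
    unfolding abs_mult using assms by (intro sum_mono mult_left_mono fdiff_abs_le) auto
  also have "\<dots> = ndiff_norm N * M" by (simp add: ndiff_norm_def sum_distrib_right mult.assoc)
  finally show ?thesis .
qed

text \<open>\<open>ndiff N\<close> is exact on polynomials of degree at most \<open>N\<close>, hence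
  on the Taylor polynomial of degree \<open>r\<close>, and the error is its value on the Taylor
  remainder. Three choices of \<open>r\<close> occur: 1 for comparing energies, \<open>k - 1\<close>
  for the first phase, and \<open>N\<close> for the chain rule.\<close>

lemma ndiff_error:
  assumes g: "derivs_le (Suc r) {x..x + real N} w g" and r: "1 \<le> r" "r \<le> N"
    and g': "(g has_real_derivative d) (at x within {x..x + real N})"
  shows "\<bar>ndiff N g x - d\<bar> \<le> ndiff_norm N * real N ^ Suc r * w (Suc r)"
proof -
  from derivs_le_sequence[OF g] obtain G where G: "G 0 = g"
    "\<forall>j<Suc r. \<forall>z\<in>{x..x + real N}. (G j has_real_derivative G (Suc j) z) (at z within {x..x + real N})"
    "\<forall>j\<le>Suc r. \<forall>z\<in>{x..x + real N}. \<bar>G j z\<bar> \<le> w j" by blast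
  have w: "0 \<le> w (Suc r)" using G(3)[rule_format, of "Suc r" x] by force
  have d: "d = G 1 x"
    using has_real_derivative_unique_within_Icc[of x "x + real N" x g d "G 1 x"] g' G r by force
  define P where "P = (\<Sum>i\<le>r. monom (G i x / fact i) i)"
  have P: "poly P z = (\<Sum>i\<le>r. G i x * z ^ i / fact i)" for z
    by (simp add: P_def poly_sum poly_monom)
  have degP: "degree P \<le> N"
    unfolding P_def using r by (intro degree_sum_le) (auto intro: order_trans[OF degree_monom_le])
  have "poly (pderiv P) 0 = coeff P 1"
    by (simp add: poly_0_coeff_0 coeff_pderiv)
  also have "\<dots> = (\<Sum>i\<le>r. if i = 1 then G 1 x else 0)"
    unfolding P_def coeff_sum by (intro sum.cong) auto
  also have "\<dots> = d" using r d by simp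
  finally have "ndiff N (poly P) 0 = d" using ndiff_poly[OF degP] by simp
  then have "ndiff N (\<lambda>z. poly P (z - x)) x = d"
    using ndiff_cong[of N "\<lambda>z. poly P (z - x)" x "poly P" 0] by simp
  then have "ndiff N g x - d = ndiff N (\<lambda>z. g z - poly P (z - x)) x"
    by (simp add: ndiff_diff)
  also have "\<bar>\<dots>\<bar> \<le> ndiff_norm N * (real N ^ Suc r * w (Suc r))"
  proof (rule ndiff_abs_le)
    fix m assume m: "m \<le> N"
    have "norm (G 0 (x + real m) - (\<Sum>i\<le>r. G i x * (x + real m - x) ^ i / fact i))
        \<le> w (Suc r) * norm (x + real m - x) ^ Suc r / fact r"
      by (rule field_Taylor[of "{x..x + real N}"]) (use G m in auto)
    also have "\<dots> \<le> w (Suc r) * real N ^ Suc r / 1"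
      using m w by (intro frac_le mult_left_mono power_mono) (auto simp: fact_ge_1)
    finally show "\<bar>g (x + real m) - poly P (x + real m - x)\<bar> \<le> real N ^ Suc r * w (Suc r)"
      using G(1) by (simp add: P mult.commute)
  qed
  finally show ?thesis by (simp add: mult.assoc)
qed

text \<open>A derivative of order \<open>i \<le> j\<close> is paid for by
  \<open>\<epsilon> ^ j \<le> \<epsilon> ^ i\<close>, one of order \<open>i > j\<close> vanishes
  because the degree is at most \<open>j\<close>. So a coefficient of size
  \<open>\<epsilon> ^ j\<close> makes this term slow to every order.\<close>

lemma binomial_poly_scaled_derivs_le:
  "\<exists>C\<ge>0. \<forall>j\<le>N. \<forall>\<epsilon> d K. 0 < \<epsilon> \<longrightarrow> \<epsilon> \<le> 1 \<longrightarrow> \<bar>d\<bar> \<le> K * \<epsilon> ^ j \<longrightarrow>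
     derivs_le m {0..real N} (\<lambda>i. C * K * \<epsilon> ^ i) (\<lambda>\<tau>. d * poly (binomial_poly j) \<tau>)"
proof -
  have "\<exists>c\<ge>0. \<forall>\<tau>\<in>{0..real N}. \<bar>poly ((pderiv ^^ i) (binomial_poly j)) \<tau>\<bar> \<le> c" for i j
  proof -
    have "compact ((\<lambda>\<tau>. poly ((pderiv ^^ i) (binomial_poly j)) \<tau>) ` {0..real N})"
      by (intro compact_continuous_image continuous_intros) auto
    then have "bounded ((\<lambda>\<tau>. poly ((pderiv ^^ i) (binomial_poly j)) \<tau>) ` {0..real N})"
      by (rule compact_imp_bounded)
    then obtain c where "\<forall>\<tau>\<in>{0..real N}. \<bar>poly ((pderiv ^^ i) (binomial_poly j)) \<tau>\<bar> \<le> c"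
      by (auto simp: bounded_iff)
    then show ?thesis by (intro exI[of _ "max 0 c"]) (auto simp: le_max_iff_disj)
  qed
  then obtain c where c: "\<And>i j. 0 \<le> c i j"
    "\<And>i j \<tau>. \<tau> \<in> {0..real N} \<Longrightarrow> \<bar>poly ((pderiv ^^ i) (binomial_poly j)) \<tau>\<bar> \<le> c i j" by metis
  define C where "C = (\<Sum>j\<le>N. \<Sum>i\<le>m. c i j)"
  have cC: "c i j \<le> C" if "i \<le> m" "j \<le> N" for i j
  proof -
    have "c i j \<le> (\<Sum>i\<le>m. c i j)" using that c by (intro member_le_sum) auto
    also have "\<dots> \<le> C" unfolding C_def using that c
      by (intro member_le_sum[of j _ "\<lambda>j. \<Sum>i\<le>m. c i j"]) (auto intro: sum_nonneg)
    finally show ?thesis .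
  qed
  show ?thesis
  proof (intro exI[of _ C] conjI allI impI)
    show "0 \<le> C" unfolding C_def by (intro sum_nonneg c)
    fix j \<epsilon> d and K :: real assume j: "j \<le> N" and \<epsilon>: "0 < \<epsilon>" "\<epsilon> \<le> 1" and d: "\<bar>d\<bar> \<le> K * \<epsilon> ^ j"
    have K: "0 \<le> K" using d \<epsilon>(1) by (smt (verit) mult_neg_pos zero_less_power)
    have "derivs_le m {0..real N} (\<lambda>i. C * K * \<epsilon> ^ i) ((\<lambda>i \<tau>. d * poly ((pderiv ^^ i) (binomial_poly j)) \<tau>) 0)"
    proof (rule derivs_le_of_sequence; intro allI impI ballI)
      fix i \<tau> assume "i < m" "\<tau> \<in> {0..real N}"
      show "((\<lambda>\<tau>. d * poly ((pderiv ^^ i) (binomial_poly j)) \<tau>) has_real_derivative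
          d * poly ((pderiv ^^ Suc i) (binomial_poly j)) \<tau>) (at \<tau> within {0..real N})"
        by (auto intro!: derivative_eq_intros poly_DERIV[THEN DERIV_subset])
    next
      fix i \<tau> assume i: "i \<le> m" "\<tau> \<in> {0..real N}"
      show "\<bar>d * poly ((pderiv ^^ i) (binomial_poly j)) \<tau>\<bar> \<le> C * K * \<epsilon> ^ i"
      proof (cases "i \<le> j")
        case True
        have "\<bar>d * poly ((pderiv ^^ i) (binomial_poly j)) \<tau>\<bar> \<le> (K * \<epsilon> ^ i) * C"
          unfolding abs_mult
        proof (rule mult_mono)
          have "K * \<epsilon> ^ j \<le> K * \<epsilon> ^ i"
            using True \<epsilon> K by (intro mult_left_mono power_decreasing) auto
          then show "\<bar>d\<bar> \<le> K * \<epsilon> ^ i" using d by simp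
          show "\<bar>poly ((pderiv ^^ i) (binomial_poly j)) \<tau>\<bar> \<le> C"
            using c(2)[OF i(2), of i j] cC[OF i(1) j] by simp
        qed (use K \<epsilon> in auto)
        then show ?thesis by (simp add: ac_simps)
      next
        case False
        then have "(pderiv ^^ i) (binomial_poly j) = 0"
          using degree_binomial_poly[of j] by (intro poly_eqI) (simp add: coeff_higher_pderiv coeff_eq_0)
        then show ?thesis using \<open>0 \<le> C\<close> K \<epsilon> by simp
      qed
    qed
    then show "derivs_le m {0..real N} (\<lambda>i. C * K * \<epsilon> ^ i) (\<lambda>\<tau>. d * poly (binomial_poly j) \<tau>)" by simp
  qed
qed

lemma derivs_le_sum:
  assumes "finite A" "\<And>a. a \<in> A \<Longrightarrow> derivs_le m X (w a) (f a)"
  shows "derivs_le m X (\<lambda>j. \<Sum>a\<in>A. w a j) (\<lambda>x. \<Sum>a\<in>A. f a x)"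
  using assms by (induction A rule: finite_induct) (auto intro: derivs_le_const derivs_le_add)

text \<open>Turns slowness of \<open>f\<close> at the nodes, measured by differences, into slowness
  of a smooth function, measured by derivatives of any order \<open>m\<close>, also beyond
  \<open>N\<close>.\<close>

lemma newton_derivs_le:
  "\<exists>C\<ge>0. \<forall>\<epsilon> f x K. 0 < \<epsilon> \<longrightarrow> \<epsilon> \<le> 1 \<longrightarrow> (\<forall>j\<le>N. \<bar>fdiff j f x\<bar> \<le> K * \<epsilon> ^ j) \<longrightarrow>
     derivs_le m {0..real N} (\<lambda>i. C * K * \<epsilon> ^ i) (poly (newton N f x))"
proof -
  obtain C where C: "0 \<le> C" "\<forall>j\<le>N. \<forall>\<epsilon> d K. 0 < \<epsilon> \<longrightarrow> \<epsilon> \<le> 1 \<longrightarrow> \<bar>d\<bar> \<le> K * \<epsilon> ^ j \<longrightarrow>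
     derivs_le m {0..real N} (\<lambda>i. C * K * \<epsilon> ^ i) (\<lambda>\<tau>. d * poly (binomial_poly j) \<tau>)"
    using binomial_poly_scaled_derivs_le[of N m] by blast
  show ?thesis
  proof (intro exI[of _ "real (Suc N) * C"] conjI allI impI)
    fix \<epsilon> f x and K :: real
    assume "0 < \<epsilon>" "\<epsilon> \<le> 1" "\<forall>j\<le>N. \<bar>fdiff j f x\<bar> \<le> K * \<epsilon> ^ j"
    then have "derivs_le m {0..real N} (\<lambda>i. \<Sum>j\<le>N. C * K * \<epsilon> ^ i) (\<lambda>\<tau>. \<Sum>j\<le>N. fdiff j f x * poly (binomial_poly j) \<tau>)"
      using C(2) by (intro derivs_le_sum) auto
    then show "derivs_le m {0..real N} (\<lambda>i. real (Suc N) * C * K * \<epsilon> ^ i) (poly (newton N f x))"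
      by (simp add: newton_def poly_sum[abs_def] mult.assoc)
  qed (use C in auto)
qed

text \<open>Nothing is assumed about the size of \<open>f x\<close> itself.\<close>

lemma newton_derivative_derivs_le:
  "\<exists>C\<ge>0. \<forall>\<epsilon> f x K. 0 < \<epsilon> \<longrightarrow> \<epsilon> \<le> 1 \<longrightarrow> 0 \<le> K \<longrightarrow> (\<forall>j. 1 \<le> j \<and> j \<le> N \<longrightarrow> \<bar>fdiff j f x\<bar> \<le> K * \<epsilon> ^ j) \<longrightarrow>
     derivs_le m {0..real N} (\<lambda>i. C * K * \<epsilon> ^ Suc i) (poly (pderiv (newton N f x)))"
proof -
  obtain C where C: "0 \<le> C" "\<forall>\<epsilon> f x K. 0 < \<epsilon> \<longrightarrow> \<epsilon> \<le> 1 \<longrightarrow> (\<forall>j\<le>N. \<bar>fdiff j f x\<bar> \<le> K * \<epsilon> ^ j) \<longrightarrow>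
     derivs_le (Suc m) {0..real N} (\<lambda>i. C * K * \<epsilon> ^ i) (poly (newton N f x))"
    using newton_derivs_le[of N "Suc m"] by blast
  show ?thesis
  proof (cases "N = 0")
    case True
    have "poly (pderiv (newton N f x)) = (\<lambda>\<tau>. 0)" for f x
      using True by (auto simp: newton_def binomial_poly_def)
    then show ?thesis by (intro exI[of _ 0]) (auto intro!: derivs_le_const)
  next
    case False
    show ?thesis
    proof (intro exI[of _ C] conjI allI impI)
      fix \<epsilon> f x and K :: real
      assume \<epsilon>: "0 < \<epsilon>" "\<epsilon> \<le> 1" "0 \<le> K"
        and fdiff: "\<forall>j. 1 \<le> j \<and> j \<le> N \<longrightarrow> \<bar>fdiff j f x\<bar> \<le> K * \<epsilon> ^ j"
      \<comment> \<open>Subtracting the value at \<open>x\<close> annihilates the difference of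
        order zero and leaves the derivative of the interpolant unchanged.\<close>
      define g where "g = (\<lambda>z. f z - f x)"
      have fdg: "fdiff j g x = (if j = 0 then 0 else fdiff j f x)" for j
        by (auto simp: g_def fdiff_diff fdiff_const)
      have "\<forall>j\<le>N. \<bar>fdiff j g x\<bar> \<le> K * \<epsilon> ^ j" using fdiff \<epsilon> by (auto simp: fdg)
      then have g: "derivs_le (Suc m) {0..real N} (\<lambda>i. C * K * \<epsilon> ^ i) (poly (newton N g x))"
        using C(2) \<epsilon> by blast
      have "newton N f x = newton N g x + [:f x:]"
      proof -
        have "newton N f x = (\<Sum>j\<le>N. smult (fdiff j g x) (binomial_poly j) + (if j = 0 then [:f x:] else 0))"
          unfolding newton_def by (intro sum.cong) (auto simp: fdg binomial_poly_def)
        then show ?thesis by (simp add: sum.distrib newton_def)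
      qed
      then have "pderiv (newton N f x) = pderiv (newton N g x)"
        by (simp add: pderiv_add pderiv_pCons)
      moreover have "derivs_le m {0..real N} (\<lambda>i. C * K * \<epsilon> ^ Suc i) (poly (pderiv (newton N g x)))"
        by (rule derivs_le_derivative[OF _ g]) (use False in \<open>auto intro: poly_DERIV[THEN DERIV_subset]\<close>)
      ultimately show "derivs_le m {0..real N} (\<lambda>i. C * K * \<epsilon> ^ Suc i) (poly (pderiv (newton N f x)))"
        by simp
    qed (use C in auto)
  qed
qed

lemma slow_comp_derivs_le:
  assumes "0 \<le> K" "\<And>j. 0 \<le> B j"
  shows "\<exists>C\<ge>0. \<forall>\<epsilon> G f x. 0 < \<epsilon> \<longrightarrow> \<epsilon> \<le> 1 \<longrightarrow>
      (\<forall>j z. (G j has_real_derivative G (Suc j) z) (at z)) \<longrightarrow> (\<forall>j z. \<bar>G j z\<bar> \<le> B j) \<longrightarrow>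
      (\<forall>j. 1 \<le> j \<and> j \<le> N \<longrightarrow> \<bar>fdiff j f x\<bar> \<le> K * \<epsilon> ^ j) \<longrightarrow>
      derivs_le m {0..real N} (\<lambda>i. C * \<epsilon> ^ i) (\<lambda>\<tau>. G 0 (poly (newton N f x) \<tau>))"
proof -
  obtain C where C: "0 \<le> C" "\<And>\<epsilon> f x K. 0 < \<epsilon> \<Longrightarrow> \<epsilon> \<le> 1 \<Longrightarrow> 0 \<le> K \<Longrightarrow> (\<forall>j. 1 \<le> j \<and> j \<le> N \<longrightarrow> \<bar>fdiff j f x\<bar> \<le> K * \<epsilon> ^ j) \<Longrightarrow>
     derivs_le m {0..real N} (\<lambda>i. C * K * \<epsilon> ^ Suc i) (poly (pderiv (newton N f x)))"
    using newton_derivative_derivs_le[of N m] by blast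
  have CK: "0 \<le> C * K" using C(1) assms(1) by simp
  obtain D where D: "0 \<le> D" "\<And>X w G f f'. submult w \<Longrightarrow>
      (\<forall>j z. (G j has_real_derivative G (Suc j) z) (at z)) \<Longrightarrow> (\<forall>j z. \<bar>G j z\<bar> \<le> B j) \<Longrightarrow>
      (\<forall>x\<in>X. (f has_real_derivative f' x) (at x within X)) \<Longrightarrow>
      derivs_le m X (\<lambda>j. C * K * w (Suc j)) f' \<Longrightarrow> derivs_le m X (\<lambda>j. D * w j) (\<lambda>x. G 0 (f x))"
    using derivs_le_comp[of "C * K" B m, OF CK assms(2)] by metis
  show ?thesis
  proof (intro exI[of _ D] conjI allI impI)
    fix \<epsilon> f x and G :: "nat \<Rightarrow> real \<Rightarrow> real"
    assume *: "0 < \<epsilon>" "\<epsilon> \<le> 1" "\<forall>j z. (G j has_real_derivative G (Suc j) z) (at z)"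
      "\<forall>j z. \<bar>G j z\<bar> \<le> B j" "\<forall>j. 1 \<le> j \<and> j \<le> N \<longrightarrow> \<bar>fdiff j f x\<bar> \<le> K * \<epsilon> ^ j"
    show "derivs_le m {0..real N} (\<lambda>i. D * \<epsilon> ^ i) (\<lambda>\<tau>. G 0 (poly (newton N f x) \<tau>))"
    proof (rule D(2)[OF _ *(3,4), of "\<lambda>j. \<epsilon> ^ j"])
      show "submult (\<lambda>j. \<epsilon> ^ j)" using * by (intro submult_powers) auto
      show "derivs_le m {0..real N} (\<lambda>j. C * K * \<epsilon> ^ Suc j) (poly (pderiv (newton N f x)))"
        using C(2) * assms(1) by blast
    qed (auto intro: poly_DERIV[THEN DERIV_subset])
  qed (use D in auto)
qed

text \<open>Differences only see the nodes, where \<open>f\<close> and its interpolant agree, so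
  \<open>f\<close> may be replaced by the interpolant, to which the chain rule for derivatives
  applies. Between the nodes \<open>f\<close> may oscillate at will.\<close>

lemma fdiff_comp_bound:
  assumes "0 \<le> K" "\<And>j. 0 \<le> B j"
  shows "\<exists>C\<ge>0. \<forall>\<epsilon> G f x. 0 < \<epsilon> \<longrightarrow> \<epsilon> \<le> 1 \<longrightarrow>
      (\<forall>j z. (G j has_real_derivative G (Suc j) z) (at z)) \<longrightarrow> (\<forall>j z. \<bar>G j z\<bar> \<le> B j) \<longrightarrow>
      (\<forall>j. 1 \<le> j \<and> j \<le> N \<longrightarrow> \<bar>fdiff j f x\<bar> \<le> K * \<epsilon> ^ j) \<longrightarrow>
      \<bar>fdiff N (\<lambda>z. G 0 (f z)) x\<bar> \<le> C * \<epsilon> ^ N"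
proof -
  obtain C where C: "0 \<le> C" "\<And>\<epsilon> G f x. 0 < \<epsilon> \<Longrightarrow> \<epsilon> \<le> 1 \<Longrightarrow>
      (\<forall>j z. (G j has_real_derivative G (Suc j) z) (at z)) \<Longrightarrow> (\<forall>j z. \<bar>G j z\<bar> \<le> B j) \<Longrightarrow>
      (\<forall>j. 1 \<le> j \<and> j \<le> N \<longrightarrow> \<bar>fdiff j f x\<bar> \<le> K * \<epsilon> ^ j) \<Longrightarrow>
      derivs_le N {0..real N} (\<lambda>i. C * \<epsilon> ^ i) (\<lambda>\<tau>. G 0 (poly (newton N f x) \<tau>))"
    using slow_comp_derivs_le[of K B N N] assms by metis
  show ?thesis
  proof (intro exI[of _ C] conjI allI impI)
    fix \<epsilon> f x and G :: "nat \<Rightarrow> real \<Rightarrow> real"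
    assume *: "0 < \<epsilon>" "\<epsilon> \<le> 1" "\<forall>j z. (G j has_real_derivative G (Suc j) z) (at z)"
      "\<forall>j z. \<bar>G j z\<bar> \<le> B j" "\<forall>j. 1 \<le> j \<and> j \<le> N \<longrightarrow> \<bar>fdiff j f x\<bar> \<le> K * \<epsilon> ^ j"
    have "fdiff N (\<lambda>z. G 0 (f z)) x = fdiff N (\<lambda>\<tau>. G 0 (poly (newton N f x) \<tau>)) 0"
      by (rule fdiff_cong) (simp add: poly_newton)
    then show "\<bar>fdiff N (\<lambda>z. G 0 (f z)) x\<bar> \<le> C * \<epsilon> ^ N"
      using fdiff_le_of_derivs_le[OF C(2)[OF *], of 0] by simp
  qed (use C in auto)
qed

lemma ndiff_newton_error:
  assumes "1 \<le> N" "derivs_le (Suc N) {0..real N} w g"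
    and "\<And>m. m \<le> N \<Longrightarrow> h (x + real m) = g (real m)"
    and "(g has_real_derivative d) (at 0)"
  shows "\<bar>ndiff N h x - d\<bar> \<le> ndiff_norm N * real N ^ Suc N * w (Suc N)"
proof -
  have "ndiff N h x = ndiff N g 0" using assms(3) by (intro ndiff_cong) auto
  then show ?thesis
    using ndiff_error[of N 0 N w g d] assms by (auto intro: DERIV_subset)
qed

text \<open>For the interpolant of \<open>f\<close> the true chain rule holds; the price is the
  error of differentiating one slow smooth function numerically, which is of order
  \<open>N + 1\<close>.\<close>

lemma ndiff_comp:
  assumes "0 \<le> K" "\<And>j. 0 \<le> B j" "1 \<le> N"
  shows "\<exists>C\<ge>0. \<forall>\<epsilon> G f x. 0 < \<epsilon> \<longrightarrow> \<epsilon> \<le> 1 \<longrightarrow>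
      (\<forall>j z. (G j has_real_derivative G (Suc j) z) (at z)) \<longrightarrow> (\<forall>j z. \<bar>G j z\<bar> \<le> B j) \<longrightarrow>
      (\<forall>j. 1 \<le> j \<and> j \<le> N \<longrightarrow> \<bar>fdiff j f x\<bar> \<le> K * \<epsilon> ^ j) \<longrightarrow>
      \<bar>ndiff N (\<lambda>z. G 0 (f z)) x - G 1 (f x) * ndiff N f x\<bar> \<le> C * \<epsilon> ^ Suc N"
proof -
  obtain C where C: "0 \<le> C" "\<And>\<epsilon> G f x. 0 < \<epsilon> \<Longrightarrow> \<epsilon> \<le> 1 \<Longrightarrow>
      (\<forall>j z. (G j has_real_derivative G (Suc j) z) (at z)) \<Longrightarrow> (\<forall>j z. \<bar>G j z\<bar> \<le> B j) \<Longrightarrow>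
      (\<forall>j. 1 \<le> j \<and> j \<le> N \<longrightarrow> \<bar>fdiff j f x\<bar> \<le> K * \<epsilon> ^ j) \<Longrightarrow>
      derivs_le (Suc N) {0..real N} (\<lambda>i. C * \<epsilon> ^ i) (\<lambda>\<tau>. G 0 (poly (newton N f x) \<tau>))"
    using slow_comp_derivs_le[of K B N "Suc N"] assms by metis
  show ?thesis
  proof (intro exI[of _ "ndiff_norm N * real N ^ Suc N * C"] conjI allI impI)
    fix \<epsilon> f x and G :: "nat \<Rightarrow> real \<Rightarrow> real"
    assume *: "0 < \<epsilon>" "\<epsilon> \<le> 1" "\<forall>j z. (G j has_real_derivative G (Suc j) z) (at z)"
      "\<forall>j z. \<bar>G j z\<bar> \<le> B j" "\<forall>j. 1 \<le> j \<and> j \<le> N \<longrightarrow> \<bar>fdiff j f x\<bar> \<le> K * \<epsilon> ^ j"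
    let ?P = "newton N f x"
    have P0: "poly ?P 0 = f x" using poly_newton[of 0 N f x] by simp
    have "\<bar>ndiff N (\<lambda>z. G 0 (f z)) x - G 1 (poly ?P 0) * poly (pderiv ?P) 0\<bar>
        \<le> ndiff_norm N * real N ^ Suc N * (C * \<epsilon> ^ Suc N)"
    proof (rule ndiff_newton_error[OF assms(3) C(2)[OF *]])
      show "((\<lambda>\<tau>. G 0 (poly ?P \<tau>)) has_real_derivative G 1 (poly ?P 0) * poly (pderiv ?P) 0) (at 0)"
        using DERIV_chain2[of "G 0" "G 1 (poly ?P 0)" "poly ?P" 0] *(3) poly_DERIV by auto
    qed (simp add: poly_newton)
    then show "\<bar>ndiff N (\<lambda>z. G 0 (f z)) x - G 1 (f x) * ndiff N f x\<bar>
        \<le> ndiff_norm N * real N ^ Suc N * C * \<epsilon> ^ Suc N"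
      by (simp add: P0 ndiff_newton mult.assoc)
  qed (use C ndiff_norm_nonneg[of N] in auto)
qed

text \<open>The half square is unbounded, so it is not an instance of \<open>ndiff_comp\<close>. The
  product rule replaces the chain rule, and the value of \<open>f\<close> must now be bounded as
  well, which holds for momenta.\<close>

lemma ndiff_square:
  assumes "0 \<le> K" "1 \<le> N"
  shows "\<exists>C\<ge>0. \<forall>\<epsilon> f x. 0 < \<epsilon> \<longrightarrow> \<epsilon> \<le> 1 \<longrightarrow>
      (\<forall>j\<le>N. \<bar>fdiff j f x\<bar> \<le> K * \<epsilon> ^ j) \<longrightarrow>
      \<bar>ndiff N (\<lambda>z. (f z)\<^sup>2 / 2) x - f x * ndiff N f x\<bar> \<le> C * \<epsilon> ^ Suc N"
proof -
  obtain C where C: "0 \<le> C" "\<And>\<epsilon> f x K. 0 < \<epsilon> \<Longrightarrow> \<epsilon> \<le> 1 \<Longrightarrow> (\<forall>j\<le>N. \<bar>fdiff j f x\<bar> \<le> K * \<epsilon> ^ j) \<Longrightarrow>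
     derivs_le (Suc N) {0..real N} (\<lambda>i. C * K * \<epsilon> ^ i) (poly (newton N f x))"
    using newton_derivs_le[of N "Suc N"] by blast
  define D where "D = 1/2 * (2 ^ Suc N * (C * K)\<^sup>2)"
  have D: "0 \<le> D" by (simp add: D_def)
  show ?thesis
  proof (intro exI[of _ "ndiff_norm N * real N ^ Suc N * D"] conjI allI impI)
    fix \<epsilon> f x
    assume *: "0 < \<epsilon>" "\<epsilon> \<le> 1" "\<forall>j\<le>N. \<bar>fdiff j f x\<bar> \<le> K * \<epsilon> ^ j"
    let ?P = "newton N f x"
    have P0: "poly ?P 0 = f x" using poly_newton[of 0 N f x] by simp
    have "derivs_le (Suc N) {0..real N} (\<lambda>i. 2 ^ Suc N * ((C * K)\<^sup>2 * \<epsilon> ^ i)) (\<lambda>\<tau>. poly ?P \<tau> * poly ?P \<tau>)"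
      by (rule derivs_le_mult[OF C(2)[OF *] C(2)[OF *]])
        (use C assms * in \<open>auto simp: power2_eq_square power_add\<close>)
    from derivs_le_cmult[OF this, of "1/2"]
    have d: "derivs_le (Suc N) {0..real N} (\<lambda>i. D * \<epsilon> ^ i) (\<lambda>\<tau>. 1/2 * (poly ?P \<tau> * poly ?P \<tau>))"
      by (simp add: D_def mult.assoc)
    have "\<bar>ndiff N (\<lambda>z. (f z)\<^sup>2 / 2) x - poly ?P 0 * poly (pderiv ?P) 0\<bar>
        \<le> ndiff_norm N * real N ^ Suc N * (D * \<epsilon> ^ Suc N)"
    proof (rule ndiff_newton_error[OF assms(2) d])
      show "((\<lambda>\<tau>. 1/2 * (poly ?P \<tau> * poly ?P \<tau>)) has_real_derivative poly ?P 0 * poly (pderiv ?P) 0) (at 0)"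
        by (auto intro!: derivative_eq_intros)
    qed (simp add: poly_newton power2_eq_square)
    then show "\<bar>ndiff N (\<lambda>z. (f z)\<^sup>2 / 2) x - f x * ndiff N f x\<bar>
        \<le> ndiff_norm N * real N ^ Suc N * D * \<epsilon> ^ Suc N"
      by (simp add: P0 ndiff_newton mult.assoc)
  qed (use D ndiff_norm_nonneg[of N] in auto)
qed

section \<open>Interpolation of derivatives\<close>

text \<open>By induction \<open>g j\<close> is small somewhere in each outer third of the interval,
  and the mean value theorem between the two points gives a small value of \<open>g (Suc j)\<close>.
  The hypothesis allows larger values of \<open>g 0\<close> on shorter subintervals; thus its
  negation, \<open>\<bar>g 0\<bar>\<close> above \<open>\<theta> / (v - u)\<close> on all of
  \<open>{u..v}\<close>, bounds the integral of the square from below however short the subinterval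
  is.\<close>

lemma small_point:
  fixes h :: real
  assumes "0 < h"
  shows "\<exists>D>0. \<forall>g u v \<theta>. v - u = h \<longrightarrow> 0 \<le> \<theta> \<longrightarrow>
    (\<forall>i<j. \<forall>x\<in>{u..v}. (g i has_real_derivative g (Suc i) x) (at x within {u..v})) \<longrightarrow>
    (\<forall>u' v'. u \<le> u' \<and> u' < v' \<and> v' \<le> v \<longrightarrow> (\<exists>\<xi>\<in>{u'..v'}. \<bar>g 0 \<xi>\<bar> \<le> \<theta> / (v' - u'))) \<longrightarrow>
    (\<exists>\<xi>\<in>{u..v}. \<bar>g j \<xi> :: real\<bar> \<le> D * \<theta>)"
  using assms
proof (induction j arbitrary: h)
  case 0
  show ?case
  proof (intro exI[of _ "1/h"] conjI allI impI)
    fix g :: "nat \<Rightarrow> real \<Rightarrow> real" and u v \<theta>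
    assume "v - u = h" "\<forall>u' v'. u \<le> u' \<and> u' < v' \<and> v' \<le> v \<longrightarrow> (\<exists>\<xi>\<in>{u'..v'}. \<bar>g 0 \<xi>\<bar> \<le> \<theta> / (v' - u'))"
    then show "\<exists>\<xi>\<in>{u..v}. \<bar>g 0 \<xi>\<bar> \<le> 1 / h * \<theta>" using 0 by force
  qed (use 0 in auto)
next
  case (Suc j)
  have h3: "0 < h / 3" using Suc.prems by simp
  obtain D where D: "D > 0" "\<And>g u v \<theta>. v - u = h/3 \<Longrightarrow> 0 \<le> \<theta> \<Longrightarrow>
    (\<forall>i<j. \<forall>x\<in>{u..v}. (g i has_real_derivative g (Suc i) x) (at x within {u..v})) \<Longrightarrow>
    (\<forall>u' v'. u \<le> u' \<and> u' < v' \<and> v' \<le> v \<longrightarrow> (\<exists>\<xi>\<in>{u'..v'}. \<bar>g 0 \<xi>\<bar> \<le> \<theta> / (v' - u'))) \<Longrightarrow>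
    (\<exists>\<xi>\<in>{u..v}. \<bar>g j \<xi> :: real\<bar> \<le> D * \<theta>)" using Suc.IH[OF h3] by blast
  show ?case
  proof (intro exI[of _ "2 * D / (h/3)"] conjI allI impI)
    show "0 < 2 * D / (h/3)" using D h3 by simp
    fix g :: "nat \<Rightarrow> real \<Rightarrow> real" and u v \<theta>
    assume uv: "v - u = h" and \<theta>: "0 \<le> \<theta>"
      and g: "\<forall>i<Suc j. \<forall>x\<in>{u..v}. (g i has_real_derivative g (Suc i) x) (at x within {u..v})"
      and pt: "\<forall>u' v'. u \<le> u' \<and> u' < v' \<and> v' \<le> v \<longrightarrow> (\<exists>\<xi>\<in>{u'..v'}. \<bar>g 0 \<xi>\<bar> \<le> \<theta> / (v' - u'))"
    have sub: "\<exists>\<xi>\<in>{u1..v1}. \<bar>g j \<xi>\<bar> \<le> D * \<theta>" if "u \<le> u1" "v1 \<le> v" "v1 - u1 = h/3" for u1 v1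
    proof (rule D(2)[OF that(3) \<theta>])
      show "\<forall>i<j. \<forall>x\<in>{u1..v1}. (g i has_real_derivative g (Suc i) x) (at x within {u1..v1})"
        using g that by (auto intro!: has_field_derivative_subset[of "g _" _ _ "{u..v}" "{u1..v1}"])
    qed (use pt that in auto)
    obtain a where a: "a \<in> {u..u + h/3}" "\<bar>g j a\<bar> \<le> D * \<theta>" using sub[of u "u + h/3"] uv h3 by auto
    obtain b where b: "b \<in> {v - h/3..v}" "\<bar>g j b\<bar> \<le> D * \<theta>" using sub[of "v - h/3" v] uv h3 by auto
    have ab: "h/3 \<le> b - a" using a(1) b(1) uv by auto
    have "\<exists>\<xi>\<in>{a<..<b}. g j b - g j a = (b - a) * g (Suc j) \<xi>"
    proof (rule mvt_within)
      show "(g j has_real_derivative g (Suc j) x) (at x within {a..b})" if "x \<in> {a..b}" for x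
        by (rule has_field_derivative_subset[of "g j" _ x "{u..v}"]) (use g that a b in auto)
    qed (use ab h3 in auto)
    then obtain \<xi> where \<xi>: "\<xi> \<in> {a<..<b}" "g j b - g j a = (b - a) * g (Suc j) \<xi>" by blast
    have "h/3 * \<bar>g (Suc j) \<xi>\<bar> \<le> (b - a) * \<bar>g (Suc j) \<xi>\<bar>" using ab by (intro mult_right_mono) auto
    also have "\<dots> = \<bar>g j b - g j a\<bar>" using ab h3 \<xi> by (simp add: abs_mult)
    also have "\<dots> \<le> 2 * (D * \<theta>)" using a b by linarith
    finally have "\<bar>g (Suc j) \<xi>\<bar> \<le> 2 * D / (h/3) * \<theta>" using h3 by (simp add: field_simps)
    then show "\<exists>\<xi>\<in>{u..v}. \<bar>g (Suc j) \<xi>\<bar> \<le> 2 * D / (h/3) * \<theta>" using \<xi>(1) a(1) b(1) by force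
  qed
qed

text \<open>A qualitative Landau-Kolmogorov inequality. Induction from the top order:
  \<open>g M\<close> has a small value near every point and a bounded derivative, hence is at most
  \<open>\<eta>\<close>; then \<open>\<eta>\<close> takes the role of the bound \<open>C\<close> one
  order lower.\<close>

lemma interpolation:
  fixes C \<eta> :: real
  assumes "0 \<le> C" "0 < \<eta>"
  shows "\<exists>\<theta>0>0. \<forall>g a \<theta>. 0 \<le> \<theta> \<longrightarrow> \<theta> \<le> \<theta>0 \<longrightarrow>
    (\<forall>i<M. \<forall>x\<in>{a..a+1}. (g i has_real_derivative g (Suc i) x) (at x within {a..a+1})) \<longrightarrow>
    (\<forall>x\<in>{a..a+1}. \<bar>g M x\<bar> \<le> C) \<longrightarrow>
    (\<forall>u v. a \<le> u \<and> u < v \<and> v \<le> a + 1 \<longrightarrow> (\<exists>\<xi>\<in>{u..v}. \<bar>g 0 \<xi>\<bar> \<le> \<theta> / (v - u))) \<longrightarrow>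
    (\<forall>j<M. \<forall>x\<in>{a..a+1}. \<bar>g j x\<bar> \<le> (\<eta> :: real))"
  using assms(1)
proof (induction M arbitrary: C)
  case 0
  show ?case by (intro exI[of _ 1]) auto
next
  case (Suc M)
  \<comment> \<open>On a window of this length a function with derivative at most \<open>C\<close>
    varies by at most \<open>\<eta> / 2\<close>; the other half of \<open>\<eta>\<close> is left for
    the value at the small point.\<close>
  define h where "h = min 1 (\<eta> / (2 * (C + 1)))"
  have h: "0 < h" "h \<le> 1" using assms(2) Suc.prems by (auto simp: h_def)
  have "h * C \<le> \<eta> / (2 * (C + 1)) * C" unfolding h_def using Suc.prems by (intro mult_right_mono) auto
  also have "\<dots> \<le> \<eta> / 2" using assms(2) Suc.prems by (simp add: field_simps)
  finally have hC: "h * C \<le> \<eta> / 2" .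
  obtain D where D: "D > 0" "\<And>g u v \<theta>. v - u = h \<Longrightarrow> 0 \<le> \<theta> \<Longrightarrow>
    (\<forall>i<M. \<forall>x\<in>{u..v}. (g i has_real_derivative g (Suc i) x) (at x within {u..v})) \<Longrightarrow>
    (\<forall>u' v'. u \<le> u' \<and> u' < v' \<and> v' \<le> v \<longrightarrow> (\<exists>\<xi>\<in>{u'..v'}. \<bar>g 0 \<xi>\<bar> \<le> \<theta> / (v' - u'))) \<Longrightarrow>
    (\<exists>\<xi>\<in>{u..v}. \<bar>g M \<xi> :: real\<bar> \<le> D * \<theta>)" using small_point[OF h(1), of M] by blast
  obtain \<theta>1 where \<theta>1: "\<theta>1 > 0" "\<And>g a \<theta>. 0 \<le> \<theta> \<Longrightarrow> \<theta> \<le> \<theta>1 \<Longrightarrow>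
    (\<forall>i<M. \<forall>x\<in>{a..a+1}. (g i has_real_derivative g (Suc i) x) (at x within {a..a+1})) \<Longrightarrow>
    (\<forall>x\<in>{a..a+1}. \<bar>g M x\<bar> \<le> \<eta>) \<Longrightarrow>
    (\<forall>u v. a \<le> u \<and> u < v \<and> v \<le> a + 1 \<longrightarrow> (\<exists>\<xi>\<in>{u..v}. \<bar>g 0 \<xi>\<bar> \<le> \<theta> / (v - u))) \<Longrightarrow>
    (\<forall>j<M. \<forall>x\<in>{a..a+1}. \<bar>g j x\<bar> \<le> (\<eta> :: real))"
    using Suc.IH[of \<eta>] assms(2) by (auto simp: less_imp_le)
  show ?case
  proof (intro exI[of _ "min \<theta>1 (\<eta> / (2 * D))"] conjI allI impI)
    show "0 < min \<theta>1 (\<eta> / (2 * D))" using \<theta>1 D assms(2) by auto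
    fix g :: "nat \<Rightarrow> real \<Rightarrow> real" and a \<theta> j
    assume \<theta>: "0 \<le> \<theta>" "\<theta> \<le> min \<theta>1 (\<eta> / (2 * D))"
      and g: "\<forall>i<Suc M. \<forall>x\<in>{a..a+1}. (g i has_real_derivative g (Suc i) x) (at x within {a..a+1})"
      and C: "\<forall>x\<in>{a..a+1}. \<bar>g (Suc M) x\<bar> \<le> C"
      and pt: "\<forall>u v. a \<le> u \<and> u < v \<and> v \<le> a + 1 \<longrightarrow> (\<exists>\<xi>\<in>{u..v}. \<bar>g 0 \<xi>\<bar> \<le> \<theta> / (v - u))"
      and j: "j < Suc M"
    have "\<theta> * (2 * D) \<le> \<eta>" using \<theta> D by (simp add: pos_le_divide_eq)
    then have D\<theta>: "D * \<theta> \<le> \<eta> / 2" by (simp add: algebra_simps)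
    have top: "\<bar>g M x\<bar> \<le> \<eta>" if x: "x \<in> {a..a+1}" for x
    proof -
      \<comment> \<open>Shifted to the left near the right end, so that a window of length
        \<open>h\<close> containing \<open>x\<close> stays in \<open>{a..a+1}\<close>.\<close>
      define u where "u = min x (a + 1 - h)"
      have u: "a \<le> u" "u + h \<le> a + 1" "x \<in> {u..u+h}" using x h by (auto simp: u_def)
      have sub: "(g i has_real_derivative g (Suc i) z) (at z within {u..u+h})"
        if "i < Suc M" "z \<in> {u..u+h}" for i z
        by (rule has_field_derivative_subset[of "g i" _ z "{a..a+1}"]) (use g that u in auto)
      have "\<exists>\<xi>\<in>{u..u+h}. \<bar>g M \<xi>\<bar> \<le> D * \<theta>"
        by (rule D(2)) (use \<theta> sub pt u in auto)
      then obtain \<xi> where \<xi>: "\<xi> \<in> {u..u+h}" "\<bar>g M \<xi>\<bar> \<le> D * \<theta>" by blast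
      have "norm (g M x - g M \<xi>) \<le> C * norm (x - \<xi>)"
        by (rule field_differentiable_bound[of "{u..u+h}" "g M" "g (Suc M)"]) (use sub C u \<xi> in auto)
      also have "\<dots> \<le> C * h" using \<xi> u Suc.prems by (intro mult_left_mono) (auto simp: abs_if)
      finally have "\<bar>g M x - g M \<xi>\<bar> \<le> \<eta> / 2" using hC by (simp add: mult.commute)
      then show ?thesis using \<xi>(2) D\<theta> by linarith
    qed
    show "\<forall>x\<in>{a..a+1}. \<bar>g j x\<bar> \<le> \<eta>"
    proof (cases "j = M")
      case False
      then show ?thesis using \<theta>1(2)[of \<theta> a g] \<theta> g pt top j by auto
    qed (use top in auto)
  qed
qed

declare derivs_le.simps(2) [simp del]

section \<open>Trigonometric polynomials\<close>

text \<open>Each differentiation of the mode \<open>m\<close> brings a factor \<open>m\<close> and a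
  phase shift by \<open>pi / 2\<close>, which gives all derivatives in closed form with visible
  bounds and period.\<close>

lemma finite_fourier_derivatives:
  assumes "finite_fourier_no_const f"
  shows "\<exists>g c. g 0 = f \<and> (\<forall>j x. (g j has_real_derivative g (Suc j) x) (at x)) \<and>
    (\<forall>j x. \<bar>g j x\<bar> \<le> c j) \<and> (\<forall>j x. g j (x + 2 * pi) = (g j x :: real))"
proof -
  obtain M and a b :: "nat \<Rightarrow> real" where f: "\<And>x. f x = (\<Sum>m=1..M. a m * cos (real m * x) + b m * sin (real m * x))"
    using assms by (auto simp: finite_fourier_no_const_def)
  define g where "g j x = (\<Sum>m=1..M. real m ^ j * (a m * cos (real m * x + real j * (pi / 2)) + b m * sin (real m * x + real j * (pi / 2))))" for j x
  define c where "c j = (\<Sum>m=1..M. real m ^ j * (\<bar>a m\<bar> + \<bar>b m\<bar>))" for j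
  have shift: "cos (z + real (Suc j) * (pi / 2)) = - sin (z + real j * (pi / 2))"
    "sin (z + real (Suc j) * (pi / 2)) = cos (z + real j * (pi / 2))" for z j
  proof -
    have "z + real (Suc j) * (pi / 2) = (z + real j * (pi / 2)) + pi / 2" by (simp add: algebra_simps)
    then show "cos (z + real (Suc j) * (pi / 2)) = - sin (z + real j * (pi / 2))"
      "sin (z + real (Suc j) * (pi / 2)) = cos (z + real j * (pi / 2))"
      by (simp_all only: cos_add sin_add) simp_all
  qed
  have "(g j has_real_derivative g (Suc j) x) (at x)" for j x
    unfolding g_def[abs_def]
  proof (rule DERIV_sum)
    fix m
    show "((\<lambda>x. real m ^ j * (a m * cos (real m * x + real j * (pi / 2)) + b m * sin (real m * x + real j * (pi / 2))))
      has_real_derivative real m ^ Suc j * (a m * cos (real m * x + real (Suc j) * (pi / 2)) + b m * sin (real m * x + real (Suc j) * (pi / 2)))) (at x)"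
      unfolding shift by (auto intro!: derivative_eq_intros simp: algebra_simps)
  qed
  moreover have "\<bar>g j x\<bar> \<le> c j" for j x
  proof -
    have "\<bar>g j x\<bar> \<le> (\<Sum>m=1..M. \<bar>real m ^ j * (a m * cos (real m * x + real j * (pi / 2)) + b m * sin (real m * x + real j * (pi / 2)))\<bar>)"
      unfolding g_def by (rule sum_abs)
    also have "\<dots> \<le> c j"
      unfolding c_def
    proof (rule sum_mono)
      fix m
      let ?z = "real m * x + real j * (pi / 2)"
      have "\<bar>a m * cos ?z + b m * sin ?z\<bar> \<le> \<bar>a m * cos ?z\<bar> + \<bar>b m * sin ?z\<bar>" by (rule abs_triangle_ineq)
      also have "\<dots> \<le> \<bar>a m\<bar> * 1 + \<bar>b m\<bar> * 1"
        unfolding abs_mult by (intro add_mono mult_left_mono) auto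
      finally show "\<bar>real m ^ j * (a m * cos ?z + b m * sin ?z)\<bar> \<le> real m ^ j * (\<bar>a m\<bar> + \<bar>b m\<bar>)"
        by (simp add: abs_mult mult_left_mono)
    qed
    finally show ?thesis .
  qed
  moreover have "g j (x + 2 * pi) = g j x" for j x
    unfolding g_def
  proof (intro sum.cong refl)
    fix m
    have "real m * (x + 2 * pi) + real j * (pi / 2) = (real m * x + real j * (pi / 2)) + 2 * real m * pi"
      by (simp add: algebra_simps)
    then show "real m ^ j * (a m * cos (real m * (x + 2 * pi) + real j * (pi / 2)) + b m * sin (real m * (x + 2 * pi) + real j * (pi / 2)))
       = real m ^ j * (a m * cos (real m * x + real j * (pi / 2)) + b m * sin (real m * x + real j * (pi / 2)))"
      by (simp only: cos_add[of _ "2 * real m * pi"] sin_add[of _ "2 * real m * pi"] cos_2npi sin_2npi) simp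
  qed
  moreover have "g 0 = f" by (auto simp: g_def f)
  ultimately show ?thesis by (intro exI[of _ g] exI[of _ c]) auto
qed

text \<open>The sum of the two absolute values is continuous, periodic and nowhere zero, hence has a
  positive minimum, attained on one period.\<close>

lemma nondegenerate_gap:
  fixes g :: "nat \<Rightarrow> real \<Rightarrow> real"
  assumes g: "\<And>j x. (g j has_real_derivative g (Suc j) x) (at x)"
    and per: "\<And>j x. g j (x + 2 * pi) = g j x" and nd: "nondegenerate (g 0)"
  shows "\<exists>c>0. \<forall>x. c \<le> \<bar>g 1 x\<bar> + \<bar>g 2 x\<bar>"
proof -
  have d: "deriv (g j) = g (Suc j)" for j
    using g by (auto intro!: DERIV_imp_deriv)
  have nz: "0 < \<bar>g 1 x\<bar> + \<bar>g 2 x\<bar>" for x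
  proof -
    have "g 1 x \<noteq> 0 \<or> g 2 x \<noteq> 0" using nd by (auto simp: nondegenerate_def d numeral_2_eq_2)
    then show ?thesis by linarith
  qed
  have "continuous_on {0..2 * pi} (\<lambda>x. \<bar>g 1 x\<bar> + \<bar>g 2 x\<bar>)"
    using g by (intro continuous_intros) (meson DERIV_isCont continuous_at_imp_continuous_on)+
  then obtain x0 where x0: "\<And>x. x \<in> {0..2 * pi} \<Longrightarrow> \<bar>g 1 x0\<bar> + \<bar>g 2 x0\<bar> \<le> \<bar>g 1 x\<bar> + \<bar>g 2 x\<bar>"
    using continuous_attains_inf[of "{0..2 * pi}" "\<lambda>x. \<bar>g 1 x\<bar> + \<bar>g 2 x\<bar>"] by fastforce
  have "\<bar>g 1 x0\<bar> + \<bar>g 2 x0\<bar> \<le> \<bar>g 1 x\<bar> + \<bar>g 2 x\<bar>" for x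
  proof -
    have shift: "g j (z + 2 * pi * real m) = g j z" for j z and m :: nat
    proof (induction m)
      case (Suc m)
      have "g j (z + 2 * pi * real (Suc m)) = g j ((z + 2 * pi * real m) + 2 * pi)" by (simp add: algebra_simps)
      then show ?case using Suc per by simp
    qed simp
    define m where "m = \<lfloor>x / (2 * pi)\<rfloor>"
    define r where "r = x - 2 * pi * of_int m"
    have "of_int m \<le> x / (2 * pi)" "x / (2 * pi) < of_int m + 1"
      unfolding m_def by linarith+
    then have "of_int m * (2 * pi) \<le> x" "x < (of_int m + 1) * (2 * pi)"
      using pi_gt_zero by (simp_all only: pos_le_divide_eq pos_divide_less_eq mult_pos_pos zero_less_numeral)
    then have "r \<in> {0..2 * pi}" by (simp add: r_def algebra_simps)
    moreover have "g j x = g j r" for j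
    proof (cases "0 \<le> m")
      case True
      then have "x = r + 2 * pi * real (nat m)" by (simp add: r_def)
      then show ?thesis using shift by metis
    next
      case False
      then have "r = x + 2 * pi * real (nat (- m))" by (simp add: r_def)
      then show ?thesis using shift by metis
    qed
    ultimately show ?thesis using x0 by metis
  qed
  then show ?thesis using nz[of x0] by blast
qed

lemma ex_common_lower_bound:
  assumes "finite A" "\<And>i. i \<in> A \<Longrightarrow> \<exists>c>0. \<forall>x. c \<le> (f i x :: real)"
  shows "\<exists>c>0. \<forall>i\<in>A. \<forall>x. c \<le> f i x"
  using assms
proof (induction A rule: finite_induct)
  case empty
  show ?case by (intro exI[of _ 1]) auto
next
  case (insert i A)
  obtain c where c: "c > 0" "\<forall>i\<in>A. \<forall>x. c \<le> f i x" using insert by blast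
  obtain c' where c': "c' > 0" "\<forall>x. c' \<le> f i x" using insert by blast
  show ?case using c c' by (intro exI[of _ "min c c'"]) (auto simp: min_le_iff_disj)
qed

section \<open>The chain of rotators in scaled time\<close>

text \<open>\<open>W i j\<close> is the \<open>j\<close>-th derivative of the potential
  \<open>U i\<close>, with bounds \<open>B j\<close> common to all links; \<open>c0\<close> is the
  quantitative form of non-degeneracy. Links are numbered by their left rotator, hence the range
  \<open>{1..<n}\<close>.\<close>

locale rotator_chain =
  fixes n k :: nat and W :: "nat \<Rightarrow> nat \<Rightarrow> real \<Rightarrow> real" and B :: "nat \<Rightarrow> real" and \<gamma> c0 :: real
  assumes k2: "2 \<le> k" and kn: "k \<le> n" and \<gamma>: "0 < \<gamma>" and c0: "0 < c0"
    and W_deriv: "i \<in> {1..<n} \<Longrightarrow> (W i j has_real_derivative W i (Suc j) x) (at x)"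
    and W_bound: "i \<in> {1..<n} \<Longrightarrow> \<bar>W i j x\<bar> \<le> B j"
    and W_periodic: "i \<in> {1..<n} \<Longrightarrow> W i j (x + 2 * pi) = W i j x"
    and W_nondeg: "i \<in> {1..<n} \<Longrightarrow> c0 \<le> \<bar>W i 1 x\<bar> + \<bar>W i 2 x\<bar>"
begin

text \<open>In the time \<open>s = t / \<epsilon>\<close> with \<open>\<epsilon> = 2 * pi / L\<close>, the fast rotator has the phase
  \<open>2 * pi * s + p k s\<close> and the momentum \<open>L + y k s\<close>, with \<open>p k\<close> slow; all other rotators
  keep their phase and momentum. The fast phase enters the equations through \<open>\<kappa>\<close> only.\<close>

definition \<kappa> :: "nat \<Rightarrow> real" where
  "\<kappa> j = (if Suc j = k then 1 else if j = k then -1 else 0)"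

definition q :: "(nat \<Rightarrow> real \<Rightarrow> real) \<Rightarrow> nat \<Rightarrow> real \<Rightarrow> real" where
  "q p j s = p (Suc j) s - p j s + 2 * pi * \<kappa> j * s"

text \<open>Zero outside the chain, so that \<open>total_force\<close> covers the free ends: at
  \<open>i = 1\<close> the index \<open>i - 1\<close> is 0, and at \<open>i = n\<close> there is no
  link to the right.\<close>

definition u :: "(nat \<Rightarrow> real \<Rightarrow> real) \<Rightarrow> nat \<Rightarrow> real \<Rightarrow> real" where
  "u p j s = (if 1 \<le> j \<and> j < n then W j 1 (q p j s) else 0)"

definition total_force :: "(nat \<Rightarrow> real \<Rightarrow> real) \<Rightarrow> (nat \<Rightarrow> real \<Rightarrow> real) \<Rightarrow> nat \<Rightarrow> real \<Rightarrow> real" where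
  "total_force p y i s = u p i s - u p (i - 1) s - (if i = 1 then \<gamma> * y 1 s else 0)"

text \<open>The bound \<open>R\<close> belongs to the notion of solution because the estimates below
  are conditional on it; their constants may depend on \<open>R\<close>, but not on
  \<open>\<epsilon>\<close>, the window or the trajectory.\<close>

definition sol :: "real \<Rightarrow> real \<Rightarrow> real set \<Rightarrow> (nat \<Rightarrow> real \<Rightarrow> real) \<Rightarrow> (nat \<Rightarrow> real \<Rightarrow> real) \<Rightarrow> bool" where
  "sol \<epsilon> R X p y \<longleftrightarrow> 0 < \<epsilon> \<and> \<epsilon> \<le> 1 \<and> (\<forall>i\<in>{1..n}. \<forall>s\<in>X.
     (p i has_real_derivative \<epsilon> * y i s) (at s within X) \<and>
     (y i has_real_derivative \<epsilon> * total_force p y i s) (at s within X) \<and> \<bar>y i s\<bar> \<le> R)"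

lemma B_nonneg: "0 \<le> B j"
  using W_bound[of 1 j 0] k2 kn by (simp add: order_trans[OF abs_ge_zero])

lemma sol_subset: "sol \<epsilon> R X p y \<Longrightarrow> Y \<subseteq> X \<Longrightarrow> sol \<epsilon> R Y p y"
  unfolding sol_def by (blast intro: has_field_derivative_subset)

lemma q_deriv:
  assumes "sol \<epsilon> R X p y" "s \<in> X" "j \<in> {1..<n}"
  shows "(q p j has_real_derivative \<epsilon> * (y (Suc j) s - y j s) + 2 * pi * \<kappa> j) (at s within X)"
proof -
  have "(p (Suc j) has_real_derivative \<epsilon> * y (Suc j) s) (at s within X)"
    "(p j has_real_derivative \<epsilon> * y j s) (at s within X)"
    using assms by (auto simp: sol_def)
  then have "((\<lambda>s. p (Suc j) s - p j s + 2 * pi * \<kappa> j * s) has_real_derivative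
      \<epsilon> * (y (Suc j) s - y j s) + 2 * pi * \<kappa> j) (at s within X)"
    by (auto intro!: derivative_eq_intros simp: right_diff_distrib)
  then show ?thesis by (simp add: q_def[abs_def])
qed

lemma W_q_deriv:
  assumes "sol \<epsilon> R X p y" "s \<in> X" "j \<in> {1..<n}"
  shows "((\<lambda>s. W j d (q p j s)) has_real_derivative
    W j (Suc d) (q p j s) * (\<epsilon> * (y (Suc j) s - y j s) + 2 * pi * \<kappa> j)) (at s within X)"
  by (rule DERIV_chain2[OF W_deriv q_deriv]) (use assms in auto)

text \<open>The parameter \<open>d\<close> lets one bound serve the forces \<open>U'\<close> and the
  curvatures \<open>U''\<close>.\<close>

lemma W_derivs_le:
  assumes "0 \<le> K"
  shows "\<exists>D\<ge>0. \<forall>\<epsilon> R X p y w j. submult w \<longrightarrow> sol \<epsilon> R X p y \<longrightarrow> j \<in> {1..<n} \<longrightarrow>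
     derivs_le m X (\<lambda>l. K * w (Suc l)) (\<lambda>s. \<epsilon> * (y (Suc j) s - y j s) + 2 * pi * \<kappa> j) \<longrightarrow>
     derivs_le m X (\<lambda>l. D * w l) (\<lambda>s. W j d (q p j s))"
proof -
  obtain D where D: "0 \<le> D" "\<And>X w G f f'. submult w \<Longrightarrow>
      (\<forall>j z. (G j has_real_derivative G (Suc j) z) (at z)) \<Longrightarrow> (\<forall>j z. \<bar>G j z\<bar> \<le> B (d + j)) \<Longrightarrow>
      (\<forall>x\<in>X. (f has_real_derivative f' x) (at x within X)) \<Longrightarrow>
      derivs_le m X (\<lambda>j. K * w (Suc j)) f' \<Longrightarrow> derivs_le m X (\<lambda>j. D * w j) (\<lambda>x. G 0 (f x))"
    using derivs_le_comp[of K "\<lambda>j. B (d + j)" m, OF assms B_nonneg] by metis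
  show ?thesis
  proof (intro exI[of _ D] conjI allI impI)
    fix \<epsilon> R X p y w j
    assume *: "submult w" "sol \<epsilon> R X p y" "j \<in> {1..<n}"
      "derivs_le m X (\<lambda>l. K * w (Suc l)) (\<lambda>s. \<epsilon> * (y (Suc j) s - y j s) + 2 * pi * \<kappa> j)"
    show "derivs_le m X (\<lambda>l. D * w l) (\<lambda>s. W j d (q p j s))"
      using D(2)[OF *(1) _ _ _ *(4), of "\<lambda>l. W j (d + l)" "q p j"] W_deriv W_bound q_deriv[OF *(2)] *(3)
      by auto
  qed (use D in auto)
qed

section \<open>A priori bounds on the derivatives of the momenta\<close>

lemma y_deriv:
  assumes "sol \<epsilon> R X p y" "s \<in> X" "i \<in> {1..n}"
  shows "((\<lambda>s. \<epsilon> * y i s) has_real_derivative \<epsilon>\<^sup>2 * total_force p y i s) (at s within X)"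
  using assms by (auto simp: sol_def power2_eq_square intro!: derivative_eq_intros)

lemma u_derivs_le_eq:
  assumes "j \<in> {1..<n}" "derivs_le m X w (\<lambda>s. W j 1 (q p j s))"
  shows "derivs_le m X w (u p j)"
  using assms by (intro derivs_le_cong[OF assms(2)]) (auto simp: u_def)

lemma total_force_derivs_le:
  assumes "derivs_le m X w (u p i)" "derivs_le m X w (u p (i - 1))" "derivs_le m X v (\<lambda>s. \<epsilon> * y 1 s)"
    and "\<And>l. 0 \<le> v l" "0 < \<epsilon>"
  shows "derivs_le m X (\<lambda>l. \<epsilon>\<^sup>2 * (2 * w l) + \<gamma> * \<epsilon> * v l) (\<lambda>s. \<epsilon>\<^sup>2 * total_force p y i s)"
proof -
  have 1: "derivs_le m X (\<lambda>l. \<epsilon>\<^sup>2 * (2 * w l)) (\<lambda>s. \<epsilon>\<^sup>2 * (u p i s - u p (i - 1) s))"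
    using derivs_le_cmult[OF derivs_le_diff[OF assms(1,2)], of "\<epsilon>\<^sup>2"] by simp
  have 2: "derivs_le m X (\<lambda>l. \<gamma> * \<epsilon> * v l) (\<lambda>s. (if i = 1 then \<gamma> * \<epsilon> else 0) * (\<epsilon> * y 1 s))"
    by (rule derivs_le_mono[OF derivs_le_cmult[OF assms(3)]]) (use \<gamma> assms(4,5) in auto)
  show ?thesis
    by (rule derivs_le_cong[OF derivs_le_diff[OF 1 2]]) (auto simp: total_force_def algebra_simps power2_eq_square)
qed

lemma u_0_derivs_le: "(\<And>l. 0 \<le> w l) \<Longrightarrow> derivs_le m X w (u p 0)"
  using derivs_le_const[of 0 w m X] by (simp add: u_def[abs_def])

lemma kappa_le: "\<bar>\<kappa> j\<bar> \<le> 1"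
  by (auto simp: \<kappa>_def)

text \<open>A link that touches the fast rotator carries the constant velocity \<open>2 * pi\<close>
  up to sign, which is not small; there the weights must be at least 1. On the other links
  \<open>\<kappa> j = 0\<close>, and the velocity is as slow as the momenta.\<close>

lemma phase_velocity_derivs_le:
  assumes "derivs_le m X (\<lambda>l. C * w l) (\<lambda>s. \<epsilon> * y (Suc j) s)" "derivs_le m X (\<lambda>l. C * w l) (\<lambda>s. \<epsilon> * y j s)"
    and "0 \<le> C" "\<And>l. 0 \<le> w l" "\<kappa> j = 0 \<or> (\<forall>l. 1 \<le> w l)"
  shows "derivs_le m X (\<lambda>l. (2 * C + 2 * pi) * w l) (\<lambda>s. \<epsilon> * (y (Suc j) s - y j s) + 2 * pi * \<kappa> j)"
proof -
  have \<kappa>: "\<bar>2 * pi * \<kappa> j\<bar> \<le> 2 * pi * w l" for l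
  proof -
    have "\<bar>\<kappa> j\<bar> \<le> w l" using assms(4)[of l] assms(5) kappa_le[of j] by (auto intro: order_trans)
    then show ?thesis using mult_left_mono[of "\<bar>\<kappa> j\<bar>" "w l" "2 * pi"] by (simp add: abs_mult)
  qed
  have "derivs_le m X (\<lambda>l. 2 * pi * w l) (\<lambda>s. 2 * pi * \<kappa> j)"
    using \<kappa>[of 0] assms(4) by (intro derivs_le_const) auto
  from derivs_le_add[OF derivs_le_diff[OF assms(1,2)] this]
  have "derivs_le m X (\<lambda>l. (2 * C + 2 * pi) * w l)
      (\<lambda>s. \<epsilon> * y (Suc j) s - \<epsilon> * y j s + 2 * pi * \<kappa> j)"
    by (rule derivs_le_mono) (auto simp: algebra_simps)
  then show ?thesis by (rule derivs_le_cong) (simp add: algebra_simps)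
qed

text \<open>Regularity is gained order by order: momenta bounded to order \<open>m\<close> bound the
  phase velocities, hence the forces, to order \<open>m\<close>, and these are the derivatives of
  the momenta. No power of \<open>\<epsilon>\<close> is gained, since the fast phase moves at speed
  \<open>2 * pi\<close>.\<close>

lemma apriori_bound:
  assumes "0 \<le> R"
  shows "\<exists>C\<ge>0. \<forall>\<epsilon> X p y i. sol \<epsilon> R X p y \<longrightarrow> i \<in> {1..n} \<longrightarrow>
     derivs_le m X (\<lambda>_. C) (\<lambda>s. \<epsilon> * y i s)"
proof (induction m)
  case 0
  have "\<bar>\<epsilon> * y i s\<bar> \<le> R" if "sol \<epsilon> R X p y" "i \<in> {1..n}" "s \<in> X" for \<epsilon> X p y i s
  proof -
    have "\<bar>\<epsilon>\<bar> * \<bar>y i s\<bar> \<le> 1 * R" using that assms by (intro mult_mono) (auto simp: sol_def)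
    then show ?thesis by (simp add: abs_mult)
  qed
  then show ?case using assms by (intro exI[of _ R]) auto
next
  case (Suc m)
  obtain C where C: "0 \<le> C" "\<And>\<epsilon> X p y i. sol \<epsilon> R X p y \<Longrightarrow> i \<in> {1..n} \<Longrightarrow>
     derivs_le m X (\<lambda>_. C) (\<lambda>s. \<epsilon> * y i s)" using Suc.IH by blast
  have CK: "0 \<le> 2 * C + 2 * pi" using C(1) pi_ge_zero by linarith
  obtain D where D: "0 \<le> D" "\<And>\<epsilon> R X p y w j. submult w \<Longrightarrow> sol \<epsilon> R X p y \<Longrightarrow> j \<in> {1..<n} \<Longrightarrow>
     derivs_le m X (\<lambda>l. (2 * C + 2 * pi) * w (Suc l)) (\<lambda>s. \<epsilon> * (y (Suc j) s - y j s) + 2 * pi * \<kappa> j) \<Longrightarrow>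
     derivs_le m X (\<lambda>l. D * w l) (\<lambda>s. W j 1 (q p j s))"
    using W_derivs_le[OF CK, of m 1] by blast
  show ?case
  proof (intro exI[of _ "R + (2 * D + \<gamma> * C)"] conjI allI impI)
    show "0 \<le> R + (2 * D + \<gamma> * C)" using assms D C \<gamma> by auto
    fix \<epsilon> X p y i assume s: "sol \<epsilon> R X p y" and i: "i \<in> {1..n}"
    have \<epsilon>: "0 < \<epsilon>" "\<epsilon> \<le> 1" using s by (auto simp: sol_def)
    have uj: "derivs_le m X (\<lambda>_. D) (u p j)" if "j \<le> n" for j
    proof (cases "j \<in> {1..<n}")
      case True
      have "derivs_le m X (\<lambda>l. (2 * C + 2 * pi) * 1) (\<lambda>s. \<epsilon> * (y (Suc j) s - y j s) + 2 * pi * \<kappa> j)"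
        using C(2)[OF s] True C(1) by (intro phase_velocity_derivs_le) auto
      then have "derivs_le m X (\<lambda>l. D * 1) (\<lambda>s. W j 1 (q p j s))"
        by (intro D(2)[OF _ s True]) (auto simp: submult_def)
      then show ?thesis using u_derivs_le_eq[OF True] by simp
    next
      case False
      have "derivs_le m X (\<lambda>_. D) (\<lambda>_. 0)" using D by (intro derivs_le_const) auto
      then show ?thesis by (rule derivs_le_cong) (use False that in \<open>auto simp: u_def\<close>)
    qed
    show "derivs_le (Suc m) X (\<lambda>_. R + (2 * D + \<gamma> * C)) (\<lambda>s. \<epsilon> * y i s)"
    proof (rule derivs_le_SucI)
      have "derivs_le m X (\<lambda>l. \<epsilon>\<^sup>2 * (2 * D) + \<gamma> * \<epsilon> * C) (\<lambda>s. \<epsilon>\<^sup>2 * total_force p y i s)"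
        by (rule total_force_derivs_le[where y = y and \<epsilon> = \<epsilon>, OF uj[of i] uj[of "i - 1"] C(2)[OF s]]) (use i C \<epsilon> k2 kn in auto)
      then show "derivs_le m X (\<lambda>j. R + (2 * D + \<gamma> * C)) (\<lambda>s. \<epsilon>\<^sup>2 * total_force p y i s)"
      proof (rule derivs_le_mono[OF _ order_refl])
        have "\<epsilon>\<^sup>2 * (2 * D) \<le> 1 * (2 * D)" using \<epsilon> D by (intro mult_right_mono) (auto simp: power_le_one)
        moreover have "\<epsilon> * (\<gamma> * C) \<le> 1 * (\<gamma> * C)" using \<epsilon> C \<gamma> by (intro mult_right_mono) auto
        ultimately show "\<epsilon>\<^sup>2 * (2 * D) + \<gamma> * \<epsilon> * C \<le> R + (2 * D + \<gamma> * C)"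
          using assms by (simp add: ac_simps)
      qed
      show "((\<lambda>s. \<epsilon> * y i s) has_real_derivative \<epsilon>\<^sup>2 * total_force p y i x) (at x within X)" if "x \<in> X" for x
        using y_deriv[OF s that i] .
      show "\<bar>\<epsilon> * y i x\<bar> \<le> R + (2 * D + \<gamma> * C)" if "x \<in> X" for x
      proof -
        have "\<bar>\<epsilon>\<bar> * \<bar>y i x\<bar> \<le> 1 * R" using that s i assms by (intro mult_mono) (auto simp: sol_def)
        then show ?thesis using D C \<gamma> by (simp add: abs_mult add_increasing2)
      qed
    qed
  qed
qed

text \<open>Each step away from the fast rotator gains a factor \<open>\<epsilon>\<^sup>2\<close>.\<close>

lemma apriori_decay:
  assumes "0 \<le> R" "r \<le> k - 1"
  shows "\<exists>C\<ge>0. \<forall>\<epsilon> X p y i. sol \<epsilon> R X p y \<longrightarrow> 1 \<le> i \<longrightarrow> i + r \<le> k \<longrightarrow>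
     derivs_le m X (\<lambda>l. C * \<epsilon> ^ min (Suc l) (2 * r)) (\<lambda>s. \<epsilon> * y i s)"
  using assms(2)
proof (induction r arbitrary: m)
  case 0
  obtain C where "0 \<le> C" "\<And>\<epsilon> X p y i. sol \<epsilon> R X p y \<Longrightarrow> i \<in> {1..n} \<Longrightarrow>
     derivs_le m X (\<lambda>_. C) (\<lambda>s. \<epsilon> * y i s)" using apriori_bound[OF assms(1), of m] by blast
  then show ?case using kn by (intro exI[of _ C]) auto
next
  case (Suc r)
  \<comment> \<open>Two inductions are nested: over the distance \<open>r\<close> for the forces,
    which involve one rotator closer to \<open>k\<close>, and over the order \<open>m\<close> for
    the friction, which needs the bound on \<open>y 1\<close> at the same \<open>r\<close>.\<close>
  note outer = Suc.IH[OF Suc_leD[OF Suc.prems]]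
  \<comment> \<open>The momenta are merely bounded, so the order zero has only one power of
    \<open>\<epsilon>\<close> at any distance; the gain is in the derivatives, up to the ceiling
    \<open>2 * Suc r\<close>.\<close>
  have y_le: "\<bar>\<epsilon> * y i s\<bar> \<le> R * \<epsilon> ^ min (Suc 0) (2 * Suc r)"
    if "sol \<epsilon> R X p y" "i \<in> {1..n}" "s \<in> X" for \<epsilon> X p y i s
  proof -
    have "\<bar>y i s\<bar> * \<bar>\<epsilon>\<bar> \<le> R * \<epsilon>" using that assms(1) by (intro mult_mono) (auto simp: sol_def)
    then show ?thesis by (simp add: abs_mult mult.commute)
  qed
  show ?case
  proof (induction m)
    case 0
    show ?case using y_le kn assms(1) by (intro exI[of _ R]) auto
  next
    case (Suc m)
    obtain C2 where C2: "0 \<le> C2" "\<And>\<epsilon> X p y i. sol \<epsilon> R X p y \<Longrightarrow> 1 \<le> i \<Longrightarrow> i + Suc r \<le> k \<Longrightarrow>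
     derivs_le m X (\<lambda>l. C2 * \<epsilon> ^ min (Suc l) (2 * Suc r)) (\<lambda>s. \<epsilon> * y i s)" using Suc.IH by blast
    obtain C1 where C1: "0 \<le> C1" "\<And>\<epsilon> X p y i. sol \<epsilon> R X p y \<Longrightarrow> 1 \<le> i \<Longrightarrow> i + r \<le> k \<Longrightarrow>
     derivs_le m X (\<lambda>l. C1 * \<epsilon> ^ min (Suc l) (2 * r)) (\<lambda>s. \<epsilon> * y i s)" using outer by blast
    have CK: "0 \<le> 2 * C1 + 2 * pi" using C1(1) pi_ge_zero by linarith
    obtain D where D: "0 \<le> D" "\<And>\<epsilon> R X p y w j. submult w \<Longrightarrow> sol \<epsilon> R X p y \<Longrightarrow> j \<in> {1..<n} \<Longrightarrow>
       derivs_le m X (\<lambda>l. (2 * C1 + 2 * pi) * w (Suc l)) (\<lambda>s. \<epsilon> * (y (Suc j) s - y j s) + 2 * pi * \<kappa> j) \<Longrightarrow>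
       derivs_le m X (\<lambda>l. D * w l) (\<lambda>s. W j 1 (q p j s))"
      using W_derivs_le[OF CK, of m 1] by blast
    show ?case
    proof (intro exI[of _ "R + (2 * D + \<gamma> * C2)"] conjI allI impI)
      show "0 \<le> R + (2 * D + \<gamma> * C2)" using assms D C2 \<gamma> by auto
      fix \<epsilon> X p y i assume s: "sol \<epsilon> R X p y" and i: "1 \<le> i" "i + Suc r \<le> k"
      have \<epsilon>: "0 < \<epsilon>" "\<epsilon> \<le> 1" using s by (auto simp: sol_def)
      have uj: "derivs_le m X (\<lambda>l. D * \<epsilon> ^ min l (2 * r)) (u p j)" if j: "j + Suc r \<le> k" for j
      proof (cases "j \<in> {1..<n}")
        case True
        \<comment> \<open>The link \<open>k - 1\<close> can occur only for \<open>r = 0\<close>,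
          where all weights are 1.\<close>
        have "\<kappa> j = 0 \<or> r = 0" using j by (auto simp: \<kappa>_def)
        then have "derivs_le m X (\<lambda>l. (2 * C1 + 2 * pi) * \<epsilon> ^ min (Suc l) (2 * r))
            (\<lambda>s. \<epsilon> * (y (Suc j) s - y j s) + 2 * pi * \<kappa> j)"
          using C1(2)[OF s] True C1(1) j \<epsilon> by (intro phase_velocity_derivs_le) auto
        then have "derivs_le m X (\<lambda>l. D * \<epsilon> ^ min l (2 * r)) (\<lambda>s. W j 1 (q p j s))"
          using \<epsilon> by (intro D(2)[OF submult_powers_min s True])
        then show ?thesis using u_derivs_le_eq[OF True] by simp
      next
        case False
        have "derivs_le m X (\<lambda>l. D * \<epsilon> ^ min l (2 * r)) (\<lambda>_. 0)" using D \<epsilon> by (intro derivs_le_const) auto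
        then show ?thesis by (rule derivs_le_cong) (use False that in \<open>auto simp: u_def\<close>)
      qed
      have y1: "derivs_le m X (\<lambda>l. C2 * \<epsilon> ^ min (Suc l) (2 * Suc r)) (\<lambda>s. \<epsilon> * y 1 s)"
        using C2(2)[OF s, of 1] i by auto
      show "derivs_le (Suc m) X (\<lambda>l. (R + (2 * D + \<gamma> * C2)) * \<epsilon> ^ min (Suc l) (2 * Suc r)) (\<lambda>s. \<epsilon> * y i s)"
      proof (rule derivs_le_SucI)
        have "derivs_le m X (\<lambda>l. \<epsilon>\<^sup>2 * (2 * (D * \<epsilon> ^ min l (2 * r)))
            + \<gamma> * \<epsilon> * (C2 * \<epsilon> ^ min (Suc l) (2 * Suc r))) (\<lambda>s. \<epsilon>\<^sup>2 * total_force p y i s)"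
          by (rule total_force_derivs_le[where y = y and \<epsilon> = \<epsilon>, OF uj[of i] uj[of "i - 1"] y1]) (use i C2 \<epsilon> in auto)
        then show "derivs_le m X (\<lambda>l. (R + (2 * D + \<gamma> * C2)) * \<epsilon> ^ min (Suc (Suc l)) (2 * Suc r))
            (\<lambda>s. \<epsilon>\<^sup>2 * total_force p y i s)"
        proof (rule derivs_le_mono[OF _ order_refl])
          fix l
          define e where "e = \<epsilon> ^ min (Suc (Suc l)) (2 * Suc r)"
          have e: "0 \<le> e" using \<epsilon> by (simp add: e_def)
          \<comment> \<open>The factor \<open>\<epsilon>\<^sup>2\<close> of the equation of motion
            adds 2 to both arguments of \<open>min\<close>, so the ceiling rises with the
            distance.\<close>
          have e1: "\<epsilon>\<^sup>2 * \<epsilon> ^ min l (2 * r) = e"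
            by (simp add: e_def power2_eq_square)
          have e2: "\<epsilon> * \<epsilon> ^ min (Suc l) (2 * Suc r) \<le> e"
            unfolding e_def power_Suc[symmetric] using \<epsilon> by (intro power_decreasing) auto
          have "\<gamma> * \<epsilon> * (C2 * \<epsilon> ^ min (Suc l) (2 * Suc r)) = (\<gamma> * C2) * (\<epsilon> * \<epsilon> ^ min (Suc l) (2 * Suc r))"
            by (simp add: ac_simps)
          also have "\<dots> \<le> (\<gamma> * C2) * e" using e2 \<gamma> C2 by (intro mult_left_mono) auto
          finally have 2: "\<gamma> * \<epsilon> * (C2 * \<epsilon> ^ min (Suc l) (2 * Suc r)) \<le> (\<gamma> * C2) * e" .
          have 1: "\<epsilon>\<^sup>2 * (2 * (D * \<epsilon> ^ min l (2 * r))) = 2 * D * e" by (simp flip: e1)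
          have "0 \<le> R * e" using assms(1) e by simp
          then show "\<epsilon>\<^sup>2 * (2 * (D * \<epsilon> ^ min l (2 * r))) + \<gamma> * \<epsilon> * (C2 * \<epsilon> ^ min (Suc l) (2 * Suc r))
              \<le> (R + (2 * D + \<gamma> * C2)) * e"
            using 2 unfolding 1 by (simp add: distrib_right)
        qed
        fix x assume x: "x \<in> X"
        have i': "i \<in> {1..n}" using i kn by auto
        show "((\<lambda>s. \<epsilon> * y i s) has_real_derivative \<epsilon>\<^sup>2 * total_force p y i x) (at x within X)"
          using y_deriv[OF s x i'] .
        have "R * \<epsilon> ^ min (Suc 0) (2 * Suc r) \<le> (R + (2 * D + \<gamma> * C2)) * \<epsilon> ^ min (Suc 0) (2 * Suc r)"
          using D C2 \<gamma> \<epsilon> by (intro mult_right_mono) auto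
        then show "\<bar>\<epsilon> * y i x\<bar> \<le> (R + (2 * D + \<gamma> * C2)) * \<epsilon> ^ min (Suc 0) (2 * Suc r)"
          using y_le[OF s i' x] by linarith
      qed
    qed
  qed
qed

section \<open>Lower bound on the dissipated energy\<close>

text \<open>The equation of motion of rotator \<open>i\<close> solved for the force of its right
  link. As \<open>\<epsilon>\<^sup>2 * total_force\<close> is the derivative of
  \<open>\<epsilon> * y i\<close>, one order of differentiation and a factor
  \<open>\<epsilon>\<^sup>2\<close> are lost; the friction term costs a division by
  \<open>\<epsilon>\<close> only.\<close>

lemma potential_force_derivs_le:
  assumes i: "1 \<le> i" "i < k" and s: "sol \<epsilon> R {a..a+1} p y"
    and A: "0 \<le> A" "0 \<le> \<eta>"
    and yi: "derivs_le (Suc m) {a..a+1} (\<lambda>_. A * (\<eta> * \<epsilon> ^ (2 * (k - i)))) (\<lambda>s. \<epsilon> * y i s)"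
    and u: "derivs_le m {a..a+1} (\<lambda>_. A * (\<eta> * \<epsilon> ^ (2 * (k - i)))) (u p (i - 1))"
  shows "derivs_le m {a..a+1} (\<lambda>_. (2 + \<gamma>) * A * (\<eta> * \<epsilon> ^ (2 * (k - i - 1)))) (u p i)"
proof -
  have \<epsilon>: "0 < \<epsilon>" "\<epsilon> \<le> 1" using s by (auto simp: sol_def)
  define \<zeta> where "\<zeta> = \<eta> * \<epsilon> ^ (2 * (k - i - 1))"
  have \<zeta>: "0 \<le> \<zeta>" using A \<epsilon> by (simp add: \<zeta>_def)
  have "2 * (k - i) = 2 * (k - i - 1) + 2" using i by simp
  then have \<zeta>2: "\<eta> * \<epsilon> ^ (2 * (k - i)) = \<epsilon>\<^sup>2 * \<zeta>" 
    by (simp only: \<zeta>_def power_add ac_simps)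
  have f: "derivs_le m {a..a+1} (\<lambda>_. A * (\<epsilon>\<^sup>2 * \<zeta>)) (\<lambda>s. \<epsilon>\<^sup>2 * total_force p y i s)"
    using derivs_le_derivative[OF _ yi] y_deriv[OF s] i kn unfolding \<zeta>2 by auto
  have 1: "derivs_le m {a..a+1} (\<lambda>_. A * \<zeta>) (\<lambda>s. (1 / \<epsilon>\<^sup>2) * (\<epsilon>\<^sup>2 * total_force p y i s))"
    by (rule derivs_le_mono[OF derivs_le_cmult[OF f]]) (use \<epsilon> in auto)
  have le1: "A * (\<epsilon>\<^sup>2 * \<zeta>) \<le> A * \<zeta>"
    using A \<zeta> \<epsilon> by (intro mult_left_mono mult_left_le_one_le) (auto simp: power_le_one)
  have 2: "derivs_le m {a..a+1} (\<lambda>_. A * \<zeta>) (u p (i - 1))"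
    by (rule derivs_le_mono[OF u[unfolded \<zeta>2]]) (use le1 in auto)
  have y: "derivs_le m {a..a+1} (\<lambda>_. A * (\<epsilon>\<^sup>2 * \<zeta>)) (\<lambda>s. \<epsilon> * y i s)"
    by (rule derivs_le_mono[OF yi[unfolded \<zeta>2]]) auto
  have 3: "derivs_le m {a..a+1} (\<lambda>_. \<gamma> * (A * \<zeta>)) (\<lambda>s. (if i = 1 then \<gamma> / \<epsilon> else 0) * (\<epsilon> * y i s))"
  proof (rule derivs_le_mono[OF derivs_le_cmult[OF y] order_refl])
    have "\<gamma> / \<epsilon> * (A * (\<epsilon>\<^sup>2 * \<zeta>)) = \<epsilon> * (\<gamma> * (A * \<zeta>))"
      using \<epsilon> by (simp add: power2_eq_square)
    also have "\<dots> \<le> \<gamma> * (A * \<zeta>)"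
      using \<gamma> A \<zeta> \<epsilon> by (intro mult_left_le_one_le) auto
    finally show "\<bar>if i = 1 then \<gamma> / \<epsilon> else 0\<bar> * (A * (\<epsilon>\<^sup>2 * \<zeta>)) \<le> \<gamma> * (A * \<zeta>)"
      using \<gamma> \<epsilon> A \<zeta> by auto
  qed
  have "derivs_le m {a..a+1} (\<lambda>_. (2 + \<gamma>) * A * \<zeta>)
     (\<lambda>s. (1 / \<epsilon>\<^sup>2) * (\<epsilon>\<^sup>2 * total_force p y i s) + u p (i - 1) s + (if i = 1 then \<gamma> / \<epsilon> else 0) * (\<epsilon> * y i s))"
    by (rule derivs_le_mono[OF derivs_le_add[OF derivs_le_add[OF 1 2] 3]]) (auto simp: algebra_simps)
  then show ?thesis
    unfolding \<zeta>_def by (rule derivs_le_cong) (use \<epsilon> in \<open>auto simp: total_force_def\<close>)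
qed

text \<open>If \<open>U' (q)\<close> is small, then \<open>U'' (q)\<close> is not, and the phase difference \<open>q\<close> inherits smallness of its
  derivatives from \<open>U' (q)\<close>, which the equation of motion of the preceding rotator provides.\<close>

lemma chain_at_rest:
  assumes R: "0 \<le> R" and "1 \<le> i" "i < k"
  shows "\<exists>M C \<eta>0. 0 \<le> C \<and> 0 < \<eta>0 \<and> (\<forall>\<eta> \<epsilon> a p y. 0 < \<eta> \<longrightarrow> \<eta> \<le> \<eta>0 \<longrightarrow> sol \<epsilon> R {a..a+1} p y \<longrightarrow>
     derivs_le M {a..a+1} (\<lambda>_. \<eta> * \<epsilon> ^ (2 * (k - 1))) (\<lambda>s. \<epsilon> * y 1 s) \<longrightarrow>
     derivs_le m {a..a+1} (\<lambda>_. C * (\<eta> * \<epsilon> ^ (2 * (k - i)))) (\<lambda>s. \<epsilon> * y i s) \<and>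
     derivs_le m {a..a+1} (\<lambda>_. C * (\<eta> * \<epsilon> ^ (2 * (k - i - 1)))) (u p i))"
  using assms(2,3)
proof (induction i arbitrary: m rule: nat_induct_at_least)
  case base
  show ?case
  proof (rule exI[of _ "Suc m"], rule exI[of _ "2 + \<gamma>"], rule exI[of _ "1::real"],
      intro conjI allI impI)
    fix \<eta> \<epsilon> :: real and a p y
    assume \<eta>: "0 < \<eta>" and s: "sol \<epsilon> R {a..a+1} p y"
      and y1: "derivs_le (Suc m) {a..a+1} (\<lambda>_. \<eta> * \<epsilon> ^ (2 * (k - 1))) (\<lambda>s. \<epsilon> * y 1 s)"
    have \<epsilon>: "0 < \<epsilon>" using s by (simp add: sol_def)
    have nn: "0 \<le> \<eta> * \<epsilon> ^ (2 * (k - 1))" using \<eta> \<epsilon> by simp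
    show "derivs_le m {a..a+1} (\<lambda>_. (2 + \<gamma>) * (\<eta> * \<epsilon> ^ (2 * (k - 1)))) (\<lambda>s. \<epsilon> * y 1 s)"
    proof (rule derivs_le_mono[OF y1])
      have "1 * (\<eta> * \<epsilon> ^ (2 * (k - 1))) \<le> (2 + \<gamma>) * (\<eta> * \<epsilon> ^ (2 * (k - 1)))"
        using nn \<gamma> by (intro mult_right_mono) auto
      then show "\<eta> * \<epsilon> ^ (2 * (k - 1)) \<le> (2 + \<gamma>) * (\<eta> * \<epsilon> ^ (2 * (k - 1)))" by simp
    qed simp
    have "derivs_le m {a..a+1} (\<lambda>_. (2 + \<gamma>) * 1 * (\<eta> * \<epsilon> ^ (2 * (k - 1 - 1)))) (u p 1)"
      by (rule potential_force_derivs_le[OF _ _ s]) (use base k2 y1 \<eta> nn in \<open>auto intro: u_0_derivs_le\<close>)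
    then show "derivs_le m {a..a+1} (\<lambda>_. (2 + \<gamma>) * (\<eta> * \<epsilon> ^ (2 * (k - 1 - 1)))) (u p 1)" by simp
  qed (use \<gamma> in auto)
next
  case (Suc i)
  have ik: "i < k" "Suc i < k" using Suc.prems by auto
  have iS: "1 \<le> i" using Suc.hyps by simp
  have iN: "i \<in> {1..<n}" using iS ik kn by auto
  \<comment> \<open>This link does not touch the fast rotator, so its phase velocity is just
    \<open>\<epsilon> * (y (Suc i) s - y i s)\<close>, and bounding it bounds the next
    momentum.\<close>
  have \<kappa>0: "\<kappa> i = 0" using ik by (auto simp: \<kappa>_def)
  \<comment> \<open>Two orders more than required: one is lost in differentiating
    \<open>W i 1 (q p i s)\<close>, the other in solving the next equation of motion.\<close>
  obtain M C \<eta>0 where C: "0 \<le> C" "0 < \<eta>0" "\<And>\<eta> \<epsilon> a p y. 0 < \<eta> \<Longrightarrow> \<eta> \<le> \<eta>0 \<Longrightarrow> sol \<epsilon> R {a..a+1} p y \<Longrightarrow>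
     derivs_le M {a..a+1} (\<lambda>_. \<eta> * \<epsilon> ^ (2 * (k - 1))) (\<lambda>s. \<epsilon> * y 1 s) \<Longrightarrow>
     derivs_le (Suc (Suc m)) {a..a+1} (\<lambda>_. C * (\<eta> * \<epsilon> ^ (2 * (k - i)))) (\<lambda>s. \<epsilon> * y i s) \<and>
     derivs_le (Suc (Suc m)) {a..a+1} (\<lambda>_. C * (\<eta> * \<epsilon> ^ (2 * (k - i - 1)))) (u p i)"
    using Suc.IH[OF ik(1), of "Suc (Suc m)"] by blast
  obtain C1 where C1: "0 \<le> C1" "\<And>\<epsilon> X p y i. sol \<epsilon> R X p y \<Longrightarrow> i \<in> {1..n} \<Longrightarrow>
     derivs_le (Suc m) X (\<lambda>_. C1) (\<lambda>s. \<epsilon> * y i s)" using apriori_bound[OF R, of "Suc m"] by blast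
  have CK: "0 \<le> 2 * C1 + 2 * pi" using C1(1) pi_ge_zero by linarith
  obtain D where D: "0 \<le> D" "\<And>\<epsilon> R X p y w j. submult w \<Longrightarrow> sol \<epsilon> R X p y \<Longrightarrow> j \<in> {1..<n} \<Longrightarrow>
     derivs_le (Suc m) X (\<lambda>l. (2 * C1 + 2 * pi) * w (Suc l)) (\<lambda>s. \<epsilon> * (y (Suc j) s - y j s) + 2 * pi * \<kappa> j) \<Longrightarrow>
     derivs_le (Suc m) X (\<lambda>l. D * w l) (\<lambda>s. W j 2 (q p j s))"
    using W_derivs_le[OF CK, of "Suc m" 2] by blast
  have c02: "0 < c0 / 2" using c0 by simp
  obtain E where E: "0 \<le> E" "\<And>X f. derivs_le (Suc m) X (\<lambda>j. D) f \<Longrightarrow> (\<forall>x\<in>X. c0 / 2 \<le> \<bar>f x\<bar>) \<Longrightarrow>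
      derivs_le (Suc m) X (\<lambda>j. E) (\<lambda>x. 1 / f x)" using derivs_le_inverse[OF c02 D(1), of "Suc m"] by blast
  define A where "A = 2 ^ Suc m * (C * E) + C"
  have A: "0 \<le> A" "C \<le> A" using C E by (auto simp: A_def)
  show ?case
  proof (rule exI[of _ M], rule exI[of _ "(2 + \<gamma>) * A"],
      rule exI[of _ "min \<eta>0 (c0 / (2 * (C + 1)))"], intro conjI allI impI)
    show "0 \<le> (2 + \<gamma>) * A" using A \<gamma> by simp
    show "0 < min \<eta>0 (c0 / (2 * (C + 1)))" using C c0 by simp
    fix \<eta> \<epsilon> :: real and a p y
    assume \<eta>: "0 < \<eta>" "\<eta> \<le> min \<eta>0 (c0 / (2 * (C + 1)))" and s: "sol \<epsilon> R {a..a+1} p y"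
      and y1: "derivs_le M {a..a+1} (\<lambda>_. \<eta> * \<epsilon> ^ (2 * (k - 1))) (\<lambda>s. \<epsilon> * y 1 s)"
    have \<epsilon>: "0 < \<epsilon>" "\<epsilon> \<le> 1" using s by (auto simp: sol_def)
    define \<zeta> where "\<zeta> = \<eta> * \<epsilon> ^ (2 * (k - Suc i))"
    have \<zeta>: "0 \<le> \<zeta>" using \<eta> \<epsilon> by (simp add: \<zeta>_def)
    have \<zeta>\<eta>: "\<zeta> \<le> \<eta>"
      unfolding \<zeta>_def using \<eta> \<epsilon> by (intro mult_left_le) (auto intro!: power_le_one)
    have yi: "derivs_le (Suc m) {a..a+1} (\<lambda>_. C * (\<eta> * \<epsilon> ^ (2 * (k - i)))) (\<lambda>s. \<epsilon> * y i s)"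
      and ui: "derivs_le (Suc (Suc m)) {a..a+1} (\<lambda>_. C * \<zeta>) (u p i)"
    proof -
      have *: "derivs_le (Suc (Suc m)) {a..a+1} (\<lambda>_. C * (\<eta> * \<epsilon> ^ (2 * (k - i)))) (\<lambda>s. \<epsilon> * y i s)"
        "derivs_le (Suc (Suc m)) {a..a+1} (\<lambda>_. C * (\<eta> * \<epsilon> ^ (2 * (k - i - 1)))) (u p i)"
        using C(3)[OF \<eta>(1) _ s y1] \<eta>(2) by auto
      show "derivs_le (Suc m) {a..a+1} (\<lambda>_. C * (\<eta> * \<epsilon> ^ (2 * (k - i)))) (\<lambda>s. \<epsilon> * y i s)"
        by (rule derivs_le_mono[OF *(1)]) auto
      show "derivs_le (Suc (Suc m)) {a..a+1} (\<lambda>_. C * \<zeta>) (u p i)" using *(2) by (simp add: \<zeta>_def)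
    qed
    have \<zeta>2: "\<eta> * \<epsilon> ^ (2 * (k - i)) \<le> \<zeta>"
      unfolding \<zeta>_def using \<eta> \<epsilon> by (intro mult_left_mono power_decreasing) auto
    \<comment> \<open>The bound on \<open>\<eta>\<close> keeps \<open>\<bar>U'\<bar>\<close> below
      \<open>c0 / 2\<close>, which leaves at least \<open>c0 / 2\<close> for
      \<open>\<bar>U''\<bar>\<close>, the factor to be divided out.\<close>
    have W2: "c0 / 2 \<le> \<bar>W i 2 (q p i x)\<bar>" if "x \<in> {a..a+1}" for x
    proof -
      have "\<bar>W i 1 (q p i x)\<bar> \<le> C * \<zeta>" using derivs_le_0D[OF ui that] iN by (simp add: u_def)
      also have "\<dots> \<le> (C + 1) * \<eta>" using \<zeta> \<zeta>\<eta> C \<eta> by (intro mult_mono) auto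
      also have "\<dots> \<le> c0 / 2" using \<eta> C by (simp add: field_simps)
      finally show ?thesis using W_nondeg[OF iN, of "q p i x"] by linarith
    qed
    have "derivs_le (Suc m) {a..a+1} (\<lambda>l. (2 * C1 + 2 * pi) * 1) (\<lambda>s. \<epsilon> * (y (Suc i) s - y i s) + 2 * pi * \<kappa> i)"
      using C1(2)[OF s] iN C1(1) by (intro phase_velocity_derivs_le) auto
    then have "derivs_le (Suc m) {a..a+1} (\<lambda>l. D * 1) (\<lambda>s. W i 2 (q p i s))"
      by (intro D(2)[OF _ s iN]) (auto simp: submult_def)
    then have inv: "derivs_le (Suc m) {a..a+1} (\<lambda>_. E) (\<lambda>s. 1 / W i 2 (q p i s))"
      using W2 by (intro E(2)) (auto)
    have "derivs_le (Suc m) {a..a+1} (\<lambda>_. C * \<zeta>)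
        (\<lambda>s. W i 2 (q p i s) * (\<epsilon> * (y (Suc i) s - y i s) + 2 * pi * \<kappa> i))"
    proof (rule derivs_le_derivative[of a "a + 1" "Suc m" "\<lambda>_. C * \<zeta>"])
      show "derivs_le (Suc (Suc m)) {a..a+1} (\<lambda>_. C * \<zeta>) (\<lambda>s. W i 1 (q p i s))"
        by (rule derivs_le_cong[OF ui]) (use iN in \<open>auto simp: u_def\<close>)
      show "((\<lambda>s. W i 1 (q p i s)) has_real_derivative
          W i 2 (q p i x) * (\<epsilon> * (y (Suc i) x - y i x) + 2 * pi * \<kappa> i)) (at x within {a..a+1})"
        if "x \<in> {a..a+1}" for x
        using W_q_deriv[OF s that iN, of 1] by (simp add: numeral_2_eq_2)
    qed simp
    from derivs_le_mult[OF this inv, of "\<lambda>_. C * E * \<zeta>"]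
    have "derivs_le (Suc m) {a..a+1} (\<lambda>_. 2 ^ Suc m * (C * E * \<zeta>))
        (\<lambda>s. W i 2 (q p i s) * (\<epsilon> * (y (Suc i) s - y i s) + 2 * pi * \<kappa> i) * (1 / W i 2 (q p i s)))"
      using C E \<zeta> by (auto simp: ac_simps)
    then have dq: "derivs_le (Suc m) {a..a+1} (\<lambda>_. 2 ^ Suc m * (C * E * \<zeta>)) (\<lambda>s. \<epsilon> * (y (Suc i) s - y i s))"
    proof (rule derivs_le_cong)
      fix x assume "x \<in> {a..a+1}"
      then have "W i 2 (q p i x) \<noteq> 0" using W2[of x] c0 by auto
      then show "W i 2 (q p i x) * (\<epsilon> * (y (Suc i) x - y i x) + 2 * pi * \<kappa> i) * (1 / W i 2 (q p i x))
        = \<epsilon> * (y (Suc i) x - y i x)" using \<kappa>0 by simp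
    qed
    have "derivs_le (Suc m) {a..a+1} (\<lambda>_. A * \<zeta>) (\<lambda>s. \<epsilon> * (y (Suc i) s - y i s) + \<epsilon> * y i s)"
    proof (rule derivs_le_mono[OF derivs_le_add[OF dq yi]])
      have "C * (\<eta> * \<epsilon> ^ (2 * (k - i))) \<le> C * \<zeta>" using C \<zeta>2 by (intro mult_left_mono)
      then show "2 ^ Suc m * (C * E * \<zeta>) + C * (\<eta> * \<epsilon> ^ (2 * (k - i))) \<le> A * \<zeta>"
        by (simp add: A_def algebra_simps)
    qed simp
    then have yS: "derivs_le (Suc m) {a..a+1} (\<lambda>_. A * \<zeta>) (\<lambda>s. \<epsilon> * y (Suc i) s)"
      by (rule derivs_le_cong) (simp add: algebra_simps)
    have uA: "derivs_le m {a..a+1} (\<lambda>_. A * \<zeta>) (u p i)"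
      by (rule derivs_le_mono[OF ui]) (use A \<zeta> in \<open>auto intro: mult_right_mono\<close>)
    show "derivs_le m {a..a+1} (\<lambda>_. (2 + \<gamma>) * A * (\<eta> * \<epsilon> ^ (2 * (k - Suc i)))) (\<lambda>s. \<epsilon> * y (Suc i) s)"
    proof (rule derivs_le_mono[OF yS])
      have "1 * (A * \<zeta>) \<le> (2 + \<gamma>) * (A * \<zeta>)" using A \<zeta> \<gamma> by (intro mult_right_mono) auto
      then show "A * \<zeta> \<le> (2 + \<gamma>) * A * (\<eta> * \<epsilon> ^ (2 * (k - Suc i)))" by (simp add: \<zeta>_def mult.assoc)
    qed simp
    show "derivs_le m {a..a+1} (\<lambda>_. (2 + \<gamma>) * A * (\<eta> * \<epsilon> ^ (2 * (k - Suc i - 1)))) (u p (Suc i))"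
      by (rule potential_force_derivs_le[OF _ ik(2) s A(1)]) (use \<eta> yS uA in \<open>auto simp: \<zeta>_def\<close>)
  qed
qed

text \<open>If the claim failed, interpolation would make all needed derivatives of
  \<open>y 1\<close> small, and the forces would be small up to the link \<open>k - 1\<close>. But
  the phase of that link turns with speed at least 1, so a small \<open>U'\<close> along it forces a
  small \<open>U''\<close>, against non-degeneracy. The window \<open>{u..v}\<close> comes from
  negating the hypothesis of \<open>interpolation\<close>.\<close>

lemma first_momentum_lower_bound:
  assumes R: "0 \<le> R"
  shows "\<exists>\<theta>>0. \<exists>\<epsilon>0>0. \<forall>\<epsilon> a p y. \<epsilon> \<le> \<epsilon>0 \<longrightarrow> sol \<epsilon> R {a..a+1} p y \<longrightarrow>
    (\<exists>u v. a \<le> u \<and> u < v \<and> v \<le> a + 1 \<and> (\<forall>\<xi>\<in>{u..v}. \<epsilon> ^ (2 * (k - 1)) * \<theta> / (v - u) < \<bar>\<epsilon> * y 1 \<xi>\<bar>))"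
proof -
  have k1: "1 \<le> k - 1" "k - 1 < k" using k2 by auto
  have kN: "k - 1 \<in> {1..<n}" using k2 kn by auto
  have \<kappa>1: "\<kappa> (k - 1) = 1" using k2 by (auto simp: \<kappa>_def)
  have Sk: "Suc (k - 1) = k" using k2 by simp
  obtain M C \<eta>0 where C: "0 \<le> C" "0 < \<eta>0" "\<And>\<eta> \<epsilon> a p y. 0 < \<eta> \<Longrightarrow> \<eta> \<le> \<eta>0 \<Longrightarrow> sol \<epsilon> R {a..a+1} p y \<Longrightarrow>
     derivs_le M {a..a+1} (\<lambda>_. \<eta> * \<epsilon> ^ (2 * (k - 1))) (\<lambda>s. \<epsilon> * y 1 s) \<Longrightarrow>
     derivs_le 1 {a..a+1} (\<lambda>_. C * (\<eta> * \<epsilon> ^ (2 * (k - (k - 1) - 1)))) (u p (k - 1))"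
    using chain_at_rest[OF R k1, of 1] by blast
  \<comment> \<open>Both \<open>\<bar>U'\<bar>\<close> and \<open>\<bar>U''\<bar>\<close> will come
    out at most \<open>C * \<eta> \<le> c0 / 4\<close>, together less than
    \<open>c0\<close>.\<close>
  define \<eta> where "\<eta> = min \<eta>0 (c0 / (4 * (C + 1)))"
  have \<eta>: "0 < \<eta>" "\<eta> \<le> \<eta>0" using C c0 by (auto simp: \<eta>_def)
  have "C * \<eta> \<le> (C + 1) * \<eta>" using \<eta> by (simp add: algebra_simps)
  also have "\<dots> \<le> (C + 1) * (c0 / (4 * (C + 1)))" using C by (intro mult_left_mono) (auto simp: \<eta>_def)
  also have "\<dots> = c0 / 4" using C by (simp add: field_simps)
  finally have C\<eta>: "C * \<eta> \<le> c0 / 4" .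
  \<comment> \<open>At the order \<open>2 * k\<close> and above, the a priori bound has its full
    power \<open>\<epsilon> ^ (2 * (k - 1))\<close>, so the top derivative stays bounded after
    division by it; \<open>Suc M\<close> keeps the orders up to \<open>M\<close> below the
    top.\<close>
  define M' where "M' = max (Suc M) (2 * k)"
  obtain C1 where C1: "0 \<le> C1" "\<And>\<epsilon> X p y i. sol \<epsilon> R X p y \<Longrightarrow> 1 \<le> i \<Longrightarrow> i + (k - 1) \<le> k \<Longrightarrow>
     derivs_le M' X (\<lambda>l. C1 * \<epsilon> ^ min (Suc l) (2 * (k - 1))) (\<lambda>s. \<epsilon> * y i s)"
    using apriori_decay[OF R, of "k - 1" M'] by auto
  obtain \<theta> where \<theta>: "0 < \<theta>" "\<And>g a \<theta>'. 0 \<le> \<theta>' \<Longrightarrow> \<theta>' \<le> \<theta> \<Longrightarrow>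
    (\<forall>i<M'. \<forall>x\<in>{a..a+1}. (g i has_real_derivative g (Suc i) x) (at x within {a..a+1})) \<Longrightarrow>
    (\<forall>x\<in>{a..a+1}. \<bar>g M' x\<bar> \<le> C1) \<Longrightarrow>
    (\<forall>u v. a \<le> u \<and> u < v \<and> v \<le> a + 1 \<longrightarrow> (\<exists>\<xi>\<in>{u..v}. \<bar>g 0 \<xi>\<bar> \<le> \<theta>' / (v - u))) \<Longrightarrow>
    (\<forall>j<M'. \<forall>x\<in>{a..a+1}. \<bar>g j x\<bar> \<le> (\<eta> :: real))"
    using interpolation[OF C1(1) \<eta>(1), of M'] by blast
  show ?thesis
  proof (rule exI[of _ \<theta>], rule conjI[OF \<theta>(1)], rule exI[of _ "1 / (2 * (R + 1))"], intro conjI allI impI)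
    show "0 < 1 / (2 * (R + 1))" using R by simp
    fix \<epsilon> a p y assume \<epsilon>0: "\<epsilon> \<le> 1 / (2 * (R + 1))" and s: "sol \<epsilon> R {a..a+1} p y"
    have \<epsilon>: "0 < \<epsilon>" "\<epsilon> \<le> 1" using s by (auto simp: sol_def)
    show "\<exists>u v. a \<le> u \<and> u < v \<and> v \<le> a + 1 \<and> (\<forall>\<xi>\<in>{u..v}. \<epsilon> ^ (2 * (k - 1)) * \<theta> / (v - u) < \<bar>\<epsilon> * y 1 \<xi>\<bar>)"
    proof (rule ccontr)
      assume "\<not> ?thesis"
      then have pt: "\<exists>\<xi>\<in>{u..v}. \<bar>\<epsilon> * y 1 \<xi>\<bar> \<le> \<epsilon> ^ (2 * (k - 1)) * \<theta> / (v - u)"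
        if "a \<le> u" "u < v" "v \<le> a + 1" for u v
        using that by (meson not_le)
      define e where "e = \<epsilon> ^ (2 * (k - 1))"
      have e: "0 < e" using \<epsilon> by (simp add: e_def)
      have "derivs_le M' {a..a+1} (\<lambda>l. C1 * \<epsilon> ^ min (Suc l) (2 * (k - 1))) (\<lambda>s. \<epsilon> * y 1 s)"
        using C1(2)[OF s, of 1] k2 by auto
      from derivs_le_sequence[OF this] obtain G where G: "G 0 = (\<lambda>s. \<epsilon> * y 1 s)"
        "\<And>i x. i < M' \<Longrightarrow> x \<in> {a..a+1} \<Longrightarrow> (G i has_real_derivative G (Suc i) x) (at x within {a..a+1})"
        "\<And>i x. i \<le> M' \<Longrightarrow> x \<in> {a..a+1} \<Longrightarrow> \<bar>G i x\<bar> \<le> C1 * \<epsilon> ^ min (Suc i) (2 * (k - 1))"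
        by blast
      have sm: "\<forall>j<M'. \<forall>x\<in>{a..a+1}. \<bar>G j x / e\<bar> \<le> \<eta>"
      proof (rule \<theta>(2)[OF less_imp_le[OF \<theta>(1)] order_refl])
        show "\<forall>i<M'. \<forall>x\<in>{a..a+1}. ((\<lambda>x. G i x / e) has_real_derivative G (Suc i) x / e) (at x within {a..a+1})"
          using G(2) by (auto intro!: DERIV_cdivide)
        have "min (Suc M') (2 * (k - 1)) = 2 * (k - 1)" by (auto simp: M'_def)
        then show "\<forall>x\<in>{a..a+1}. \<bar>G M' x / e\<bar> \<le> C1"
          using G(3)[of M'] e by (auto simp: e_def pos_divide_le_eq)
        show "\<forall>u v. a \<le> u \<and> u < v \<and> v \<le> a + 1 \<longrightarrow> (\<exists>\<xi>\<in>{u..v}. \<bar>G 0 \<xi> / e\<bar> \<le> \<theta> / (v - u))"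
        proof (intro allI impI)
          fix u v assume uv: "a \<le> u \<and> u < v \<and> v \<le> a + 1"
          obtain \<xi> where "\<xi> \<in> {u..v}" "\<bar>\<epsilon> * y 1 \<xi>\<bar> \<le> e * \<theta> / (v - u)"
            using pt[of u v] uv unfolding e_def by blast
          then show "\<exists>\<xi>\<in>{u..v}. \<bar>G 0 \<xi> / e\<bar> \<le> \<theta> / (v - u)"
            using e unfolding G(1) by (intro bexI[of _ \<xi>]) (simp_all add: pos_divide_le_eq mult.commute)
        qed
      qed
      have "derivs_le M {a..a+1} (\<lambda>_. \<eta> * e) (G 0)"
      proof (rule derivs_le_of_sequence)
        show "\<forall>j<M. \<forall>x\<in>{a..a+1}. (G j has_real_derivative G (Suc j) x) (at x within {a..a+1})"
          using G(2) by (auto simp: M'_def)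
        show "\<forall>j\<le>M. \<forall>x\<in>{a..a+1}. \<bar>G j x\<bar> \<le> \<eta> * e"
          using sm e by (auto simp: M'_def pos_divide_le_eq)
      qed
      then have "derivs_le 1 {a..a+1} (\<lambda>_. C * (\<eta> * \<epsilon> ^ (2 * (k - (k - 1) - 1)))) (u p (k - 1))"
        unfolding G(1) e_def by (rule C(3)[OF \<eta> s])
      \<comment> \<open>At the fast rotator all powers of \<open>\<epsilon>\<close> are spent; what
        remains small is \<open>\<eta>\<close> alone.\<close>
      moreover have "k - (k - 1) - 1 = 0" by simp
      ultimately have u0: "derivs_le (Suc 0) {a..a+1} (\<lambda>_. C * \<eta>) (u p (k - 1))" by simp
      have u1: "derivs_le (Suc 0) {a..a+1} (\<lambda>_. C * \<eta>) (\<lambda>s. W (k - 1) 1 (q p (k - 1) s))"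
        by (rule derivs_le_cong[OF u0]) (use kN in \<open>simp add: u_def\<close>)
      have a1: "a \<in> {a..a+1}" by simp
      have "derivs_le 0 {a..a+1} (\<lambda>_. C * \<eta>) (\<lambda>s. W (k - 1) 2 (q p (k - 1) s) *
          (\<epsilon> * (y (Suc (k - 1)) s - y (k - 1) s) + 2 * pi * \<kappa> (k - 1)))"
        by (rule derivs_le_derivative[OF _ u1]) (use W_q_deriv[OF s _ kN, of _ 1] in \<open>auto simp: numeral_2_eq_2\<close>)
      from derivs_le_0D[OF this a1]
      have b2: "\<bar>W (k - 1) 2 (q p (k - 1) a) * (\<epsilon> * (y k a - y (k - 1) a) + 2 * pi)\<bar> \<le> C * \<eta>"
        unfolding Sk \<kappa>1 by simp
      \<comment> \<open>By the threshold for \<open>\<epsilon>\<close> the slow part of the phase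
        velocity is at most 1, so the velocity is at least \<open>2 * pi - 1\<close>.\<close>
      have "\<bar>y k a\<bar> \<le> R" "\<bar>y (k - 1) a\<bar> \<le> R" using s a1 kN kn k2 by (auto simp: sol_def)
      then have "\<bar>y k a - y (k - 1) a\<bar> \<le> 2 * (R + 1)"
        using abs_triangle_ineq4[of "y k a" "y (k - 1) a"] by simp
      then have "\<epsilon> * \<bar>y k a - y (k - 1) a\<bar> \<le> 1 / (2 * (R + 1)) * (2 * (R + 1))"
        using \<epsilon>0 \<epsilon> R by (intro mult_mono) auto
      also have "\<dots> = 1" using R by simp
      finally have "\<bar>\<epsilon> * (y k a - y (k - 1) a)\<bar> \<le> 1" using \<epsilon> by (simp add: abs_mult)
      then have "1 \<le> \<bar>\<epsilon> * (y k a - y (k - 1) a) + 2 * pi\<bar>" using pi_ge_two by linarith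
      then have "\<bar>W (k - 1) 2 (q p (k - 1) a)\<bar> * 1 \<le>
          \<bar>W (k - 1) 2 (q p (k - 1) a)\<bar> * \<bar>\<epsilon> * (y k a - y (k - 1) a) + 2 * pi\<bar>"
        by (intro mult_left_mono) auto
      then have "\<bar>W (k - 1) 2 (q p (k - 1) a)\<bar> \<le> C * \<eta>" using b2 by (simp add: abs_mult)
      moreover have "\<bar>W (k - 1) 1 (q p (k - 1) a)\<bar> \<le> C * \<eta>" using derivs_le_0D[OF u1 a1] .
      ultimately show False using W_nondeg[OF kN, of "q p (k - 1) a"] C\<eta> c0 by linarith
    qed
  qed
qed

section \<open>Adiabatic invariance\<close>

text \<open>The phase difference with the fast phase frozen at the time \<open>x\<close>; it agrees with
  \<open>q p j\<close> modulo \<open>2 * pi\<close> at the times \<open>x + m\<close>.\<close>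

definition q_frozen :: "(nat \<Rightarrow> real \<Rightarrow> real) \<Rightarrow> nat \<Rightarrow> real \<Rightarrow> real \<Rightarrow> real" where
  "q_frozen p j x s = p (Suc j) s - p j s + 2 * pi * \<kappa> j * x"

lemma W_shift:
  assumes "i \<in> {1..<n}" shows "W i l (x + 2 * pi * \<kappa> j * real m) = W i l x"
proof -
  have 1: "W i l (x + 2 * pi * real m) = W i l x" for x
  proof (induction m)
    case (Suc m)
    have "W i l (x + 2 * pi * real (Suc m)) = W i l ((x + 2 * pi * real m) + 2 * pi)"
      by (simp add: algebra_simps)
    then show ?case using Suc W_periodic[OF assms] by simp
  qed simp
  show ?thesis
    using 1[of x] 1[of "x - 2 * pi * real m"] by (auto simp: \<kappa>_def)
qed

lemma W_q_frozen:
  assumes "i \<in> {1..<n}" shows "W i l (q p j (x + real m)) = W i l (q_frozen p j x (x + real m))"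
proof -
  have "q p j (x + real m) = q_frozen p j x (x + real m) + 2 * pi * \<kappa> j * real m"
    by (simp add: q_def q_frozen_def algebra_simps)
  then show ?thesis using W_shift[OF assms] by simp
qed

lemma fdiff_q_frozen:
  assumes "1 \<le> i" shows "fdiff i (q_frozen p j x) z = fdiff i (p (Suc j)) z - fdiff i (p j) z"
proof -
  have "fdiff i (q_frozen p j x) z = fdiff i (\<lambda>s. p (Suc j) s - p j s) z + fdiff i (\<lambda>s. 2 * pi * \<kappa> j * x) z"
    unfolding q_frozen_def[abs_def] by (rule fdiff_add)
  then show ?thesis using assms by (simp add: fdiff_const fdiff_diff)
qed

lemma ndiff_q_frozen: "ndiff N (q_frozen p j x) z = ndiff N (p (Suc j)) z - ndiff N (p j) z"
proof -
  have "ndiff N (q_frozen p j x) z = ndiff N (\<lambda>s. p (Suc j) s - p j s) z + ndiff N (\<lambda>s. 2 * pi * \<kappa> j * x) z"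
    unfolding q_frozen_def[abs_def] by (rule ndiff_add)
  then show ?thesis by (simp add: ndiff_const ndiff_diff)
qed

text \<open>The mean value theorem writes a difference of order \<open>N + 1\<close> of
  \<open>y i\<close> as \<open>\<epsilon>\<close> times a difference of order \<open>N\<close> of
  the force at some \<open>\<xi>\<close>. At the nodes \<open>\<xi> + m\<close> the fast phase may
  be frozen, and the force becomes a function of the slow phases, known to order \<open>N\<close>.
  Differences of \<open>p i\<close> start at order 1, as the phases themselves are not
  bounded.\<close>

lemma slow_differences:
  assumes R: "0 \<le> R"
  shows "\<exists>K\<ge>0. \<forall>\<epsilon> a b p y. sol \<epsilon> R {a..b} p y \<longrightarrow>
    (\<forall>j x i. j \<le> N \<longrightarrow> a \<le> x \<longrightarrow> x + real j \<le> b \<longrightarrow> i \<in> {1..n} \<longrightarrow>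
      \<bar>fdiff j (y i) x\<bar> \<le> K * \<epsilon> ^ j \<and> (1 \<le> j \<longrightarrow> \<bar>fdiff j (p i) x\<bar> \<le> K * \<epsilon> ^ j))"
proof (induction N)
  case 0
  show ?case using R by (intro exI[of _ R]) (auto simp: sol_def)
next
  case (Suc N)
  obtain K where K: "0 \<le> K" "\<And>\<epsilon> a b p y j x i. sol \<epsilon> R {a..b} p y \<Longrightarrow>
    j \<le> N \<Longrightarrow> a \<le> x \<Longrightarrow> x + real j \<le> b \<Longrightarrow> i \<in> {1..n} \<Longrightarrow>
      \<bar>fdiff j (y i) x\<bar> \<le> K * \<epsilon> ^ j \<and> (1 \<le> j \<longrightarrow> \<bar>fdiff j (p i) x\<bar> \<le> K * \<epsilon> ^ j)"
    using Suc.IH by blast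
  have K2: "0 \<le> 2 * K" using K by simp
  obtain C where C: "0 \<le> C" "\<And>\<epsilon> G f x. 0 < \<epsilon> \<Longrightarrow> \<epsilon> \<le> 1 \<Longrightarrow>
      (\<forall>j z. (G j has_real_derivative G (Suc j) z) (at z)) \<Longrightarrow> (\<forall>j z. \<bar>G j z\<bar> \<le> B (Suc j)) \<Longrightarrow>
      (\<forall>j. 1 \<le> j \<and> j \<le> N \<longrightarrow> \<bar>fdiff j f x\<bar> \<le> 2 * K * \<epsilon> ^ j) \<Longrightarrow>
      \<bar>fdiff N (\<lambda>z. G 0 (f z)) x\<bar> \<le> C * \<epsilon> ^ N"
    using fdiff_comp_bound[OF K2, of "\<lambda>j. B (Suc j)" N] B_nonneg by blast
  define K' where "K' = K + 2 * C + \<gamma> * K"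
  have K': "0 \<le> K'" "K \<le> K'" "2 * C + \<gamma> * K \<le> K'" using K(1) C(1) \<gamma> by (auto simp: K'_def)
  show ?case
  proof (intro exI[of _ K'] conjI[OF K'(1)] allI impI)
    fix \<epsilon> a b p y j x i
    assume s: "sol \<epsilon> R {a..b} p y" and j: "j \<le> Suc N" and x: "a \<le> x" "x + real j \<le> b" and i: "i \<in> {1..n}"
    have \<epsilon>: "0 < \<epsilon>" "\<epsilon> \<le> 1" using s by (auto simp: sol_def)
    show "\<bar>fdiff j (y i) x\<bar> \<le> K' * \<epsilon> ^ j \<and> (1 \<le> j \<longrightarrow> \<bar>fdiff j (p i) x\<bar> \<le> K' * \<epsilon> ^ j)"
    proof (cases "j \<le> N")
      case True
      have "K * \<epsilon> ^ j \<le> K' * \<epsilon> ^ j" using K' \<epsilon> by (intro mult_right_mono) auto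
      then show ?thesis using K(2)[OF s True x i] by auto
    next
      case False
      then have jN: "j = Suc N" using j by simp
      have uN: "\<bar>fdiff N (u p l) \<xi>\<bar> \<le> C * \<epsilon> ^ N" if \<xi>: "a \<le> \<xi>" "\<xi> + real N \<le> b" for l \<xi>
      proof (cases "l \<in> {1..<n}")
        case True
        have "fdiff N (u p l) \<xi> = fdiff N (\<lambda>s. W l 1 (q_frozen p l \<xi> s)) \<xi>"
          by (rule fdiff_cong) (use True W_q_frozen[OF True] in \<open>auto simp: u_def\<close>)
        also have "\<bar>\<dots>\<bar> \<le> C * \<epsilon> ^ N"
        proof (rule C(2)[OF \<epsilon>, of "\<lambda>j. W l (Suc j)", unfolded One_nat_def[symmetric]])
          show "\<forall>j. 1 \<le> j \<and> j \<le> N \<longrightarrow> \<bar>fdiff j (q_frozen p l \<xi>) \<xi>\<bar> \<le> 2 * K * \<epsilon> ^ j"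
          proof (intro allI impI)
            fix j assume j: "1 \<le> j \<and> j \<le> N"
            have "\<bar>fdiff j (p (Suc l)) \<xi>\<bar> \<le> K * \<epsilon> ^ j" "\<bar>fdiff j (p l) \<xi>\<bar> \<le> K * \<epsilon> ^ j"
              using K(2)[OF s, of j \<xi>] j \<xi> True by auto
            then show "\<bar>fdiff j (q_frozen p l \<xi>) \<xi>\<bar> \<le> 2 * K * \<epsilon> ^ j"
              using j by (simp add: fdiff_q_frozen)
          qed
        qed (use True W_deriv W_bound in auto)
        finally show ?thesis .
      next
        case False
        then have "u p l = (\<lambda>_. 0)" by (auto simp: u_def)
        then show ?thesis using C \<epsilon> by (cases N) (simp_all add: fdiff_const del: fdiff.simps(2))
      qed
      obtain \<xi> where \<xi>: "x \<le> \<xi>" "\<xi> \<le> x + 1" "fdiff (Suc N) (y i) x = fdiff N (\<lambda>s. \<epsilon> * total_force p y i s) \<xi>"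
        using fdiff_Suc_mean_value[of a b "y i" "\<lambda>s. \<epsilon> * total_force p y i s" x N] s i x jN by (auto simp: sol_def)
      have \<xi>b: "a \<le> \<xi>" "\<xi> + real N \<le> b" using \<xi> x jN by auto
      have "fdiff N (total_force p y i) \<xi> = fdiff N (u p i) \<xi> - fdiff N (u p (i - 1)) \<xi>
          - (if i = 1 then \<gamma> else 0) * fdiff N (y 1) \<xi>"
      proof -
        have "total_force p y i = (\<lambda>s. (u p i s - u p (i - 1) s) - (if i = 1 then \<gamma> else 0) * y 1 s)"
          by (auto simp: total_force_def)
        then show ?thesis by (simp add: fdiff_diff fdiff_cmult)
      qed
      also have "\<bar>\<dots>\<bar> \<le> K' * \<epsilon> ^ N"
      proof -
        have "\<bar>fdiff N (y 1) \<xi>\<bar> \<le> K * \<epsilon> ^ N" using K(2)[OF s order_refl \<xi>b, of 1] k2 kn by auto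
        then have "\<bar>(if i = 1 then \<gamma> else 0) * fdiff N (y 1) \<xi>\<bar> \<le> \<gamma> * (K * \<epsilon> ^ N)"
          unfolding abs_mult using \<gamma> by (intro mult_mono) auto
        moreover have "(2 * C + \<gamma> * K) * \<epsilon> ^ N \<le> K' * \<epsilon> ^ N"
          using K' \<epsilon> by (intro mult_right_mono) auto
        ultimately show ?thesis
          using uN[OF \<xi>b, of i] uN[OF \<xi>b, of "i - 1"] by (simp add: algebra_simps)
      qed
      finally have "\<epsilon> * \<bar>fdiff N (total_force p y i) \<xi>\<bar> \<le> \<epsilon> * (K' * \<epsilon> ^ N)" using \<epsilon> by (intro mult_left_mono) auto
      then have y: "\<bar>fdiff (Suc N) (y i) x\<bar> \<le> K' * \<epsilon> ^ Suc N"
        unfolding \<xi>(3) fdiff_cmult using \<epsilon> by (simp add: abs_mult ac_simps)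
      obtain \<zeta> where \<zeta>: "x \<le> \<zeta>" "\<zeta> \<le> x + 1" "fdiff (Suc N) (p i) x = fdiff N (\<lambda>s. \<epsilon> * y i s) \<zeta>"
        using fdiff_Suc_mean_value[of a b "p i" "\<lambda>s. \<epsilon> * y i s" x N] s i x jN by (auto simp: sol_def)
      have "a \<le> \<zeta>" "\<zeta> + real N \<le> b" using \<zeta> x jN by auto
      then have "\<bar>fdiff N (y i) \<zeta>\<bar> \<le> K * \<epsilon> ^ N" using K(2)[OF s order_refl _ _ i] by auto
      also have "\<dots> \<le> K' * \<epsilon> ^ N" using K' \<epsilon> by (intro mult_right_mono) auto
      finally have "\<epsilon> * \<bar>fdiff N (y i) \<zeta>\<bar> \<le> \<epsilon> * (K' * \<epsilon> ^ N)" using \<epsilon> by (intro mult_left_mono) auto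
      then have "\<bar>fdiff (Suc N) (p i) x\<bar> \<le> K' * \<epsilon> ^ Suc N"
        unfolding \<zeta>(3) fdiff_cmult using \<epsilon> by (simp add: abs_mult ac_simps)
      then show ?thesis using y jN by (simp del: fdiff.simps(2))
    qed
  qed
qed

text \<open>The energy in the moving frame: every momentum enters through its deviation
  \<open>y i\<close>, without \<open>L\<close>, so a bound on \<open>E\<close> bounds all of
  them.\<close>

definition E :: "(nat \<Rightarrow> real \<Rightarrow> real) \<Rightarrow> (nat \<Rightarrow> real \<Rightarrow> real) \<Rightarrow> real \<Rightarrow> real" where
  "E p y s = (\<Sum>i=1..n. (y i s)\<^sup>2 / 2) + (\<Sum>j\<in>{1..<n}. W j 0 (q p j s))"

text \<open>Summation by parts; the boundary terms vanish because \<open>u\<close> is zero at both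
  ends of the chain. The vector \<open>a\<close> is free: it will be the variation
  \<open>D (p i)\<close>, the momenta, and the indicator of \<open>k\<close>.\<close>

lemma sum_force:
  "(\<Sum>i=1..n. total_force p y i s * a i) = - (\<Sum>j\<in>{1..<n}. W j 1 (q p j s) * (a (Suc j) - a j)) - \<gamma> * y 1 s * a 1"
proof -
  have *: "(\<Sum>i=1..m. (v i - v (i - 1)) * a i) + (\<Sum>j\<in>{1..<m}. v j * (a (Suc j) - a j)) = v m * a m - v 0 * a 1"
    if "1 \<le> m" for m and v :: "nat \<Rightarrow> real"
    using that by (induction m rule: nat_induct_at_least) (auto simp: algebra_simps)
  have "(\<Sum>i=1..n. total_force p y i s * a i)
      = (\<Sum>i=1..n. (u p i s - u p (i - 1) s) * a i - (if i = 1 then \<gamma> * y 1 s * a 1 else 0))"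
    by (intro sum.cong) (auto simp: total_force_def algebra_simps)
  also have "\<dots> = (\<Sum>i=1..n. (u p i s - u p (i - 1) s) * a i) - \<gamma> * y 1 s * a 1"
    using k2 kn by (simp add: sum_subtractf)
  also have "(\<Sum>i=1..n. (u p i s - u p (i - 1) s) * a i) = - (\<Sum>j\<in>{1..<n}. u p j s * (a (Suc j) - a j))"
    using *[of n "\<lambda>j. u p j s"] k2 kn by (simp add: u_def)
  also have "(\<Sum>j\<in>{1..<n}. u p j s * (a (Suc j) - a j)) = (\<Sum>j\<in>{1..<n}. W j 1 (q p j s) * (a (Suc j) - a j))"
    by (intro sum.cong) (auto simp: u_def)
  finally show ?thesis .
qed

lemma total_force_bound:
  assumes "sol \<epsilon> R X p y" "s \<in> X"
  shows "\<bar>total_force p y i s\<bar> \<le> 2 * B 1 + \<gamma> * R"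
proof -
  have 1: "\<bar>u p j s\<bar> \<le> B 1" for j
    using W_bound[of j 1] B_nonneg[of 1] by (auto simp: u_def)
  have "\<bar>y 1 s\<bar> \<le> R" using assms k2 kn by (auto simp: sol_def)
  then have "\<bar>\<gamma> * y 1 s\<bar> \<le> \<gamma> * R" "0 \<le> \<gamma> * R" using \<gamma> by (auto simp: abs_mult)
  then show ?thesis using 1[of i] 1[of "i - 1"] by (auto simp: total_force_def abs_le_iff)
qed

text \<open>Two requirements agree on this value. The horizon is of order
  \<open>1 / \<epsilon> ^ N\<close> in \<open>s\<close>, so an error
  \<open>\<epsilon> ^ Suc N\<close> per unit adds up to O(\<epsilon>); and the friction leaves a
  remainder \<open>(\<epsilon> ^ k)\<^sup>2 / \<epsilon>\<close>, which is the same
  \<open>\<epsilon> ^ Suc N\<close>.\<close>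

definition N :: nat where "N = 2 * (k - 1)"

lemma N_bounds: "1 \<le> k - 1" "k - 1 \<le> N" "1 \<le> N"
  using k2 by (auto simp: N_def)

lemma continuous_on_of_derivative:
  assumes "\<And>x. x \<in> X \<Longrightarrow> (f has_real_derivative f' x) (at x within X)"
  shows "continuous_on X f"
  using assms by (meson DERIV_continuous continuous_on_eq_continuous_within)

text \<open>At the distance \<open>k - 1\<close> from the fast rotator the \<open>k\<close>-th
  derivative of \<open>p 1\<close> is of size \<open>\<epsilon> ^ k\<close>: the ceiling
  \<open>2 * (k - 1)\<close> is not below \<open>k\<close>, as \<open>k \<ge> 2\<close>.\<close>

lemma ndiff_phase:
  assumes R: "0 \<le> R"
  shows "\<exists>C\<ge>0. \<forall>\<epsilon> x p y. sol \<epsilon> R {x..x + real N} p y \<longrightarrow>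
     \<bar>ndiff N (p 1) x - \<epsilon> * y 1 x\<bar> \<le> C * \<epsilon> ^ k"
proof -
  obtain C where C: "0 \<le> C" "\<And>\<epsilon> X p y i. sol \<epsilon> R X p y \<Longrightarrow> 1 \<le> i \<Longrightarrow> i + (k - 1) \<le> k \<Longrightarrow>
     derivs_le (k - 1) X (\<lambda>l. C * \<epsilon> ^ min (Suc l) (2 * (k - 1))) (\<lambda>s. \<epsilon> * y i s)"
    using apriori_decay[OF R, of "k - 1" "k - 1"] by auto
  show ?thesis
  proof (intro exI[of _ "ndiff_norm N * real N ^ Suc (k - 1) * C"] conjI allI impI)
    show "0 \<le> ndiff_norm N * real N ^ Suc (k - 1) * C" using ndiff_norm_nonneg C by simp
    fix \<epsilon> x p y assume s: "sol \<epsilon> R {x..x + real N} p y"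
    let ?X = "{x..x + real N}"
    have dp: "(p 1 has_real_derivative \<epsilon> * y 1 z) (at z within ?X)" if "z \<in> ?X" for z
      using s that k2 kn by (auto simp: sol_def)
    have "compact (p 1 ` ?X)"
      using dp by (intro compact_continuous_image continuous_on_of_derivative) auto
    then obtain M where M: "\<And>z. z \<in> ?X \<Longrightarrow> \<bar>p 1 z\<bar> \<le> M"
      using compact_imp_bounded by (fastforce simp: bounded_iff)
    define w where "w = case_nat M (\<lambda>l. C * \<epsilon> ^ min (Suc l) N)"
    have "derivs_le (Suc (k - 1)) ?X w (p 1)"
    proof (rule derivs_le_SucI)
      show "derivs_le (k - 1) ?X (\<lambda>j. w (Suc j)) (\<lambda>s. \<epsilon> * y 1 s)"
        using C(2)[OF s, of 1] k2 by (simp add: w_def N_def)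
    qed (use M dp in \<open>auto simp: w_def\<close>)
    from ndiff_error[OF this N_bounds(1,2) dp]
    have "\<bar>ndiff N (p 1) x - \<epsilon> * y 1 x\<bar> \<le> ndiff_norm N * real N ^ Suc (k - 1) * w (Suc (k - 1))"
      by simp
    also have "w (Suc (k - 1)) = C * \<epsilon> ^ min (Suc (k - 1)) N"
      by (simp only: w_def nat.case)
    also have "min (Suc (k - 1)) N = k" using k2 by (simp add: N_def)
    finally show "\<bar>ndiff N (p 1) x - \<epsilon> * y 1 x\<bar> \<le> ndiff_norm N * real N ^ Suc (k - 1) * C * \<epsilon> ^ k"
      by (simp add: mult.assoc)
  qed
qed

lemma ndiff_second_order:
  assumes f: "\<And>z. z \<in> {x..x + real N} \<Longrightarrow> (f has_real_derivative f' z) (at z within {x..x + real N})"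
    and f': "\<And>z. z \<in> {x..x + real N} \<Longrightarrow> (f' has_real_derivative f'' z) (at z within {x..x + real N})"
    and K: "\<And>z. z \<in> {x..x + real N} \<Longrightarrow> \<bar>f'' z\<bar> \<le> K"
  shows "\<bar>ndiff N f x - f' x\<bar> \<le> ndiff_norm N * (real N)\<^sup>2 * K"
proof -
  let ?X = "{x..x + real N}"
  have "compact (f ` ?X)" "compact (f' ` ?X)"
    by (rule compact_continuous_image[OF continuous_on_of_derivative[OF f]] compact_Icc
          compact_continuous_image[OF continuous_on_of_derivative[OF f']] | assumption)+
  then obtain M M' where M: "\<And>z. z \<in> ?X \<Longrightarrow> \<bar>f z\<bar> \<le> M" "\<And>z. z \<in> ?X \<Longrightarrow> \<bar>f' z\<bar> \<le> M'"
    using compact_imp_bounded by (fastforce simp: bounded_iff)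
  define w where "w = (\<lambda>j::nat. if j = 0 then M else if j = 1 then M' else K)"
  have "derivs_le 0 ?X (\<lambda>j. w (Suc (Suc j))) f''" using K by (simp add: w_def)
  then have "derivs_le (Suc 0) ?X (\<lambda>j. w (Suc j)) f'" using f' M by (intro derivs_le_SucI) (auto simp: w_def)
  then have "derivs_le (Suc (Suc 0)) ?X w f" using f M by (intro derivs_le_SucI[of _ f w f']) (auto simp: w_def)
  then have "derivs_le (Suc 1) ?X w f" by simp
  from ndiff_error[OF this order_refl N_bounds(3) f] show ?thesis
    by (simp add: w_def power2_eq_square)
qed

text \<open>\<open>Y\<close> increases by at most O(\<open>\<epsilon> ^ Suc N\<close>) per unit of
  \<open>s\<close>, and differs from \<open>E\<close> by O(\<epsilon>) plus a constant coming from
  the potentials alone. That constant is independent of \<open>R\<close>, which is what the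
  confinement relies on, while \<open>C\<close> may depend on \<open>R\<close>. Times in the last
  \<open>N\<close> units are excluded because the nodes must lie in \<open>{0..b}\<close>.\<close>

lemma energy_estimate:
  assumes R: "0 \<le> R"
  shows "\<exists>C\<ge>0. \<forall>\<epsilon> b p y s. sol \<epsilon> R {0..b} p y \<longrightarrow> 0 \<le> s \<longrightarrow> s \<le> b - real N \<longrightarrow>
     E p y s \<le> E p y 0 + 2 * (real n * B 0 * (1 + ndiff_norm N * real N)) + C * (\<epsilon> + s * \<epsilon> ^ Suc N)"
proof -
  define F where "F = 2 * B 1 + \<gamma> * R"
  have F: "0 \<le> F" using B_nonneg R \<gamma> by (simp add: F_def)
  obtain K where K: "0 \<le> K" "\<And>\<epsilon> a b p y j x i. sol \<epsilon> R {a..b} p y \<Longrightarrow>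
    j \<le> N \<Longrightarrow> a \<le> x \<Longrightarrow> x + real j \<le> b \<Longrightarrow> i \<in> {1..n} \<Longrightarrow>
      \<bar>fdiff j (y i) x\<bar> \<le> K * \<epsilon> ^ j \<and> (1 \<le> j \<longrightarrow> \<bar>fdiff j (p i) x\<bar> \<le> K * \<epsilon> ^ j)"
    using slow_differences[OF R, of N] by blast
  have K2: "0 \<le> 2 * K" using K by simp
  obtain C1 where C1: "0 \<le> C1" "\<And>\<epsilon> f x. 0 < \<epsilon> \<Longrightarrow> \<epsilon> \<le> 1 \<Longrightarrow>
      (\<forall>j\<le>N. \<bar>fdiff j f x\<bar> \<le> K * \<epsilon> ^ j) \<Longrightarrow>
      \<bar>ndiff N (\<lambda>z. (f z)\<^sup>2 / 2) x - f x * ndiff N f x\<bar> \<le> C1 * \<epsilon> ^ Suc N"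
    using ndiff_square[OF K(1) N_bounds(3)] by blast
  obtain C2 where C2: "0 \<le> C2" "\<And>\<epsilon> G f x. 0 < \<epsilon> \<Longrightarrow> \<epsilon> \<le> 1 \<Longrightarrow>
      (\<forall>j z. (G j has_real_derivative G (Suc j) z) (at z)) \<Longrightarrow> (\<forall>j z. \<bar>G j z\<bar> \<le> B j) \<Longrightarrow>
      (\<forall>j. 1 \<le> j \<and> j \<le> N \<longrightarrow> \<bar>fdiff j f x\<bar> \<le> 2 * K * \<epsilon> ^ j) \<Longrightarrow>
      \<bar>ndiff N (\<lambda>z. G 0 (f z)) x - G 1 (f x) * ndiff N f x\<bar> \<le> C2 * \<epsilon> ^ Suc N"
    using ndiff_comp[of "2 * K" B N, OF K2 B_nonneg N_bounds(3)] by blast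
  obtain C3 where C3: "0 \<le> C3" "\<And>\<epsilon> x p y. sol \<epsilon> R {x..x + real N} p y \<Longrightarrow>
     \<bar>ndiff N (p 1) x - \<epsilon> * y 1 x\<bar> \<le> C3 * \<epsilon> ^ k" using ndiff_phase[OF R] by blast
  define C4 where "C4 = real n * R * (ndiff_norm N * (real N)\<^sup>2 * F) + ndiff_norm N * (real N)\<^sup>2 * (real n * R * F)"
  define C5 where "C5 = real n * C1 + real n * C2 + \<gamma> * C3\<^sup>2"
  define cU where "cU = real n * B 0 * (1 + ndiff_norm N * real N)"
  have C4: "0 \<le> C4" using F R ndiff_norm_nonneg by (simp add: C4_def)
  have C5: "0 \<le> C5" using C1 C2 \<gamma> by (simp add: C5_def)
  show ?thesis
    unfolding cU_def[symmetric]
  proof (intro exI[of _ "2 * C4 + C5"] conjI allI impI)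
    show "0 \<le> 2 * C4 + C5" using C4 C5 by simp
    fix \<epsilon> b p y s0 assume s: "sol \<epsilon> R {0..b} p y" and s0: "0 \<le> s0" "s0 \<le> b - real N"
    have \<epsilon>: "0 < \<epsilon>" "\<epsilon> \<le> 1" using s by (auto simp: sol_def)
    have yR: "\<bar>y i x\<bar> \<le> R" if "i \<in> {1..n}" "x \<in> {0..b}" for i x
      using s that by (auto simp: sol_def)
    have dy: "(y i has_real_derivative \<epsilon> * total_force p y i x) (at x within {0..b})"
      and dp: "(p i has_real_derivative \<epsilon> * y i x) (at x within {0..b})"
      if "i \<in> {1..n}" "x \<in> {0..b}" for i x
      using s that by (auto simp: sol_def)
    define kin where "kin = (\<lambda>x. \<Sum>i=1..n. (y i x)\<^sup>2 / 2)"
    define pot where "pot = (\<lambda>x. \<Sum>j\<in>{1..<n}. W j 0 (q p j x))"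
    have dkin: "(kin has_real_derivative (\<Sum>i=1..n. y i x * (\<epsilon> * total_force p y i x))) (at x within {0..b})"
      if "x \<in> {0..b}" for x
      unfolding kin_def
    proof (rule DERIV_sum)
      fix i assume "i \<in> {1..n}"
      then show "((\<lambda>x. (y i x)\<^sup>2 / 2) has_real_derivative y i x * (\<epsilon> * total_force p y i x)) (at x within {0..b})"
        using dy[of i x] that by (auto intro!: derivative_eq_intros)
    qed
    have cont_kin: "continuous_on {0..b} kin"
      using dkin by (rule continuous_on_of_derivative)
    \<comment> \<open>The primitive of the Lagrangian is split: \<open>kin\<close> varies slowly, so
      \<open>D \<Lambda>1\<close> is close to \<open>kin\<close>, whereas \<open>pot\<close>
      oscillates with the fast phase and \<open>D \<Lambda>2\<close> is only bounded.\<close>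
    define \<Lambda>1 where "\<Lambda>1 = (\<lambda>x. integral {0..x} kin)"
    have \<Lambda>1: "(\<Lambda>1 has_real_derivative kin x) (at x within {0..b})" if "x \<in> {0..b}" for x
      unfolding \<Lambda>1_def by (rule integral_has_real_derivative[OF cont_kin that])
    have cont_pot: "continuous_on {0..b} pot"
      unfolding pot_def
    proof (intro continuous_on_sum)
      fix j assume "j \<in> {1..<n}"
      then show "continuous_on {0..b} (\<lambda>x. W j 0 (q p j x))"
        using W_q_deriv[OF s, of _ j 0] by (intro continuous_on_of_derivative) auto
    qed
    define \<Lambda>2 where "\<Lambda>2 = (\<lambda>x. integral {0..x} pot)"
    have \<Lambda>2: "(\<Lambda>2 has_real_derivative pot x) (at x within {0..b})" if "x \<in> {0..b}" for x
      unfolding \<Lambda>2_def by (rule integral_has_real_derivative[OF cont_pot that])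
    let ?D = "\<lambda>f. ndiff N f"
    text \<open>The Poincare-Cartan action of the loop that follows the slow interpolation of the
      trajectory and returns along the trajectory itself.\<close>
    define Y where "Y = (\<lambda>x. (\<Sum>i=1..n. y i x * ?D (p i) x) / \<epsilon> - ?D \<Lambda>1 x + ?D \<Lambda>2 x)"
    define Y' where "Y' = (\<lambda>x. (\<Sum>i=1..n. total_force p y i x * ?D (p i) x + y i x * ?D (y i) x) - ?D kin x + ?D pot x)"
    let ?X = "{0..b - real N}"
    have X: "?X \<subseteq> {0..b}" by auto
    have dY: "(Y has_real_derivative Y' x) (at x within ?X)" if x: "x \<in> ?X" for x
    proof -
      have 1: "((\<lambda>x. y i x * ?D (p i) x) has_real_derivative
          \<epsilon> * (total_force p y i x * ?D (p i) x + y i x * ?D (y i) x)) (at x within ?X)" if i: "i \<in> {1..n}" for i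
      proof -
        have "(?D (p i) has_real_derivative ?D (\<lambda>s. \<epsilon> * y i s) x) (at x within ?X)"
          by (rule ndiff_has_real_derivative[OF dp[OF i] x])
        then have "(?D (p i) has_real_derivative \<epsilon> * ?D (y i) x) (at x within ?X)"
          by (simp only: ndiff_cmult)
        moreover have "(y i has_real_derivative \<epsilon> * total_force p y i x) (at x within ?X)"
          by (rule has_field_derivative_subset[OF dy[OF i] X]) (use x in auto)
        ultimately show ?thesis by (auto intro!: derivative_eq_intros simp: algebra_simps)
      qed
      have "((\<lambda>x. \<Sum>i=1..n. y i x * ?D (p i) x) has_real_derivative
          (\<Sum>i=1..n. \<epsilon> * (total_force p y i x * ?D (p i) x + y i x * ?D (y i) x))) (at x within ?X)"
        by (rule DERIV_sum[OF 1])
      then have "((\<lambda>x. \<Sum>i=1..n. y i x * ?D (p i) x) has_real_derivative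
          \<epsilon> * (\<Sum>i=1..n. total_force p y i x * ?D (p i) x + y i x * ?D (y i) x)) (at x within ?X)"
        by (simp only: sum_distrib_left)
      from DERIV_cdivide[OF this, of \<epsilon>]
      have 2: "((\<lambda>x. (\<Sum>i=1..n. y i x * ?D (p i) x) / \<epsilon>) has_real_derivative
          (\<Sum>i=1..n. total_force p y i x * ?D (p i) x + y i x * ?D (y i) x)) (at x within ?X)"
        using \<epsilon> by simp
      show ?thesis
        unfolding Y_def Y'_def
        by (intro DERIV_add DERIV_diff 2 ndiff_has_real_derivative[OF \<Lambda>1 x] ndiff_has_real_derivative[OF \<Lambda>2 x])
    qed
    have subX: "{x..x + real N} \<subseteq> {0..b}" if "x \<in> ?X" for x using that by auto
    have Y'_le: "Y' x \<le> C5 * \<epsilon> ^ Suc N" if x: "x \<in> ?X" for x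
    proof -
      have fdb: "\<bar>fdiff j (y i) x\<bar> \<le> K * \<epsilon> ^ j \<and> (1 \<le> j \<longrightarrow> \<bar>fdiff j (p i) x\<bar> \<le> K * \<epsilon> ^ j)"
        if "j \<le> N" "i \<in> {1..n}" for i j
      proof (rule K(2)[OF s that(1) _ _ that(2)])
        have "real j \<le> real N" using that(1) by (rule of_nat_mono)
        then show "x + real j \<le> b" using x by simp
      qed (use x in auto)
      have kin: "\<bar>?D kin x - (\<Sum>i=1..n. y i x * ?D (y i) x)\<bar> \<le> real n * (C1 * \<epsilon> ^ Suc N)"
      proof -
        have "?D kin x - (\<Sum>i=1..n. y i x * ?D (y i) x)
            = (\<Sum>i=1..n. ?D (\<lambda>z. (y i z)\<^sup>2 / 2) x - y i x * ?D (y i) x)"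
          by (simp add: kin_def ndiff_sum sum_subtractf)
        also have "\<bar>\<dots>\<bar> \<le> (\<Sum>i=1..n. \<bar>?D (\<lambda>z. (y i z)\<^sup>2 / 2) x - y i x * ?D (y i) x\<bar>)" by (rule sum_abs)
        also have "\<dots> \<le> (\<Sum>i=1..n. C1 * \<epsilon> ^ Suc N)"
          by (intro sum_mono C1(2)[OF \<epsilon>]) (use fdb in auto)
        finally show ?thesis by simp
      qed
      have pot: "\<bar>?D pot x - (\<Sum>j\<in>{1..<n}. W j 1 (q p j x) * (?D (p (Suc j)) x - ?D (p j) x))\<bar>
          \<le> real n * (C2 * \<epsilon> ^ Suc N)"
      proof -
        have "\<bar>?D (\<lambda>z. W j 0 (q p j z)) x - W j 1 (q p j x) * (?D (p (Suc j)) x - ?D (p j) x)\<bar>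
            \<le> C2 * \<epsilon> ^ Suc N" if j: "j \<in> {1..<n}" for j
        proof -
          have "?D (\<lambda>z. W j 0 (q p j z)) x = ?D (\<lambda>z. W j 0 (q_frozen p j x z)) x"
            by (rule ndiff_cong) (rule W_q_frozen[OF j])
          moreover have "W j 1 (q p j x) = W j 1 (q_frozen p j x x)"
            using W_q_frozen[OF j, of 1 p j x 0] by simp
          moreover have "?D (p (Suc j)) x - ?D (p j) x = ?D (q_frozen p j x) x"
            by (simp add: ndiff_q_frozen)
          moreover have "\<bar>?D (\<lambda>z. W j 0 (q_frozen p j x z)) x - W j 1 (q_frozen p j x x) * ?D (q_frozen p j x) x\<bar>
              \<le> C2 * \<epsilon> ^ Suc N"
          proof (rule C2(2)[OF \<epsilon>])
            show "\<forall>i. 1 \<le> i \<and> i \<le> N \<longrightarrow> \<bar>fdiff i (q_frozen p j x) x\<bar> \<le> 2 * K * \<epsilon> ^ i"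
            proof (intro allI impI)
              fix i assume i: "1 \<le> i \<and> i \<le> N"
              have "\<bar>fdiff i (p (Suc j)) x\<bar> \<le> K * \<epsilon> ^ i" "\<bar>fdiff i (p j) x\<bar> \<le> K * \<epsilon> ^ i"
                using fdb[of i] i j by auto
              then show "\<bar>fdiff i (q_frozen p j x) x\<bar> \<le> 2 * K * \<epsilon> ^ i" using i by (simp add: fdiff_q_frozen)
            qed
          qed (use j W_deriv W_bound in auto)
          ultimately show ?thesis by simp
        qed
        note each = this
        have eq: "?D pot x - (\<Sum>j\<in>{1..<n}. W j 1 (q p j x) * (?D (p (Suc j)) x - ?D (p j) x))
            = (\<Sum>j\<in>{1..<n}. ?D (\<lambda>z. W j 0 (q p j z)) x - W j 1 (q p j x) * (?D (p (Suc j)) x - ?D (p j) x))"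
          by (simp add: pot_def ndiff_sum sum_subtractf)
        have "(\<Sum>j\<in>{1..<n}. \<bar>?D (\<lambda>z. W j 0 (q p j z)) x - W j 1 (q p j x) * (?D (p (Suc j)) x - ?D (p j) x)\<bar>)
            \<le> (\<Sum>j\<in>{1..<n}. C2 * \<epsilon> ^ Suc N)"
          by (rule sum_mono) (rule each)
        also have "\<dots> \<le> real n * (C2 * \<epsilon> ^ Suc N)"
          unfolding sum_constant using C2 \<epsilon> by (intro mult_right_mono) auto
        finally show ?thesis
          unfolding eq by (rule order_trans[OF sum_abs])
      qed
      \<comment> \<open>The terms \<open>y i * D (y i)\<close> cancel against \<open>D kin\<close>
        and the work of the links against \<open>D pot\<close>, up to the two errors just bounded;
        only friction remains.\<close>
      have "Y' x = - (\<Sum>j\<in>{1..<n}. W j 1 (q p j x) * (?D (p (Suc j)) x - ?D (p j) x)) - \<gamma> * y 1 x * ?D (p 1) x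
          + (\<Sum>i=1..n. y i x * ?D (y i) x) - ?D kin x + ?D pot x"
        unfolding Y'_def sum.distrib sum_force by simp
      then have 1: "Y' x \<le> - \<gamma> * y 1 x * ?D (p 1) x + (real n * (C1 * \<epsilon> ^ Suc N) + real n * (C2 * \<epsilon> ^ Suc N))"
        using kin pot by linarith
      define d where "d = ?D (p 1) x - \<epsilon> * y 1 x"
      have d: "\<bar>d\<bar> \<le> C3 * \<epsilon> ^ k"
        unfolding d_def by (rule C3(2)[OF sol_subset[OF s subX[OF x]]])
      have "d\<^sup>2 \<le> (C3 * \<epsilon> ^ k)\<^sup>2" using d by (metis abs_ge_zero power2_abs power_mono)
      also have "\<dots> = C3\<^sup>2 * \<epsilon> ^ (2 * k)" by (simp add: power_mult_distrib power_mult mult.commute)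
      also have "2 * k = Suc (Suc N)" using k2 by (simp add: N_def)
      finally have d2: "d\<^sup>2 / \<epsilon> \<le> C3\<^sup>2 * \<epsilon> ^ Suc N"
        using \<epsilon> by (simp add: pos_divide_le_eq ac_simps)
      text \<open>The dissipation \<open>- \<epsilon> * (y 1 x)\<^sup>2\<close> absorbs the term linear in \<open>d\<close>.\<close>
      have "- (y 1 x * ?D (p 1) x) \<le> d\<^sup>2 / \<epsilon>"
      proof -
        have "0 \<le> (\<epsilon> * y 1 x + d / 2)\<^sup>2 + 3/4 * d\<^sup>2" by simp
        also have "\<dots> = \<epsilon> * (y 1 x * ?D (p 1) x + d\<^sup>2 / \<epsilon>)"
          using \<epsilon> by (simp add: d_def power2_eq_square field_simps)
        finally show ?thesis using \<epsilon> by (simp add: zero_le_mult_iff)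
      qed
      then have "\<gamma> * (- (y 1 x * ?D (p 1) x)) \<le> \<gamma> * (C3\<^sup>2 * \<epsilon> ^ Suc N)"
        using d2 \<gamma> by (intro mult_left_mono) auto
      then show ?thesis using 1 by (simp add: C5_def algebra_simps)
    qed
    \<comment> \<open>As \<open>D (p i)\<close> is close to \<open>\<epsilon> * y i\<close>, the sum
      in \<open>Y\<close> is close to \<open>2 * kin\<close>, and subtracting
      \<open>D \<Lambda>1\<close> leaves one \<open>kin\<close>.\<close>
    have Y_E: "\<bar>Y x - E p y x\<bar> \<le> C4 * \<epsilon> + cU" if x: "x \<in> ?X" for x
    proof -
      have xb: "x \<in> {0..b}" using x by auto
      note sub = has_field_derivative_subset[OF _ subX[OF x]]
      have in_b: "z \<in> {0..b}" if "z \<in> {x..x + real N}" for z using subX[OF x] that by blast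
      have p: "\<bar>y i x * (?D (p i) x - \<epsilon> * y i x)\<bar> \<le> R * (ndiff_norm N * (real N)\<^sup>2 * (\<epsilon>\<^sup>2 * F))" if i: "i \<in> {1..n}" for i
      proof -
        have "\<bar>?D (p i) x - \<epsilon> * y i x\<bar> \<le> ndiff_norm N * (real N)\<^sup>2 * (\<epsilon>\<^sup>2 * F)"
        proof (rule ndiff_second_order[of x _ "\<lambda>s. \<epsilon> * y i s" "\<lambda>z. \<epsilon>\<^sup>2 * total_force p y i z"])
          fix z assume z: "z \<in> {x..x + real N}"
          show "(p i has_real_derivative \<epsilon> * y i z) (at z within {x..x + real N})"
            by (rule sub[OF dp[OF i in_b[OF z]]])
          show "((\<lambda>s. \<epsilon> * y i s) has_real_derivative \<epsilon>\<^sup>2 * total_force p y i z) (at z within {x..x + real N})"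
            by (rule sub[OF y_deriv[OF s in_b[OF z] i]])
          show "\<bar>\<epsilon>\<^sup>2 * total_force p y i z\<bar> \<le> \<epsilon>\<^sup>2 * F"
            unfolding abs_mult F_def using total_force_bound[OF s in_b[OF z]] by (simp add: mult_left_mono)
        qed
        then show ?thesis unfolding abs_mult using yR[OF i xb] R by (intro mult_mono) auto
      qed
      have "\<bar>\<Sum>i=1..n. y i x * (?D (p i) x - \<epsilon> * y i x)\<bar> \<le> (\<Sum>i=1..n. \<bar>y i x * (?D (p i) x - \<epsilon> * y i x)\<bar>)"
        by (rule sum_abs)
      also have "\<dots> \<le> (\<Sum>i=1..n. R * (ndiff_norm N * (real N)\<^sup>2 * (\<epsilon>\<^sup>2 * F)))" by (intro sum_mono p)
      also have "\<dots> = real n * R * (ndiff_norm N * (real N)\<^sup>2 * F) * \<epsilon> * \<epsilon>" by (simp add: power2_eq_square)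
      finally have A: "\<bar>(\<Sum>i=1..n. y i x * (?D (p i) x - \<epsilon> * y i x)) / \<epsilon>\<bar>
          \<le> real n * R * (ndiff_norm N * (real N)\<^sup>2 * F) * \<epsilon>"
        using \<epsilon> by (simp add: pos_divide_le_eq)
      have Bk: "\<bar>?D \<Lambda>1 x - kin x\<bar> \<le> ndiff_norm N * (real N)\<^sup>2 * (real n * R * F * \<epsilon>)"
      proof (rule ndiff_second_order)
        fix z assume z: "z \<in> {x..x + real N}"
        show "(\<Lambda>1 has_real_derivative kin z) (at z within {x..x + real N})" by (rule sub[OF \<Lambda>1[OF in_b[OF z]]])
        show "(kin has_real_derivative (\<Sum>i=1..n. y i z * (\<epsilon> * total_force p y i z))) (at z within {x..x + real N})"
          by (rule sub[OF dkin[OF in_b[OF z]]])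
        have "\<bar>\<Sum>i=1..n. y i z * (\<epsilon> * total_force p y i z)\<bar> \<le> (\<Sum>i=1..n. \<bar>y i z * (\<epsilon> * total_force p y i z)\<bar>)"
          by (rule sum_abs)
        also have "\<dots> \<le> (\<Sum>i=1..n. R * (\<epsilon> * F))"
        proof (rule sum_mono)
          fix i assume "i \<in> {1..n}"
          then show "\<bar>y i z * (\<epsilon> * total_force p y i z)\<bar> \<le> R * (\<epsilon> * F)"
            unfolding abs_mult using yR in_b[OF z] total_force_bound[OF s in_b[OF z]] R \<epsilon>
            by (intro mult_mono) (auto simp: F_def)
        qed
        finally show "\<bar>\<Sum>i=1..n. y i z * (\<epsilon> * total_force p y i z)\<bar> \<le> real n * R * F * \<epsilon>" by (simp add: ac_simps)
      qed
      have pot_le: "\<bar>pot z\<bar> \<le> real n * B 0" for z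
      proof -
        have "\<bar>pot z\<bar> \<le> (\<Sum>j\<in>{1..<n}. \<bar>W j 0 (q p j z)\<bar>)" unfolding pot_def by (rule sum_abs)
        also have "\<dots> \<le> (\<Sum>j\<in>{1..<n}. B 0)" by (intro sum_mono W_bound)
        also have "\<dots> \<le> real n * B 0" 
          unfolding sum_constant using B_nonneg[of 0] by (intro mult_right_mono) auto
        finally show ?thesis .
      qed
      \<comment> \<open>A constant is invisible to \<open>D\<close>, so \<open>\<Lambda>2\<close>
        may be normalised at \<open>x\<close>; on the nodes it is then at most its Lipschitz
        constant times \<open>N\<close>.\<close>
      have "\<bar>?D (\<lambda>z. \<Lambda>2 z - \<Lambda>2 x) x\<bar> \<le> ndiff_norm N * (real n * B 0 * real N)"
      proof (rule ndiff_abs_le)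
        fix m assume m: "m \<le> N"
        then have "real m \<le> real N" by (rule of_nat_mono)
        then have xm: "x + real m \<in> {x..x + real N}" by simp
        have "norm (\<Lambda>2 (x + real m) - \<Lambda>2 x) \<le> real n * B 0 * norm (x + real m - x)"
          by (rule field_differentiable_bound[of "{0..b}" \<Lambda>2 pot]) (use \<Lambda>2 pot_le in_b[OF xm] xb in auto)
        also have "\<dots> \<le> real n * B 0 * real N" using m B_nonneg by (intro mult_left_mono) auto
        finally show "\<bar>\<Lambda>2 (x + real m) - \<Lambda>2 x\<bar> \<le> real n * B 0 * real N" by simp
      qed
      then have Bp: "\<bar>?D \<Lambda>2 x\<bar> \<le> real n * B 0 * (ndiff_norm N * real N)"
        by (simp add: ndiff_diff ndiff_const ac_simps)
      have "(\<Sum>i=1..n. y i x * (?D (p i) x - \<epsilon> * y i x)) / \<epsilon> = (\<Sum>i=1..n. y i x * ?D (p i) x) / \<epsilon> - 2 * kin x"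
      proof -
        have "(\<Sum>i=1..n. y i x * (?D (p i) x - \<epsilon> * y i x))
            = (\<Sum>i=1..n. y i x * ?D (p i) x) - \<epsilon> * (2 * kin x)"
          by (simp add: kin_def right_diff_distrib sum_subtractf sum_distrib_left power2_eq_square ac_simps)
        then show ?thesis using \<epsilon> by (simp add: diff_divide_distrib)
      qed
      then have "Y x - E p y x = (\<Sum>i=1..n. y i x * (?D (p i) x - \<epsilon> * y i x)) / \<epsilon>
          - (?D \<Lambda>1 x - kin x) + ?D \<Lambda>2 x - pot x"
        by (simp add: Y_def E_def kin_def pot_def)
      moreover have "C4 * \<epsilon> + cU = real n * R * (ndiff_norm N * (real N)\<^sup>2 * F) * \<epsilon>
          + ndiff_norm N * (real N)\<^sup>2 * (real n * R * F * \<epsilon>) + real n * B 0 + real n * B 0 * (ndiff_norm N * real N)"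
        by (simp add: C4_def cU_def algebra_simps)
      ultimately show ?thesis using A Bk Bp pot_le[of x] by linarith
    qed
    have mono: "Y s0 - Y 0 \<le> s0 * (C5 * \<epsilon> ^ Suc N)"
    proof (cases "s0 = 0")
      case False
      then have "\<exists>\<xi>\<in>{0<..<s0}. Y s0 - Y 0 = (s0 - 0) * Y' \<xi>"
        using s0 by (intro mvt_within has_field_derivative_subset[OF dY]) auto
      then obtain \<xi> where \<xi>: "\<xi> \<in> {0<..<s0}" "Y s0 - Y 0 = s0 * Y' \<xi>" by auto
      have "\<xi> \<in> ?X" using \<xi>(1) s0 by auto
      from Y'_le[OF this] show ?thesis unfolding \<xi>(2) using s0 by (intro mult_left_mono)
    qed simp
    have 0: "0 \<in> ?X" "s0 \<in> ?X" using s0 by auto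
    have "E p y s0 \<le> E p y 0 + s0 * (C5 * \<epsilon> ^ Suc N) + 2 * (C4 * \<epsilon> + cU)"
    proof -
      have *: "e \<le> e0 + t + 2 * r" if "Y1 - Y0 \<le> t" "\<bar>Y0 - e0\<bar> \<le> r" "\<bar>Y1 - e\<bar> \<le> r"
        for e e0 t r Y0 Y1 :: real using that by linarith
      show ?thesis by (rule *[OF mono Y_E[OF 0(1)] Y_E[OF 0(2)]])
    qed
    also have "\<dots> \<le> E p y 0 + 2 * cU + (2 * C4 + C5) * (\<epsilon> + s0 * \<epsilon> ^ Suc N)"
      using C4 C5 \<epsilon> s0 by (simp add: algebra_simps add_increasing)
    finally show "E p y s0 \<le> E p y 0 + 2 * cU + (2 * C4 + C5) * (\<epsilon> + s0 * \<epsilon> ^ Suc N)" .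
  qed
qed

section \<open>Confinement of the momenta\<close>

definition ode :: "real \<Rightarrow> real set \<Rightarrow> (nat \<Rightarrow> real \<Rightarrow> real) \<Rightarrow> (nat \<Rightarrow> real \<Rightarrow> real) \<Rightarrow> bool" where
  "ode \<epsilon> X p y \<longleftrightarrow> (\<forall>i\<in>{1..n}. \<forall>s\<in>X.
     (p i has_real_derivative \<epsilon> * y i s) (at s within X) \<and>
     (y i has_real_derivative \<epsilon> * total_force p y i s) (at s within X))"

lemma sol_iff:
  "sol \<epsilon> R X p y \<longleftrightarrow> 0 < \<epsilon> \<and> \<epsilon> \<le> 1 \<and> ode \<epsilon> X p y \<and> (\<forall>i\<in>{1..n}. \<forall>s\<in>X. \<bar>y i s\<bar> \<le> R)"
  by (auto simp: sol_def ode_def)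

lemma ode_subset: "ode \<epsilon> X p y \<Longrightarrow> Y \<subseteq> X \<Longrightarrow> ode \<epsilon> Y p y"
  unfolding ode_def by (blast intro: has_field_derivative_subset)

lemma potential_bound: "\<bar>\<Sum>j\<in>{1..<n}. W j 0 (q p j s)\<bar> \<le> real n * B 0"
proof -
  have "(\<Sum>j\<in>{1..<n}. \<bar>W j 0 (q p j s)\<bar>) \<le> (\<Sum>j\<in>{1..<n}. B 0)"
    by (intro sum_mono W_bound)
  also have "\<dots> \<le> real n * B 0"
    unfolding sum_constant using B_nonneg[of 0] by (intro mult_right_mono) auto
  finally show ?thesis by (rule order_trans[OF sum_abs])
qed

text \<open>Continuity argument at the first time \<open>s1\<close> when some momentum reaches
  \<open>R\<close>. The energy estimate is available only \<open>N\<close> units earlier, where it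
  gives the bound \<open>R - 1\<close>; in \<open>N\<close> units a momentum moves by less than 1,
  its speed being O(\<epsilon>).\<close>

lemma confinement:
  assumes \<rho>: "0 < \<rho>" and A: "0 \<le> A"
  shows "\<exists>R>\<rho>. \<exists>\<epsilon>0>0. \<epsilon>0 \<le> 1 \<and> (\<forall>\<epsilon> b p y. 0 < \<epsilon> \<longrightarrow> \<epsilon> \<le> \<epsilon>0 \<longrightarrow> b * \<epsilon> ^ N \<le> A \<longrightarrow>
     ode \<epsilon> {0..b} p y \<longrightarrow> (\<forall>i\<in>{1..n}. \<bar>y i 0\<bar> < \<rho>) \<longrightarrow> (\<forall>i\<in>{1..n}. \<forall>s\<in>{0..b}. \<bar>y i s\<bar> < R))"
proof -
  define cU where "cU = real n * B 0 * (1 + ndiff_norm N * real N)"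
  \<comment> \<open>Twice the sum of the initial kinetic energy, the potential at two times and the
    loss \<open>2 * cU\<close>: this bounds \<open>(y i)\<^sup>2\<close> up to terms in
    \<open>\<epsilon>\<close>, which use the extra 1 in \<open>Q + 1 \<le> (R - 1)\<^sup>2\<close>.
    As \<open>Q\<close> does not involve \<open>R\<close>, the choice of \<open>R\<close> is not
    circular.\<close>
  define Q where "Q = real n * \<rho>\<^sup>2 + 4 * (real n * B 0) + 4 * cU"
  define R where "R = Q + \<rho> + 3"
  have cU: "0 \<le> cU" using B_nonneg ndiff_norm_nonneg by (simp add: cU_def)
  have Q: "0 \<le> Q" using B_nonneg cU by (simp add: Q_def)
  have R: "\<rho> + 3 \<le> R" "0 \<le> R" using Q \<rho> by (auto simp: R_def)
  have "1 * (Q + 1) \<le> (R - 1) * (R - 1)" using Q \<rho> by (intro mult_mono) (auto simp: R_def)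
  then have QR: "Q + 1 \<le> (R - 1)\<^sup>2" by (simp add: power2_eq_square)
  obtain C where C: "0 \<le> C" "\<And>\<epsilon> b p y s. sol \<epsilon> R {0..b} p y \<Longrightarrow> 0 \<le> s \<Longrightarrow> s \<le> b - real N \<Longrightarrow>
     E p y s \<le> E p y 0 + 2 * cU + C * (\<epsilon> + s * \<epsilon> ^ Suc N)"
    using energy_estimate[OF R(2)] unfolding cU_def[symmetric] by blast
  define F where "F = 2 * B 1 + \<gamma> * R"
  have F: "0 \<le> F" using B_nonneg R \<gamma> by (simp add: F_def)
  \<comment> \<open>The second entry makes the error accumulated over the horizon at most 1 in
    \<open>(y i)\<^sup>2\<close>, the third makes the drift over \<open>N\<close> units less than
    1.\<close>
  define \<epsilon>0 where "\<epsilon>0 = min 1 (min (1 / (2 * C * (1 + A) + 1)) (1 / (2 * (real N * F + 1))))"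
  have p1: "0 < 2 * C * (1 + A) + 1" using C(1) A by (intro add_nonneg_pos) auto
  have p2: "0 < 2 * (real N * F + 1)" using F by (simp add: add_nonneg_pos)
  have \<epsilon>0: "0 < \<epsilon>0" "\<epsilon>0 \<le> 1" using p1 p2 by (auto simp: \<epsilon>0_def)
  show ?thesis
  proof (rule exI[of _ R], rule conjI, use R in simp, rule exI[of _ \<epsilon>0], intro conjI \<epsilon>0 allI impI)
    fix \<epsilon> b p y
    assume \<epsilon>: "0 < \<epsilon>" "\<epsilon> \<le> \<epsilon>0" and bA: "b * \<epsilon> ^ N \<le> A" and ode: "ode \<epsilon> {0..b} p y"
      and init: "\<forall>i\<in>{1..n}. \<bar>y i 0\<bar> < \<rho>"
    have \<epsilon>1: "\<epsilon> \<le> 1" using \<epsilon> \<epsilon>0 by simp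
    have "\<epsilon> \<le> 1 / (2 * C * (1 + A) + 1)" using \<epsilon> by (simp add: \<epsilon>0_def)
    then have "\<epsilon> * (2 * C * (1 + A) + 1) \<le> 1" using p1 by (simp only: pos_le_divide_eq)
    then have C\<epsilon>: "2 * (C * ((1 + A) * \<epsilon>)) \<le> 1" using \<epsilon>(1) by (simp add: algebra_simps)
    have "\<epsilon> \<le> 1 / (2 * (real N * F + 1))" using \<epsilon> by (simp add: \<epsilon>0_def)
    then have "\<epsilon> * (2 * (real N * F + 1)) \<le> 1" using p2 by (simp only: pos_le_divide_eq)
    then have F\<epsilon>: "\<epsilon> * F * real N < 1" using \<epsilon>(1) by (simp add: algebra_simps)
    have cont: "continuous_on {0..b} (y i)" if "i \<in> {1..n}" for i
      by (rule continuous_on_of_derivative[of _ _ "\<lambda>s. \<epsilon> * total_force p y i s"]) (use ode that in \<open>auto simp: ode_def\<close>)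
    define Z where "Z = (\<Union>i\<in>{1..n}. {s\<in>{0..b}. R \<le> \<bar>y i s\<bar>})"
    have "Z = {}"
    proof (rule ccontr)
      assume ne: "Z \<noteq> {}"
      have cl: "closed Z"
        unfolding Z_def
      proof (intro closed_UN ballI)
        fix i assume i: "i \<in> {1..n}"
        have "closed ({0..b} \<inter> (\<lambda>s. \<bar>y i s\<bar>) -` {R..})"
          using cont[OF i] by (intro continuous_closed_preimage continuous_on_rabs) auto
        moreover have "{0..b} \<inter> (\<lambda>s. \<bar>y i s\<bar>) -` {R..} = {s\<in>{0..b}. R \<le> \<bar>y i s\<bar>}" by auto
        ultimately show "closed {s\<in>{0..b}. R \<le> \<bar>y i s\<bar>}" by simp
      qed simp
      have bb: "bdd_below Z" by (rule bdd_belowI[of _ 0]) (auto simp: Z_def)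
      define s1 where "s1 = Inf Z"
      have "s1 \<in> Z" unfolding s1_def by (rule closed_contains_Inf[OF ne bb cl])
      then obtain i where i: "i \<in> {1..n}" "s1 \<in> {0..b}" "R \<le> \<bar>y i s1\<bar>" by (auto simp: Z_def)
      have before: "\<bar>y j s\<bar> < R" if "j \<in> {1..n}" "0 \<le> s" "s < s1" for j s
      proof (rule ccontr)
        assume "\<not> \<bar>y j s\<bar> < R"
        then have "s \<in> {s\<in>{0..b}. R \<le> \<bar>y j s\<bar>}" using that i by auto
        then have "s \<in> Z" unfolding Z_def using that(1) by blast
        then have "s1 \<le> s" unfolding s1_def by (rule cInf_lower[OF _ bb])
        then show False using that by simp
      qed
      have at_s1: "\<bar>y j s1\<bar> \<le> R" if j: "j \<in> {1..n}" for j
      proof (rule ccontr)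
        assume c: "\<not> \<bar>y j s1\<bar> \<le> R"
        have "\<exists>s\<ge>0. s \<le> s1 \<and> \<bar>y j s\<bar> = R"
        proof (rule IVT')
          show "\<bar>y j 0\<bar> \<le> R" using init j R by force
          show "continuous_on {0..s1} (\<lambda>s. \<bar>y j s\<bar>)"
            using i(2) by (intro continuous_on_rabs continuous_on_subset[OF cont[OF j]]) auto
        qed (use c i in auto)
        then obtain s where s: "0 \<le> s" "s \<le> s1" "\<bar>y j s\<bar> = R" by blast
        then have "s \<noteq> s1" using c by auto
        then show False using before[OF j s(1)] s by simp
      qed
      have sub: "{0..s1} \<subseteq> {0..b}" using i by auto
      have sol: "sol \<epsilon> R {0..s1} p y"
        unfolding sol_iff
      proof (intro conjI ballI)
        fix j s assume "j \<in> {1..n}" "s \<in> {0..s1}"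
        then show "\<bar>y j s\<bar> \<le> R" using before[of j s] at_s1[of j] by (cases "s = s1") auto
      qed (use \<epsilon> \<epsilon>1 ode_subset[OF ode sub] in auto)
      \<comment> \<open>If \<open>s1\<close> comes earlier than \<open>N\<close>, the initial
        condition takes the place of the energy estimate.\<close>
      define s0 where "s0 = max 0 (s1 - real N)"
      have s0: "0 \<le> s0" "s0 \<le> s1" "s1 - s0 \<le> real N" using i by (auto simp: s0_def)
      have y0: "\<bar>y i s0\<bar> \<le> R - 1"
      proof (cases "real N \<le> s1")
        case False
        then have "s0 = 0" by (simp add: s0_def)
        then show ?thesis using init i R by force
      next
        case True
        then have "s0 \<le> s1 - real N" by (simp add: s0_def)
        then have "E p y s0 \<le> E p y 0 + 2 * cU + C * (\<epsilon> + s0 * \<epsilon> ^ Suc N)"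
          using C(2)[OF sol] s0 by blast
        moreover have "C * (\<epsilon> + s0 * \<epsilon> ^ Suc N) \<le> C * ((1 + A) * \<epsilon>)"
        proof (rule mult_left_mono[OF _ C(1)])
          have "s0 * \<epsilon> ^ N \<le> b * \<epsilon> ^ N" using s0 i \<epsilon> by (intro mult_right_mono) auto
          from mult_right_mono[OF order_trans[OF this bA], of \<epsilon>]
          have "s0 * \<epsilon> ^ N * \<epsilon> \<le> A * \<epsilon>" using \<epsilon> by simp
          then show "\<epsilon> + s0 * \<epsilon> ^ Suc N \<le> (1 + A) * \<epsilon>" by (simp add: algebra_simps)
        qed
        moreover have "E p y 0 \<le> real n * \<rho>\<^sup>2 / 2 + real n * B 0"
        proof -
          have "(\<Sum>i=1..n. (y i 0)\<^sup>2 / 2) \<le> (\<Sum>i=1..n. \<rho>\<^sup>2 / 2)"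
          proof (rule sum_mono)
            fix j assume "j \<in> {1..n}"
            then have "\<bar>y j 0\<bar> \<le> \<bar>\<rho>\<bar>" using init \<rho> by force
            then show "(y j 0)\<^sup>2 / 2 \<le> \<rho>\<^sup>2 / 2" by (simp add: abs_le_square_iff)
          qed
          then show ?thesis using potential_bound[of p 0] by (simp add: E_def)
        qed
        moreover have "(y i s0)\<^sup>2 / 2 \<le> E p y s0 + real n * B 0"
        proof -
          have "(y i s0)\<^sup>2 / 2 \<le> (\<Sum>i=1..n. (y i s0)\<^sup>2 / 2)"
            using i(1) by (intro member_le_sum) auto
          then show ?thesis using potential_bound[of p s0] by (simp add: E_def abs_le_iff)
        qed
        ultimately have "(y i s0)\<^sup>2 \<le> Q + 2 * (C * ((1 + A) * \<epsilon>))" by (simp add: Q_def)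
        also have "\<dots> \<le> (R - 1)\<^sup>2" using C\<epsilon> QR by simp
        finally have "\<bar>y i s0\<bar> \<le> \<bar>R - 1\<bar>" by (simp add: abs_le_square_iff)
        then show ?thesis using R \<rho> by simp
      qed
      have "norm (y i s1 - y i s0) \<le> \<epsilon> * F * norm (s1 - s0)"
      proof (rule field_differentiable_bound[of "{0..s1}" "y i" "\<lambda>s. \<epsilon> * total_force p y i s"])
        fix s assume s: "s \<in> {0..s1}"
        show "(y i has_real_derivative \<epsilon> * total_force p y i s) (at s within {0..s1})"
          using sol i s by (auto simp: sol_def)
        show "norm (\<epsilon> * total_force p y i s) \<le> \<epsilon> * F"
          using total_force_bound[OF sol s, of i] \<epsilon> by (simp add: abs_mult F_def)
      qed (use s0 in auto)
      also have "\<dots> \<le> \<epsilon> * F * real N" using s0 F \<epsilon> by (intro mult_left_mono) auto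
      finally have "\<bar>y i s1 - y i s0\<bar> < 1" using F\<epsilon> by simp
      then show False using y0 i(3) by linarith
    qed
    then show "\<forall>i\<in>{1..n}. \<forall>s\<in>{0..b}. \<bar>y i s\<bar> < R" unfolding Z_def by (fastforce simp: not_le)
  qed
qed

section \<open>Energy balance\<close>

text \<open>The rotation of the fast phase changes the potential at the rate
  \<open>- 2 * pi * total_force p y k s\<close>, and the term in \<open>y k\<close> compensates
  exactly this; only friction is left.\<close>

lemma total_energy_deriv:
  assumes "ode \<epsilon> X p y" "s \<in> X" "0 < \<epsilon>"
  shows "((\<lambda>s. E p y s + 2 * pi / \<epsilon> * y k s) has_real_derivative - \<epsilon> * \<gamma> * (y 1 s)\<^sup>2) (at s within X)"
proof -
  have kinr: "k \<in> {1..n}" using k2 kn by auto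
  have dp: "(p i has_real_derivative \<epsilon> * y i s) (at s within X)"
    and dy: "(y i has_real_derivative \<epsilon> * total_force p y i s) (at s within X)" if "i \<in> {1..n}" for i
    using assms that by (auto simp: ode_def)
  have 1: "((\<lambda>s. \<Sum>i=1..n. (y i s)\<^sup>2 / 2) has_real_derivative (\<Sum>i=1..n. \<epsilon> * (total_force p y i s * y i s))) (at s within X)"
  proof (rule DERIV_sum)
    fix i assume "i \<in> {1..n}"
    then show "((\<lambda>s. (y i s)\<^sup>2 / 2) has_real_derivative \<epsilon> * (total_force p y i s * y i s)) (at s within X)"
      using dy[of i] by (auto intro!: derivative_eq_intros)
  qed
  have 2: "((\<lambda>s. \<Sum>j\<in>{1..<n}. W j 0 (q p j s)) has_real_derivative
      (\<Sum>j\<in>{1..<n}. \<epsilon> * (W j 1 (q p j s) * (y (Suc j) s - y j s)) + 2 * pi * (W j 1 (q p j s) * \<kappa> j))) (at s within X)"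
  proof (rule DERIV_sum)
    fix j assume j: "j \<in> {1..<n}"
    have "(q p j has_real_derivative (\<epsilon> * (y (Suc j) s - y j s) + 2 * pi * \<kappa> j)) (at s within X)"
      unfolding q_def[abs_def] using dp[of j] dp[of "Suc j"] j
      by (auto intro!: derivative_eq_intros simp: right_diff_distrib)
    from DERIV_chain2[OF W_deriv[OF j] this, of 0]
    show "((\<lambda>s. W j 0 (q p j s)) has_real_derivative
        \<epsilon> * (W j 1 (q p j s) * (y (Suc j) s - y j s)) + 2 * pi * (W j 1 (q p j s) * \<kappa> j)) (at s within X)"
      by (simp add: algebra_simps)
  qed
  have 3: "((\<lambda>s. 2 * pi / \<epsilon> * y k s) has_real_derivative 2 * pi / \<epsilon> * (\<epsilon> * total_force p y k s)) (at s within X)"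
    by (intro DERIV_cmult dy kinr)
  define a :: "nat \<Rightarrow> real" where "a i = (if i = k then 1 else 0)" for i
  have "total_force p y k s = (\<Sum>i=1..n. if i = k then total_force p y i s else 0)" using kinr by simp
  also have "\<dots> = (\<Sum>i=1..n. total_force p y i s * a i)" by (intro sum.cong) (auto simp: a_def)
  also have "\<dots> = - (\<Sum>j\<in>{1..<n}. W j 1 (q p j s) * (a (Suc j) - a j)) - \<gamma> * y 1 s * a 1"
    by (rule sum_force)
  also have "\<dots> = - (\<Sum>j\<in>{1..<n}. W j 1 (q p j s) * \<kappa> j)"
  proof -
    have "a (Suc j) - a j = \<kappa> j" for j by (auto simp: a_def \<kappa>_def)
    moreover have "a 1 = 0" using k2 by (simp add: a_def)
    ultimately show ?thesis by simp
  qed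
  finally have fk: "total_force p y k s = - (\<Sum>j\<in>{1..<n}. W j 1 (q p j s) * \<kappa> j)" .
  have fy: "(\<Sum>i=1..n. total_force p y i s * y i s)
      = - (\<Sum>j\<in>{1..<n}. W j 1 (q p j s) * (y (Suc j) s - y j s)) - \<gamma> * y 1 s * y 1 s"
    by (rule sum_force)
  have "(\<Sum>i=1..n. \<epsilon> * (total_force p y i s * y i s))
      + (\<Sum>j\<in>{1..<n}. \<epsilon> * (W j 1 (q p j s) * (y (Suc j) s - y j s)) + 2 * pi * (W j 1 (q p j s) * \<kappa> j))
      + 2 * pi / \<epsilon> * (\<epsilon> * total_force p y k s) = - \<epsilon> * \<gamma> * (y 1 s)\<^sup>2"
    unfolding sum.distrib sum_distrib_left[symmetric] fy fk
    using assms(3) by (simp add: power2_eq_square algebra_simps)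
  then show ?thesis
    unfolding E_def using DERIV_add[OF DERIV_add[OF 1 2] 3] by simp
qed

text \<open>The energy never increases, and each unit window costs at least
  \<open>\<gamma> * (\<epsilon> ^ N * \<theta>)\<^sup>2 / \<epsilon>\<close>; since
  \<open>1 \<le> b\<close>, at least \<open>b / 2\<close> whole windows fit in.\<close>

lemma dissipation:
  assumes R: "0 \<le> R"
  shows "\<exists>c>0. \<exists>\<epsilon>0>0. \<forall>\<epsilon> b p y. \<epsilon> \<le> \<epsilon>0 \<longrightarrow> sol \<epsilon> R {0..b} p y \<longrightarrow> 1 \<le> b \<longrightarrow>
    (E p y b + 2 * pi / \<epsilon> * y k b) - (E p y 0 + 2 * pi / \<epsilon> * y k 0) \<le> - (c * b * ((\<epsilon> ^ N)\<^sup>2 / \<epsilon>))"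
proof -
  obtain \<theta> \<epsilon>0 where \<theta>: "0 < \<theta>" "0 < \<epsilon>0" "\<And>\<epsilon> a p y. \<epsilon> \<le> \<epsilon>0 \<Longrightarrow> sol \<epsilon> R {a..a+1} p y \<Longrightarrow>
    (\<exists>u v. a \<le> u \<and> u < v \<and> v \<le> a + 1 \<and> (\<forall>\<xi>\<in>{u..v}. \<epsilon> ^ N * \<theta> / (v - u) < \<bar>\<epsilon> * y 1 \<xi>\<bar>))"
    using first_momentum_lower_bound[OF R] unfolding N_def by blast
  show ?thesis
  proof (rule exI[of _ "\<gamma> * \<theta>\<^sup>2 / 2"], rule conjI, use \<gamma> \<theta> in simp, rule exI[of _ \<epsilon>0], intro conjI \<theta>(2) allI impI)
    fix \<epsilon> b p y assume \<epsilon>0: "\<epsilon> \<le> \<epsilon>0" and s: "sol \<epsilon> R {0..b} p y" and b: "1 \<le> b"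
    have \<epsilon>: "0 < \<epsilon>" "\<epsilon> \<le> 1" and ode: "ode \<epsilon> {0..b} p y" using s by (auto simp: sol_iff)
    define H where "H = (\<lambda>s. E p y s + 2 * pi / \<epsilon> * y k s)"
    define d where "d = \<gamma> * (\<epsilon> ^ N * \<theta>)\<^sup>2 / \<epsilon>"
    have d: "0 \<le> d" using \<gamma> \<epsilon> by (simp add: d_def)
    have mv: "\<exists>\<xi>\<in>{u<..<v}. H v - H u = (v - u) * (- \<epsilon> * \<gamma> * (y 1 \<xi>)\<^sup>2)"
      if uv: "0 \<le> u" "u < v" "v \<le> b" for u v
    proof (rule mvt_within[OF uv(2)])
      fix x assume "x \<in> {u..v}"
      then show "(H has_real_derivative - \<epsilon> * \<gamma> * (y 1 x)\<^sup>2) (at x within {u..v})"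
        unfolding H_def using uv
        by (intro total_energy_deriv ode_subset[OF ode] \<epsilon>) auto
    qed
    have anti: "H v \<le> H u" if uv: "0 \<le> u" "u \<le> v" "v \<le> b" for u v
    proof (cases "u = v")
      case False
      then have "u < v" using uv by simp
      then obtain \<xi> where "H v - H u = (v - u) * (- \<epsilon> * \<gamma> * (y 1 \<xi>)\<^sup>2)"
        using mv[OF uv(1) _ uv(3)] by blast
      moreover have "0 \<le> (v - u) * (\<epsilon> * \<gamma> * (y 1 \<xi>)\<^sup>2)" using uv \<epsilon> \<gamma> by simp
      ultimately show ?thesis by simp
    qed simp
    have drop: "H (a + 1) \<le> H a - d" if a: "0 \<le> a" "a + 1 \<le> b" for a
    proof -
      have "sol \<epsilon> R {a..a+1} p y" by (rule sol_subset[OF s]) (use a in auto)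
      from \<theta>(3)[OF \<epsilon>0 this] obtain u v where uv: "a \<le> u" "u < v" "v \<le> a + 1"
        "\<And>\<xi>. \<xi> \<in> {u..v} \<Longrightarrow> \<epsilon> ^ N * \<theta> / (v - u) < \<bar>\<epsilon> * y 1 \<xi>\<bar>" by blast
      obtain \<xi> where \<xi>: "\<xi> \<in> {u<..<v}" "H v - H u = (v - u) * (- \<epsilon> * \<gamma> * (y 1 \<xi>)\<^sup>2)"
        using mv[of u v] uv(1-3) a by force
      \<comment> \<open>The first momentum is bounded below in two ways, with the factor
        \<open>1 / (v - u)\<close> dropped and with it kept. The product of the two bounds makes up
        for the length of \<open>{u..v}\<close>, however short.\<close>
      have "\<epsilon> ^ N * \<theta> \<le> \<epsilon> ^ N * \<theta> / (v - u)"
        using uv \<epsilon> \<theta>(1) by (simp add: pos_le_divide_eq mult_left_le)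
      then have 1: "\<epsilon> ^ N * \<theta> \<le> \<bar>\<epsilon> * y 1 \<xi>\<bar>" using uv(4)[of \<xi>] \<xi>(1) by force
      have 2: "\<epsilon> ^ N * \<theta> \<le> (v - u) * \<bar>\<epsilon> * y 1 \<xi>\<bar>"
        using uv(4)[of \<xi>] \<xi>(1) uv(2) by (simp add: pos_divide_less_eq mult.commute)
      have "0 \<le> \<epsilon> ^ N * \<theta>" "0 \<le> (v - u) * \<bar>\<epsilon> * y 1 \<xi>\<bar>" using \<epsilon> \<theta>(1) uv(2) by auto
      from mult_mono[OF 2 1 this(2,1)]
      have "(\<epsilon> ^ N * \<theta>) * (\<epsilon> ^ N * \<theta>) \<le> ((v - u) * \<bar>\<epsilon> * y 1 \<xi>\<bar>) * \<bar>\<epsilon> * y 1 \<xi>\<bar>" .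
      then have "(\<epsilon> ^ N * \<theta>)\<^sup>2 \<le> (v - u) * (\<epsilon> * y 1 \<xi>)\<^sup>2"
        by (simp add: power2_eq_square mult.assoc flip: abs_mult)
      then have "\<gamma> * (\<epsilon> ^ N * \<theta>)\<^sup>2 / \<epsilon> \<le> \<gamma> * ((v - u) * (\<epsilon> * y 1 \<xi>)\<^sup>2) / \<epsilon>"
        using \<gamma> \<epsilon> by (intro divide_right_mono mult_left_mono) auto
      also have "\<dots> = (v - u) * (\<epsilon> * \<gamma> * (y 1 \<xi>)\<^sup>2)"
        using \<epsilon> by (simp add: power2_eq_square)
      finally have "H v \<le> H u - d" using \<xi>(2) by (simp add: d_def)
      then show ?thesis using anti[of a u] anti[of v "a + 1"] uv a by linarith
    qed
    have steps: "H (real m) \<le> H 0 - real m * d" if "real m \<le> b" for m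
      using that
    proof (induction m)
      case (Suc m)
      then have "H (real m + 1) \<le> H (real m) - d" by (intro drop) auto
      then show ?case using Suc by (simp add: algebra_simps)
    qed simp
    define m where "m = nat \<lfloor>b\<rfloor>"
    have "1 \<le> \<lfloor>b\<rfloor>" using b by (simp add: le_floor_iff)
    then have "real m = of_int \<lfloor>b\<rfloor>" "1 \<le> real_of_int \<lfloor>b\<rfloor>" by (simp_all add: m_def)
    then have m: "real m \<le> b" "b / 2 \<le> real m" using floor_correct[of b] by linarith+
    have "H b \<le> H 0 - real m * d" using steps[OF m(1)] anti[of "real m" b] m(1) by auto
    moreover have "b / 2 * d \<le> real m * d" using m(2) d by (rule mult_right_mono)
    moreover have "b / 2 * d = \<gamma> * \<theta>\<^sup>2 / 2 * b * ((\<epsilon> ^ N)\<^sup>2 / \<epsilon>)"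
      by (simp add: d_def power_mult_distrib)
    ultimately show "E p y b + 2 * pi / \<epsilon> * y k b - (E p y 0 + 2 * pi / \<epsilon> * y k 0)
        \<le> - (\<gamma> * \<theta>\<^sup>2 / 2 * b * ((\<epsilon> ^ N)\<^sup>2 / \<epsilon>))"
      by (simp add: H_def)
  qed
qed

section \<open>Return to the original variables\<close>

lemma force_eq_deriv_Ham:
  assumes i: "i \<in> {1..n}" and U: "\<And>j. j \<in> {1..<n} \<Longrightarrow> U j = W j 0"
    and q: "\<And>j. q p j s = \<phi> (Suc j) - \<phi> j"
  shows "deriv (\<lambda>z. Ham n U J (\<phi>(i := z))) (\<phi> i) = u p (i - 1) s - u p i s"
proof (rule DERIV_imp_deriv)
  have n1: "{1..n-1} = {1..<n}" using k2 kn by auto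
  have "((\<lambda>z. \<Sum>j\<in>{1..<n}. W j 0 ((\<phi>(i := z)) (Suc j) - (\<phi>(i := z)) j)) has_real_derivative
     (\<Sum>j\<in>{1..<n}. W j 1 (q p j s) * ((if Suc j = i then 1 else 0) - (if j = i then 1 else 0)))) (at (\<phi> i))"
  proof (rule DERIV_sum)
    fix j assume j: "j \<in> {1..<n}"
    have "((\<lambda>z. (\<phi>(i := z)) (Suc j) - (\<phi>(i := z)) j) has_real_derivative
        (if Suc j = i then 1 else 0) - (if j = i then 1 else 0)) (at (\<phi> i))"
      by (auto intro!: derivative_eq_intros)
    from DERIV_chain2[OF W_deriv[OF j, of 0] this]
    show "((\<lambda>z. W j 0 ((\<phi>(i := z)) (Suc j) - (\<phi>(i := z)) j)) has_real_derivative
        W j 1 (q p j s) * ((if Suc j = i then 1 else 0) - (if j = i then 1 else 0))) (at (\<phi> i))"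
      by (simp add: q)
  qed
  also have "(\<Sum>j\<in>{1..<n}. W j 1 (q p j s) * ((if Suc j = i then 1 else 0) - (if j = i then 1 else 0)))
      = u p (i - 1) s - u p i s"
  proof -
    have "(\<Sum>j\<in>{1..<n}. W j 1 (q p j s) * ((if Suc j = i then 1 else 0) - (if j = i then 1 else 0)))
       = (\<Sum>j\<in>{1..<n}. if j = i - 1 then W j 1 (q p j s) else 0) - (\<Sum>j\<in>{1..<n}. if j = i then W j 1 (q p j s) else 0)"
      unfolding sum_subtractf[symmetric] using i by (intro sum.cong) auto
    also have "\<dots> = u p (i - 1) s - u p i s" using i by (auto simp: u_def)
    finally show ?thesis .
  qed
  finally have d: "((\<lambda>z. \<Sum>j\<in>{1..<n}. W j 0 ((\<phi>(i := z)) (Suc j) - (\<phi>(i := z)) j)) has_real_derivative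
     u p (i - 1) s - u p i s) (at (\<phi> i))" .
  have eq: "(\<lambda>z. Ham n U J (\<phi>(i := z)))
      = (\<lambda>z. 1/2 * (\<Sum>i=1..n. (J i)\<^sup>2) + (\<Sum>j\<in>{1..<n}. W j 0 ((\<phi>(i := z)) (Suc j) - (\<phi>(i := z)) j)))"
    unfolding Ham_def n1 using U by (intro ext arg_cong2[of _ _ _ _ "(+)"] refl sum.cong) auto
  show "((\<lambda>z. Ham n U J (\<phi>(i := z))) has_real_derivative u p (i - 1) s - u p i s) (at (\<phi> i))"
    unfolding eq using DERIV_add[OF DERIV_const d] by simp
qed

text \<open>\<open>\<epsilon> * L = 2 * pi\<close> makes the unperturbed fast rotator turn exactly
  once per unit of \<open>s\<close>, so \<open>L\<close> disappears from the equation for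
  \<open>p k\<close>. In the energy it survives in the cross term \<open>L * y k\<close> of
  \<open>(y k + L)\<^sup>2 / 2\<close>.\<close>

lemma scaled_is_solution:
  assumes sol: "is_solution n U \<gamma> T I \<phi>" and U: "\<And>j. j \<in> {1..<n} \<Longrightarrow> U j = W j 0"
    and \<epsilon>: "0 < \<epsilon>" "\<epsilon> * L = 2 * pi"
  defines "p \<equiv> \<lambda>i s. \<phi> (\<epsilon> * s) i - (if i = k then 2 * pi * s else 0)"
    and "y \<equiv> \<lambda>i s. I (\<epsilon> * s) i - (if i = k then L else 0)"
  shows "ode \<epsilon> {0..T / \<epsilon>} p y" and "Ham n U (I (\<epsilon> * s)) (\<phi> (\<epsilon> * s)) = E p y s + 2 * pi / \<epsilon> * y k s + L\<^sup>2 / 2"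
proof -
  have q: "q p j s = \<phi> (\<epsilon> * s) (Suc j) - \<phi> (\<epsilon> * s) j" for j s
    by (auto simp: q_def p_def \<kappa>_def)
  let ?X = "{0..T / \<epsilon>}"
  have chain: "((\<lambda>s. f (\<epsilon> * s)) has_real_derivative d * \<epsilon>) (at s within ?X)"
    if "(f has_real_derivative d) (at (\<epsilon> * s) within {0..T})" "s \<in> ?X" for f d s
  proof -
    have "(f has_real_derivative d) (at (\<epsilon> * s) within (\<lambda>s. \<epsilon> * s) ` ?X)"
      by (rule has_field_derivative_subset[OF that(1)]) (use \<epsilon> in \<open>auto simp: field_simps\<close>)
    then have "(f \<circ> (\<lambda>s. \<epsilon> * s) has_real_derivative d * \<epsilon>) (at s within ?X)"
      by (rule DERIV_image_chain) (auto intro!: derivative_eq_intros)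
    then show ?thesis by (simp add: o_def)
  qed
  show "ode \<epsilon> {0..T / \<epsilon>} p y"
    unfolding ode_def
  proof (intro ballI conjI)
    fix i s assume i: "i \<in> {1..n}" and s: "s \<in> ?X"
    have es: "\<epsilon> * s \<in> {0..T}" using s \<epsilon> by (auto simp: field_simps)
    have dI: "((\<lambda>s. I s i) has_real_derivative
           (- deriv (\<lambda>z. Ham n U (I (\<epsilon> * s)) ((\<phi> (\<epsilon> * s))(i := z))) (\<phi> (\<epsilon> * s) i)
            - (if i = 1 then \<gamma> * I (\<epsilon> * s) 1 else 0))) (at (\<epsilon> * s) within {0..T})"
      and d\<phi>: "((\<lambda>s. \<phi> s i) has_real_derivative I (\<epsilon> * s) i) (at (\<epsilon> * s) within {0..T})"
      using sol i es by (auto simp: is_solution_def)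
    have "((\<lambda>s. \<phi> (\<epsilon> * s) i - (if i = k then 2 * pi * s else 0)) has_real_derivative
        I (\<epsilon> * s) i * \<epsilon> - (if i = k then 2 * pi else 0)) (at s within ?X)"
      using chain[OF d\<phi> s] by (auto intro!: derivative_eq_intros)
    moreover have "I (\<epsilon> * s) i * \<epsilon> - (if i = k then 2 * pi else 0) = \<epsilon> * y i s"
      using \<epsilon>(2) by (auto simp: y_def algebra_simps)
    ultimately show "(p i has_real_derivative \<epsilon> * y i s) (at s within ?X)" by (simp add: p_def)
    have "((\<lambda>s. I (\<epsilon> * s) i - (if i = k then L else 0)) has_real_derivative
        (- deriv (\<lambda>z. Ham n U (I (\<epsilon> * s)) ((\<phi> (\<epsilon> * s))(i := z))) (\<phi> (\<epsilon> * s) i)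
            - (if i = 1 then \<gamma> * I (\<epsilon> * s) 1 else 0)) * \<epsilon> - 0) (at s within ?X)"
      by (intro DERIV_diff chain[OF dI s]) auto
    \<comment> \<open>Friction acts on a slow rotator: as \<open>k \<ge> 2\<close>,
      \<open>I (\<epsilon> * s) 1\<close> is \<open>y 1 s\<close>.\<close>
    moreover have "- deriv (\<lambda>z. Ham n U (I (\<epsilon> * s)) ((\<phi> (\<epsilon> * s))(i := z))) (\<phi> (\<epsilon> * s) i)
            - (if i = 1 then \<gamma> * I (\<epsilon> * s) 1 else 0) = total_force p y i s"
      using force_eq_deriv_Ham[OF i U q] k2 by (auto simp: total_force_def y_def)
    ultimately show "(y i has_real_derivative \<epsilon> * total_force p y i s) (at s within ?X)"
      by (simp add: y_def mult.commute)
  qed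
  have n1: "{1..n-1} = {1..<n}" using k2 kn by auto
  have kinr: "k \<in> {1..n}" using k2 kn by auto
  have "1/2 * (\<Sum>i=1..n. (I (\<epsilon> * s) i)\<^sup>2) = (\<Sum>i=1..n. (y i s)\<^sup>2 / 2 + (if i = k then L * y i s + L\<^sup>2 / 2 else 0))"
    unfolding sum_distrib_left by (intro sum.cong) (auto simp: y_def power2_eq_square field_simps)
  also have "\<dots> = (\<Sum>i=1..n. (y i s)\<^sup>2 / 2) + (L * y k s + L\<^sup>2 / 2)"
    using kinr by (simp add: sum.distrib)
  also have "L * y k s = 2 * pi / \<epsilon> * y k s" using \<epsilon> by (simp add: field_simps)
  finally have "1/2 * (\<Sum>i=1..n. (I (\<epsilon> * s) i)\<^sup>2) = (\<Sum>i=1..n. (y i s)\<^sup>2 / 2) + (2 * pi / \<epsilon> * y k s + L\<^sup>2 / 2)" .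
  moreover have "(\<Sum>i=1..n-1. U i (\<phi> (\<epsilon> * s) (Suc i) - \<phi> (\<epsilon> * s) i)) = (\<Sum>j\<in>{1..<n}. W j 0 (q p j s))"
    unfolding n1 by (intro sum.cong) (auto simp: q U)
  ultimately show "Ham n U (I (\<epsilon> * s)) (\<phi> (\<epsilon> * s)) = E p y s + 2 * pi / \<epsilon> * y k s + L\<^sup>2 / 2"
    by (simp add: Ham_def E_def)
qed

text \<open>The radius is the \<open>R\<close> of the confinement, and the powers of
  \<open>2 * pi\<close> come from replacing \<open>\<epsilon>\<close> by
  \<open>2 * pi / L\<close>.\<close>

lemma breather_energy_loss:
  fixes \<alpha> \<rho> :: real
  assumes U: "\<And>j. j \<in> {1..<n} \<Longrightarrow> U j = W j 0" and \<alpha>: "0 < \<alpha>" and \<rho>: "0 < \<rho>"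
  shows "\<exists>L0 \<rho>s C1. L0 > 0 \<and> \<rho>s > 0 \<and> C1 > 0 \<and>
     (\<forall>L \<ge> L0. \<forall>I phi.
        let T = \<alpha> * L ^ (2*k - 3) in
        in_B n k L \<rho> (I 0) \<and> is_solution n U \<gamma> T I phi \<longrightarrow>
          (\<forall>t\<in>{0..T}. in_B n k L \<rho>s (I t)) \<and>
          Ham n U (I T) (phi T) - Ham n U (I 0) (phi 0) \<le> - C1 * T / L ^ (4*k - 6))"
proof -
  \<comment> \<open>The exact value of \<open>b * \<epsilon> ^ N\<close>, where
    \<open>b = T / \<epsilon>\<close> is the horizon in \<open>s\<close>.\<close>
  define A where "A = \<alpha> * (2 * pi) ^ (2 * k - 3)"
  have A: "0 < A" using \<alpha> by (simp add: A_def)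
  obtain R e1 where R: "\<rho> < R" "0 < e1" "e1 \<le> 1" "\<And>\<epsilon> b p y i s. 0 < \<epsilon> \<Longrightarrow> \<epsilon> \<le> e1 \<Longrightarrow> b * \<epsilon> ^ N \<le> A \<Longrightarrow>
     ode \<epsilon> {0..b} p y \<Longrightarrow> (\<forall>i\<in>{1..n}. \<bar>y i 0\<bar> < \<rho>) \<Longrightarrow> i \<in> {1..n} \<Longrightarrow> s \<in> {0..b} \<Longrightarrow> \<bar>y i s\<bar> < R"
    using confinement[OF \<rho> less_imp_le[OF A]] by blast
  have R0: "0 \<le> R" using R \<rho> by simp
  obtain c e2 where c: "0 < c" "0 < e2" "\<And>\<epsilon> b p y. \<epsilon> \<le> e2 \<Longrightarrow> sol \<epsilon> R {0..b} p y \<Longrightarrow> 1 \<le> b \<Longrightarrow>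
    (E p y b + 2 * pi / \<epsilon> * y k b) - (E p y 0 + 2 * pi / \<epsilon> * y k 0) \<le> - (c * b * ((\<epsilon> ^ N)\<^sup>2 / \<epsilon>))"
    using dissipation[OF R0] by blast
  \<comment> \<open>The bound by \<open>A\<close> provides at least one full window:
    \<open>\<epsilon> ^ N \<le> \<epsilon> \<le> A = b * \<epsilon> ^ N\<close>, hence
    \<open>1 \<le> b\<close>.\<close>
  define e where "e = min (min e1 e2) A"
  have e: "0 < e" "e \<le> e1" "e \<le> e2" "e \<le> A" using R c A by (auto simp: e_def)
  show ?thesis
  proof (rule exI[of _ "2 * pi / e"], rule exI[of _ R], rule exI[of _ "c * (2 * pi) ^ (4 * k - 6)"],
      intro conjI allI impI)
    show "0 < 2 * pi / e" "0 < R" "0 < c * (2 * pi) ^ (4 * k - 6)" using e R \<rho> c by auto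
    fix L :: real and I \<phi> assume L: "2 * pi / e \<le> L"
    have L0: "0 < L" using L e by (smt (verit) divide_pos_pos pi_gt_zero)
    define \<epsilon> where "\<epsilon> = 2 * pi / L"
    have \<epsilon>: "0 < \<epsilon>" "\<epsilon> \<le> e" "\<epsilon> * L = 2 * pi" "L = 2 * pi / \<epsilon>"
      using L L0 e by (auto simp: \<epsilon>_def field_simps)
    define T where "T = \<alpha> * L ^ (2 * k - 3)"
    have T: "0 < T" using \<alpha> L0 by (simp add: T_def)
    define b where "b = T / \<epsilon>"
    have bN: "b * \<epsilon> ^ N = A"
    proof -
      have "N = Suc (2 * k - 3)" using k2 by (simp add: N_def)
      then have "b * \<epsilon> ^ N = \<alpha> * (L * \<epsilon>) ^ (2 * k - 3)"
        using \<epsilon>(1) by (simp add: b_def T_def power_mult_distrib)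
      then show ?thesis using \<epsilon>(3) by (simp add: A_def mult.commute)
    qed
    have b1: "1 \<le> b"
    proof -
      have "\<epsilon> ^ N \<le> \<epsilon> ^ 1" using \<epsilon> e R N_bounds by (intro power_decreasing) auto
      then have "\<epsilon> ^ N \<le> b * \<epsilon> ^ N" using bN \<epsilon> e by simp
      then show ?thesis using \<epsilon> by simp
    qed
    show "let T = \<alpha> * L ^ (2*k - 3) in
        in_B n k L \<rho> (I 0) \<and> is_solution n U \<gamma> T I \<phi> \<longrightarrow>
          (\<forall>t\<in>{0..T}. in_B n k L R (I t)) \<and>
          Ham n U (I T) (\<phi> T) - Ham n U (I 0) (\<phi> 0) \<le> - (c * (2 * pi) ^ (4 * k - 6)) * T / L ^ (4*k - 6)"
      unfolding Let_def T_def[symmetric]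
    proof (intro impI conjI ballI; elim conjE)
      assume inB: "in_B n k L \<rho> (I 0)" and sol: "is_solution n U \<gamma> T I \<phi>"
      define p where "p = (\<lambda>i s. \<phi> (\<epsilon> * s) i - (if i = k then 2 * pi * s else 0))"
      define y where "y = (\<lambda>i s. I (\<epsilon> * s) i - (if i = k then L else 0))"
      have ode: "ode \<epsilon> {0..b} p y"
        using scaled_is_solution(1)[OF sol U \<epsilon>(1,3)] by (simp add: b_def p_def y_def)
      have init: "\<forall>i\<in>{1..n}. \<bar>y i 0\<bar> < \<rho>" using inB by (auto simp: in_B_def y_def)
      have bound: "\<bar>y i s\<bar> < R" if "i \<in> {1..n}" "s \<in> {0..b}" for i s
        using R(4)[OF \<epsilon>(1) _ _ ode init that] \<epsilon> e bN by simp
      {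
        fix t assume t: "t \<in> {0..T}"
        have "t / \<epsilon> \<in> {0..b}" using t \<epsilon> by (auto simp: b_def divide_right_mono)
        from bound[OF _ this] show "in_B n k L R (I t)"
          unfolding in_B_def using \<epsilon>(1) by (auto simp only: y_def nonzero_mult_div_cancel_left times_divide_eq_right)
      }
      have solR: "sol \<epsilon> R {0..b} p y"
        unfolding sol_iff using \<epsilon> e R ode bound by (auto intro: less_imp_le)
      have "Ham n U (I T) (\<phi> T) - Ham n U (I 0) (\<phi> 0)
          = (E p y b + 2 * pi / \<epsilon> * y k b) - (E p y 0 + 2 * pi / \<epsilon> * y k 0)"
        using scaled_is_solution(2)[OF sol U \<epsilon>(1,3), of b] scaled_is_solution(2)[OF sol U \<epsilon>(1,3), of 0] \<epsilon>
        by (simp add: p_def y_def b_def)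
      also have "\<dots> \<le> - (c * b * ((\<epsilon> ^ N)\<^sup>2 / \<epsilon>))"
        using \<epsilon> e by (intro c(3)[OF _ solR b1]) simp
      also have "c * b * ((\<epsilon> ^ N)\<^sup>2 / \<epsilon>) = c * (2 * pi) ^ (4 * k - 6) * T / L ^ (4 * k - 6)"
      proof -
        \<comment> \<open>The two powers split off cancel the \<open>1 / \<epsilon>\<close> of the
          dissipation rate and the \<open>1 / \<epsilon>\<close> in
          \<open>b = T / \<epsilon>\<close>.\<close>
        have "(\<epsilon> ^ N)\<^sup>2 = \<epsilon> ^ (4 * k - 6) * \<epsilon>\<^sup>2"
        proof -
          have "N * 2 = (4 * k - 6) + 2" using k2 by (simp add: N_def)
          then show ?thesis by (metis power_add power_mult)
        qed
        then have "c * b * ((\<epsilon> ^ N)\<^sup>2 / \<epsilon>) = c * T * \<epsilon> ^ (4 * k - 6)"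
          using \<epsilon> by (simp add: b_def power2_eq_square)
        also have "\<epsilon> ^ (4 * k - 6) = (2 * pi) ^ (4 * k - 6) / L ^ (4 * k - 6)"
          by (simp add: \<epsilon>_def power_divide)
        finally show ?thesis by (simp add: ac_simps)
      qed
      finally show "Ham n U (I T) (\<phi> T) - Ham n U (I 0) (\<phi> 0)
          \<le> - (c * (2 * pi) ^ (4 * k - 6)) * T / L ^ (4 * k - 6)" by simp
    qed
  qed
qed

end

theorem theorem2p4:
  fixes n k :: nat and U :: "nat \<Rightarrow> real \<Rightarrow> real" and \<gamma> \<alpha> \<rho> :: real
  assumes "n \<ge> 2" and "2 \<le> k" and "k \<le> n"
    and "\<forall>i\<in>{1..n-1}. finite_fourier_no_const (U i) \<and> nondegenerate (U i)"
    and "\<gamma> > 0" and "\<alpha> > 0" and "\<rho> > 0"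
  shows "\<exists>L0 \<rho>s C1. L0 > 0 \<and> \<rho>s > 0 \<and> C1 > 0 \<and>
     (\<forall>L \<ge> L0. \<forall>I phi.
        let T = \<alpha> * L ^ (2*k - 3) in
        in_B n k L \<rho> (I 0) \<and> is_solution n U \<gamma> T I phi \<longrightarrow>
          (\<forall>t\<in>{0..T}. in_B n k L \<rho>s (I t)) \<and>
          Ham n U (I T) (phi T) - Ham n U (I 0) (phi 0) \<le> - C1 * T / L ^ (4*k - 6))"
proof -
  have n1: "{1..n-1} = {1..<n}" using assms(1) by auto
  have "\<exists>g c. i \<in> {1..<n} \<longrightarrow> g 0 = U i \<and> (\<forall>j x. (g j has_real_derivative g (Suc j) x) (at x)) \<and>
    (\<forall>j x. \<bar>g j x\<bar> \<le> c j) \<and> (\<forall>j x. g j (x + 2 * pi) = (g j x :: real))" for i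
  proof (cases "i \<in> {1..<n}")
    case True
    then have "finite_fourier_no_const (U i)" using assms(4) unfolding n1 by blast
    from finite_fourier_derivatives[OF this] show ?thesis by blast
  qed blast
  then obtain W c where W: "\<And>i. i \<in> {1..<n} \<Longrightarrow> W i 0 = U i"
    "\<And>i j x. i \<in> {1..<n} \<Longrightarrow> (W i j has_real_derivative W i (Suc j) x) (at x)"
    "\<And>i j x. i \<in> {1..<n} \<Longrightarrow> \<bar>W i j x\<bar> \<le> c i j"
    "\<And>i j x. i \<in> {1..<n} \<Longrightarrow> W i j (x + 2 * pi) = W i j x" by metis
  obtain c0 where c0: "0 < c0" "\<forall>i\<in>{1..<n}. \<forall>x. c0 \<le> \<bar>W i 1 x\<bar> + \<bar>W i 2 x\<bar>"
    using ex_common_lower_bound[of "{1..<n}" "\<lambda>i x. \<bar>W i 1 x\<bar> + \<bar>W i 2 x\<bar>"]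
      nondegenerate_gap W assms(4) unfolding n1 by (metis finite_atLeastLessThan)
  \<comment> \<open>Summing absolute values dominates each \<open>c i j\<close>, so one bound serves
    all links.\<close>
  have "\<bar>W i j x\<bar> \<le> (\<Sum>i\<in>{1..<n}. \<bar>c i j\<bar>)" if "i \<in> {1..<n}" for i j x
  proof -
    have "\<bar>W i j x\<bar> \<le> \<bar>c i j\<bar>" using W(3)[OF that, of j x] by linarith
    also have "\<dots> \<le> (\<Sum>i\<in>{1..<n}. \<bar>c i j\<bar>)" using that by (intro member_le_sum) auto
    finally show ?thesis .
  qed
  then interpret rotator_chain n k W "\<lambda>j. \<Sum>i\<in>{1..<n}. \<bar>c i j\<bar>" \<gamma> c0
    using assms W c0 by unfold_locales auto
  show ?thesis
    by (rule breather_energy_loss) (use W(1) assms in auto)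
qed

end
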